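(* For each $n\ge 1$ let $A_n$ be a nonempty subset of $S_n$ which is invariant under conjugation and such that all $\pi\in A_n$ have the same number of fixed points. Denote by $\alpha_{1,n}$ the common density of fixed points (number of fixed points divided by $n$) of the elements of $A_n$, and let $$W_n=\left(\frac{d(\pi)-\frac{1-\alpha_{1,n}^2}{2}n}{n^{1/2}},\ \frac{\mathrm{maj}(\pi)-\frac{1-\alpha_{1,n}^2}{4}n^2}{n^{3/2}}\right),$$ where $\pi$ is chosen uniformly at random from $A_n$. If $\alpha_{1,n}\to\alpha\in[0,1]$ as $n\to\infty$, then $W_n$ converges in distribution to a bivariate normal distribution with zero mean and covariance matrix $\Sigma_\alpha$.
   Context: For $\pi\in S_n$, a descent is a position $i\in\{1,\dots,n-1\}$ with $\pi(i)>\pi(i+1)$; $d(\pi)$ is the number of descents of $\pi$ plus $1$, and $\mathrm{maj}(\pi)$ is the sum of the positions at which $\pi$ has a descent. For $\alpha\in[0,1]$, $$\Sigma_\alpha=\begin{pmatrix}\frac1{12}(1-4\alpha^3+3\alpha^4)&\frac1{24}(1-4\alpha^3+3\alpha^4)\\ \frac1{24}(1-4\alpha^3+3\alpha^4)&\frac1{36}(1-\alpha^3)\end{pmatrix}.$$ Normal distributions are allowed to be degenerate. *)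

theory Defs
  imports "HOL-Probability.Probability" "HOL-Combinatorics.Permutations"
begin

section \<open>Permutation statistics\<close>

text \<open>Elements of \<open>S\<^sub>n\<close> are functions \<open>\<pi> :: nat \<Rightarrow> nat\<close> with \<open>\<pi> permutes {1..n}\<close>.\<close>

definition descents :: "nat \<Rightarrow> (nat \<Rightarrow> nat) \<Rightarrow> nat set" where
  "descents n \<pi> = {i \<in> {1..<n}. \<pi> i > \<pi> (i + 1)}"

text \<open>Note the shift by one: \<open>desc n \<pi>\<close> is the number of descents plus \<open>1\<close>.\<close>

definition desc :: "nat \<Rightarrow> (nat \<Rightarrow> nat) \<Rightarrow> nat" where
  "desc n \<pi> = card (descents n \<pi>) + 1"

definition maj :: "nat \<Rightarrow> (nat \<Rightarrow> nat) \<Rightarrow> nat" where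
  "maj n \<pi> = \<Sum>(descents n \<pi>)"

definition num_fixed_points :: "nat \<Rightarrow> (nat \<Rightarrow> nat) \<Rightarrow> nat" where
  "num_fixed_points n \<pi> = card {i \<in> {1..n}. \<pi> i = i}"

definition conj_invariant :: "nat \<Rightarrow> (nat \<Rightarrow> nat) set \<Rightarrow> bool" where
  "conj_invariant n A \<longleftrightarrow> (\<forall>\<pi>\<in>A. \<forall>\<sigma>. \<sigma> permutes {1..n} \<longrightarrow> \<sigma> \<circ> \<pi> \<circ> inv \<sigma> \<in> A)"

definition W_stat :: "nat \<Rightarrow> real \<Rightarrow> (nat \<Rightarrow> nat) \<Rightarrow> real ^ 2" where
  "W_stat n a \<pi> = vector
     [(real (desc n \<pi>) - (1 - a\<^sup>2) / 2 * real n) / real n powr (1/2),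
      (real (maj n \<pi>) - (1 - a\<^sup>2) / 4 * (real n)\<^sup>2) / real n powr (3/2)]"

definition Sigma_mat :: "real \<Rightarrow> real ^ 2 ^ 2" where
  "Sigma_mat \<alpha> = vector
     [vector [1/12 * (1 - 4 * \<alpha>^3 + 3 * \<alpha>^4), 1/24 * (1 - 4 * \<alpha>^3 + 3 * \<alpha>^4)],
      vector [1/24 * (1 - 4 * \<alpha>^3 + 3 * \<alpha>^4), 1/36 * (1 - \<alpha>^3)]]"


section \<open>Multivariate normal distributions and convergence in distribution\<close>

text \<open>The univariate normal law with mean \<open>\<mu>\<close> and standard deviation \<open>\<sigma>\<close>, where
  \<open>\<sigma> = 0\<close> gives the Dirac measure at \<open>\<mu>\<close>.\<close>

definition normal_law :: "real \<Rightarrow> real \<Rightarrow> real measure" where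
  "normal_law \<mu> \<sigma> =
     (if \<sigma> = 0 then return borel \<mu> else density lborel (\<lambda>x. ennreal (normal_density \<mu> \<sigma> x)))"

text \<open>A Borel probability measure on a Euclidean space is normal (possibly degenerate) if all
  its one-dimensional linear marginals are.\<close>

definition multivariate_normal :: "(real ^ 'n) measure \<Rightarrow> bool" where
  "multivariate_normal N \<longleftrightarrow> prob_space N \<and> sets N = sets borel \<and>
     (\<forall>t. \<exists>\<mu> \<sigma>. \<sigma> \<ge> 0 \<and> distr N borel (\<lambda>x. t \<bullet> x) = normal_law \<mu> \<sigma>)"

definition mean_vector :: "(real ^ 'n) measure \<Rightarrow> real ^ 'n" where
  "mean_vector N = (\<chi> i. \<integral>x. x $ i \<partial>N)"

definition covariance_matrix :: "(real ^ 'n) measure \<Rightarrow> real ^ 'n ^ 'n" where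
  "covariance_matrix N =
     (\<chi> i j. \<integral>x. (x $ i - mean_vector N $ i) * (x $ j - mean_vector N $ j) \<partial>N)"

text \<open>Convergence in distribution of Borel probability measures, by testing against bounded
  continuous functions. The library's \<open>weak_conv_m\<close> covers only measures on the real line.\<close>

definition converges_in_distribution ::
    "(nat \<Rightarrow> 'a::topological_space measure) \<Rightarrow> 'a measure \<Rightarrow> bool" where
  "converges_in_distribution M N \<longleftrightarrow>
     (\<forall>f :: 'a \<Rightarrow> real. continuous_on UNIV f \<and> bounded (range f) \<longrightarrow>
        (\<lambda>n. \<integral>x. f x \<partial>(M n)) \<longlonglongrightarrow> (\<integral>x. f x \<partial>N))"

end

theory Submission
  imports
    Defs
    "HOL-Combinatorics.Orbits"
    "HOL-Combinatorics.Cycles"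
    "HOL-Computational_Algebra.Polynomial"
    "HOL-Real_Asymp.Real_Asymp"
begin

text \<open>Fix \<open>\<tau>\<close> in \<open>A\<^sub>n\<close> and let \<open>\<pi>\<close> range over its conjugates \<open>\<sigma> \<tau> \<sigma>\<^sup>-\<^sup>1\<close>. By the theory of \<open>P\<close>-partitions
  the joint generating function of \<open>d(\<pi>)\<close> and \<open>maj(\<pi>)\<close> counts pairs of a word \<open>w\<close> over \<open>{0, \<dots>, k - 1}\<close> and a
  permutation \<open>\<sigma>\<close> compatible with it. In the spirit of Gessel and Reutenauer, the number of compatible \<open>\<sigma>\<close>
  is the sum of a linear character \<open>chi\<close> of the centralizer of \<open>\<tau>\<close> over the stabilizer of \<open>w\<close>. Exchanging
  the two sums yields an identity whose two sides are polynomials in \<open>c\<close>, which agree for \<open>c = 1 / [k]\<^sub>q\<close> and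
  therefore for all complex \<open>c\<close>:
  the sum over \<open>\<pi>\<close> of \<open>q\<^sup>m\<^sup>a\<^sup>j \<Prod>\<^sub>j (q\<^sup>j\<^sup>-\<^sup>d + c [j - d]\<^sub>q) / [j]\<^sub>q\<close> is the sum over \<open>g\<close> in the centralizer of \<open>chi(g)\<close>
  times a product of power sums over the cycles of \<open>g\<close>. The elements \<open>g\<close> that only permute the fixed points
  of \<open>\<tau>\<close> give an explicit main term, and the others are negligible, because a word on the cycles of length
  at least two rarely has a nontrivial stabilizer.

  With \<open>q = exp(i t n\<^sup>-\<^sup>3\<^sup>/\<^sup>2)\<close> and \<open>c = - i (s + t) n\<^sup>-\<^sup>3\<^sup>/\<^sup>2\<close> the product turns into
  \<open>exp(i s d / \<surd>n + i t maj / n\<^sup>3\<^sup>/\<^sup>2)\<close> times the exponential of a quadratic function of \<open>d / n\<close>.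
  Taking \<open>t\<close> close to zero and \<open>s = n\<^sup>-\<^sup>1\<^sup>/\<^sup>2\<close> gives a law of large numbers for \<open>d / n\<close>, so that this
  quadratic factor may be replaced by a constant. Hence the characteristic function of \<open>W\<^sub>n\<close> converges to
  the Gaussian one, and the continuity theorem applies.\<close>

section \<open>Words, centralizers and compatible permutations\<close>

text \<open>The fixed points of \<tau> have to be summed exactly because coincidences between them
  are frequent. The sum over \<open>g\<close> is compared with the expected order of the stabilizer
  of a random word over an alphabet whose size \<open>k\<close> is of order n^(3/2). Two fixed
  points carry the same letter with probability 1/k, so up to n^2/k, of order sqrt n, coincidences
  are expected. To be moved onto another cycle, a cycle of length at least two must match two
  consecutive letters, at cost 1/k^2, and n^2/k^2 tends to 0. Freeing \<open>c\<close> replaces the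
  extraction of the law of d from a series in the alphabet size. Its value is dictated by the factor
  q^r + c [r]_q with r = j - d: to first order this is 1 + i (t - (s + t)) n^(-3/2) r, and the terms
  - i s n^(-3/2) (j - d), summed over the n values of j, contribute i s d / sqrt n. The second order
  does not vanish, which is why d / n must be shown to concentrate. The identity is available only
  when q is not a root of unity, so t is moved slightly, by an amount that is harmless against maj /
  n^(3/2).\<close>

definition centralizer :: "'a set \<Rightarrow> ('a \<Rightarrow> 'a) \<Rightarrow> ('a \<Rightarrow> 'a) set" where
  "centralizer V \<tau> = {g. g permutes V \<and> g \<circ> \<tau> = \<tau> \<circ> g}"

definition word_stab :: "'a set \<Rightarrow> ('a \<Rightarrow> 'a) \<Rightarrow> ('a \<Rightarrow> 'b) \<Rightarrow> ('a \<Rightarrow> 'a) set" where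
  "word_stab V \<tau> w = {g \<in> centralizer V \<tau>. \<forall>v\<in>V. w (g v) = w v}"

lemma finite_centralizer: "finite V \<Longrightarrow> finite (centralizer V \<tau>)"
  using finite_permutations[of V] by (auto simp: centralizer_def intro: finite_subset)

lemma finite_word_stab: "finite V \<Longrightarrow> finite (word_stab V \<tau> w)"
  using finite_centralizer[of V \<tau>] by (auto simp: word_stab_def)

lemma centralizer_funpow: "g \<in> centralizer V \<tau> \<Longrightarrow> g ((\<tau> ^^ a) x) = (\<tau> ^^ a) (g x)"
  by (induction a) (auto simp: centralizer_def fun_eq_iff)

lemma centralizer_comp: "g \<in> centralizer V \<tau> \<Longrightarrow> h \<in> centralizer V \<tau> \<Longrightarrow> g \<circ> h \<in> centralizer V \<tau>"
  by (auto simp: centralizer_def fun_eq_iff intro: permutes_compose)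

lemma centralizer_inv: "g \<in> centralizer V \<tau> \<Longrightarrow> inv g \<in> centralizer V \<tau>"
  unfolding centralizer_def fun_eq_iff o_def mem_Collect_eq
  by (metis permutes_inv permutes_inverses)

lemma word_stab_comp: "g \<in> word_stab V \<tau> w \<Longrightarrow> h \<in> word_stab V \<tau> w \<Longrightarrow> g \<circ> h \<in> word_stab V \<tau> w"
  unfolding word_stab_def
  by (auto simp: centralizer_comp) (auto simp: centralizer_def permutes_in_image)

lemma word_stab_inv: "g \<in> word_stab V \<tau> w \<Longrightarrow> inv g \<in> word_stab V \<tau> w"
  unfolding word_stab_def mem_Collect_eq
  by (metis (no_types, lifting) centralizer_def centralizer_inv mem_Collect_eq permutes_in_image permutes_inverses(1))

text \<open>Reading a word along a \<open>\<tau>\<close>-cycle gives a purely periodic sequence of digits; \<open>K\<close> is the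
  numerator of the number it represents in a base with one unused digit.\<close>

lemma word_key:
  fixes w :: "'a \<Rightarrow> nat"
  assumes "finite V" "\<tau> permutes V"
  obtains K :: "'a \<Rightarrow> nat" where
    "\<And>u v. u \<in> V \<Longrightarrow> v \<in> V \<Longrightarrow> K u = K v \<Longrightarrow> w u = w v \<and> K (\<tau> u) = K (\<tau> v)"
    "\<And>u v. u \<in> V \<Longrightarrow> v \<in> V \<Longrightarrow> K u < K v \<Longrightarrow> w u < w v \<or> (w u = w v \<and> K (\<tau> u) < K (\<tau> v))"
    "\<And>u v. u \<in> V \<Longrightarrow> v \<in> V \<Longrightarrow> (\<And>l. w ((\<tau> ^^ l) u) = w ((\<tau> ^^ l) v)) \<Longrightarrow> K u = K v"
    "\<And>u v. u \<in> V \<Longrightarrow> v \<in> V \<Longrightarrow> K (\<tau> u) = K (\<tau> v) \<Longrightarrow> K u = K v"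
proof -
  have inV: "(\<tau> ^^ l) u \<in> V" if "u \<in> V" for l u
    using that assms(2) by (induction l) (auto simp: permutes_in_image)
  obtain N where N: "\<tau> ^^ N = id" "N > 0"
    using permutation_is_nilpotent[of \<tau>] assms permutation_permutes by blast
  define b where "b = Max (insert 0 (w ` V)) + 2"
  have wb: "w u + 2 \<le> b" if "u \<in> V" for u
    using that assms(1) by (auto simp: b_def intro!: Max_ge)
  define M where "M = b ^ N - 1"
  define K where "K u = (\<Sum>l<N. w ((\<tau> ^^ l) u) * b ^ (N - 1 - l))" for u
  obtain b' where b': "b = b' + 2" by (simp add: b_def)
  have b2: "b \<ge> 2" by (simp add: b_def)
  have M: "b ^ N = M + 1" using b2 by (simp add: M_def)
  \<comment> \<open>Multiplying by the base shifts the periodic expansion by one digit; the digit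
    pushed out returns at the end because \<open>\<tau> ^^ N = id\<close>.\<close>
  have step: "b * K u = w u * M + K (\<tau> u)" for u
  proof -
    define S where "S = (\<Sum>l<Suc N. w ((\<tau> ^^ l) u) * b ^ (N - l))"
    have "S = w u * b ^ N + K (\<tau> u)"
      unfolding S_def sum.lessThan_Suc_shift K_def
      by (simp add: funpow_swap1 del: sum.lessThan_Suc)
    moreover have "S = b * K u + w u"
      unfolding S_def sum.lessThan_Suc K_def sum_distrib_left using N
      by (auto intro!: sum.cong simp: mult_ac Suc_diff_Suc simp flip: power_Suc)
    moreover have "w u * b ^ N = w u * M + w u"
      by (simp add: M)
    ultimately show ?thesis by simp
  qed
  have lt: "K u < M" if "u \<in> V" for u
  proof -
    define S where "S = (\<Sum>l<N. b ^ (N - 1 - l))"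
    have S: "S = (\<Sum>l<N. b ^ l)" unfolding S_def
      using sum.nat_diff_reindex[of "\<lambda>l. b ^ l" N] by simp
    have "int b ^ N = int M + 1" using arg_cong[OF M, of int] by simp
    then have "int M = (int b - 1) * int S"
      using power_diff_1_eq[of "int b" N] by (simp add: S)
    also have "int b - 1 = int (b - 1)" by (simp add: b')
    finally have "M = (b - 1) * S" by (metis of_nat_eq_iff of_nat_mult)
    moreover have "K u \<le> (b - 2) * S"
      unfolding K_def S_def sum_distrib_left
      using wb[OF inV[OF that]] by (intro sum_mono mult_right_mono) (auto simp: le_diff_conv2 b2)
    moreover have "S > 0" unfolding S using N b2 by (intro sum_pos) auto
    moreover have "(b - 1) * S = (b - 2) * S + S" by (simp add: b')
    ultimately show ?thesis by linarith
  qed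
  have 1: "w u = w v \<and> K (\<tau> u) = K (\<tau> v)" if "u \<in> V" "v \<in> V" "K u = K v" for u v
  proof -
    have *: "w x = b * K x div M \<and> K (\<tau> x) = b * K x mod M" if "x \<in> V" for x
      unfolding step using lt[of "\<tau> x"] that assms(2) by (auto simp: permutes_in_image)
    show ?thesis using *[of u] *[of v] that by simp
  qed
  have 2: "w u < w v \<or> (w u = w v \<and> K (\<tau> u) < K (\<tau> v))" if "u \<in> V" "v \<in> V" "K u < K v" for u v
  proof -
    have less: "w u * M + K (\<tau> u) < w v * M + K (\<tau> v)"
      unfolding step[symmetric] using that b2 by simp
    have "\<not> w v < w u"
    proof
      assume "w v < w u"
      then have "Suc (w v) * M \<le> w u * M" by (intro mult_right_mono) auto
      moreover have "K (\<tau> v) < M" using lt[of "\<tau> v"] that assms(2) by (auto simp: permutes_in_image)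
      ultimately show False using less by simp
    qed
    then show ?thesis using less by (cases "w u = w v") auto
  qed
  \<comment> \<open>The shift is invertible: \<open>N - 1\<close> further steps lead from
    \<open>\<tau> u\<close> back to \<open>u\<close>.\<close>
  have 4: "K u = K v" if "u \<in> V" "v \<in> V" "K (\<tau> u) = K (\<tau> v)" for u v
  proof -
    have "K ((\<tau> ^^ l) (\<tau> u)) = K ((\<tau> ^^ l) (\<tau> v))" for l
    proof (induction l)
      case (Suc l)
      then show ?case using 1[of "(\<tau> ^^ l) (\<tau> u)" "(\<tau> ^^ l) (\<tau> v)"] that inV assms(2)
        by (auto simp: permutes_in_image)
    qed (use that in auto)
    from this[of "N - 1"] show ?thesis using N
      by (metis Suc_diff_1 comp_apply funpow_Suc_right id_apply)
  qed
  have 3: "K u = K v" if "\<And>l. w ((\<tau> ^^ l) u) = w ((\<tau> ^^ l) v)" for u v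
    unfolding K_def that ..
  show thesis
    by (rule that[OF 1 2 3 4])
qed

text \<open>The permutations \<open>\<sigma>\<close> such that the word \<open>w \<circ> inv \<sigma>\<close> is weakly decreasing, and strictly
  decreasing at the descents of \<open>\<sigma> \<circ> \<tau> \<circ> inv \<sigma>\<close>.\<close>

definition compatible :: "nat set \<Rightarrow> (nat \<Rightarrow> nat) \<Rightarrow> (nat \<Rightarrow> nat) \<Rightarrow> (nat \<Rightarrow> nat) set" where
  "compatible V \<tau> w = {\<sigma>. \<sigma> permutes V \<and> (\<forall>u\<in>V. \<forall>v\<in>V. \<sigma> u < \<sigma> v \<longrightarrow>
     w v < w u \<or> (w u = w v \<and> \<sigma> (\<tau> u) < \<sigma> (\<tau> v)))}"

text \<open>Only the order of the keys matters below. The assumptions say that \<open>K\<close>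
  orders \<open>V\<close> lexicographically by the periodic sequences of letters read along \<tau>:
  first letter first, then the key of the successor, with ties exactly for equal sequences.\<close>

locale keyed_word =
  fixes V :: "nat set" and n :: nat and \<tau> :: "nat \<Rightarrow> nat" and w :: "nat \<Rightarrow> nat" and K :: "nat \<Rightarrow> nat"
  assumes V: "V = {1..n}" and \<tau>: "\<tau> permutes V"
    and K_eq: "\<And>u v. u \<in> V \<Longrightarrow> v \<in> V \<Longrightarrow> K u = K v \<Longrightarrow> w u = w v \<and> K (\<tau> u) = K (\<tau> v)"
    and K_less: "\<And>u v. u \<in> V \<Longrightarrow> v \<in> V \<Longrightarrow> K u < K v \<Longrightarrow>
       w u < w v \<or> (w u = w v \<and> K (\<tau> u) < K (\<tau> v))"
    and K_eqI: "\<And>u v. u \<in> V \<Longrightarrow> v \<in> V \<Longrightarrow>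
       (\<And>l. w ((\<tau> ^^ l) u) = w ((\<tau> ^^ l) v)) \<Longrightarrow> K u = K v"
    and K_back: "\<And>u v. u \<in> V \<Longrightarrow> v \<in> V \<Longrightarrow> K (\<tau> u) = K (\<tau> v) \<Longrightarrow> K u = K v"
begin

lemma finite_V[simp]: "finite V" by (simp add: V)

lemma tau_in[simp]: "\<tau> u \<in> V \<longleftrightarrow> u \<in> V"
  using \<tau> by (rule permutes_in_image)

lemma taupow_in[simp]: "(\<tau> ^^ l) u \<in> V \<longleftrightarrow> u \<in> V"
  by (induction l) simp_all

lemma K_funpow: "u \<in> V \<Longrightarrow> v \<in> V \<Longrightarrow> K u = K v \<Longrightarrow> K ((\<tau> ^^ l) u) = K ((\<tau> ^^ l) v)"
  by (induction l) (use K_eq taupow_in in simp_all)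

lemma compatibleD:
  assumes "\<sigma> \<in> compatible V \<tau> w" "u \<in> V" "v \<in> V" "\<sigma> u < \<sigma> v"
  shows "w v < w u \<or> (w u = w v \<and> \<sigma> (\<tau> u) < \<sigma> (\<tau> v))"
  using assms unfolding compatible_def by blast

lemma compatible_permutes: "\<sigma> \<in> compatible V \<tau> w \<Longrightarrow> \<sigma> permutes V"
  by (simp add: compatible_def)

text \<open>A pair labelled against the order of keys must have equal letters, and the conflict then
  passes on to the pair of successors. The letters would agree along the whole cycle, which forces
  equal keys.\<close>

lemma K_imp_less:
  assumes \<sigma>: "\<sigma> \<in> compatible V \<tau> w" and uv: "u \<in> V" "v \<in> V" "K v < K u"
  shows "\<sigma> u < \<sigma> v"
proof (rule ccontr)
  assume "\<not> \<sigma> u < \<sigma> v"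
  moreover have "\<sigma> u \<noteq> \<sigma> v"
    using uv permutes_inj[OF compatible_permutes[OF \<sigma>]] by (auto dest: injD)
  ultimately have less: "\<sigma> v < \<sigma> u" by simp
  have *: "w v = w u \<and> \<sigma> (\<tau> v) < \<sigma> (\<tau> u) \<and> K (\<tau> v) < K (\<tau> u)"
    if "u \<in> V" "v \<in> V" "K v < K u" "\<sigma> v < \<sigma> u" for u v
    using compatibleD[OF \<sigma> that(2,1,4)] K_less[OF that(2,1,3)] by auto
  have "\<sigma> ((\<tau> ^^ l) v) < \<sigma> ((\<tau> ^^ l) u) \<and> K ((\<tau> ^^ l) v) < K ((\<tau> ^^ l) u)" for l
  proof (induction l)
    case (Suc l)
    then show ?case using *[of "(\<tau> ^^ l) u" "(\<tau> ^^ l) v"] uv taupow_in by simp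
  qed (use less uv in auto)
  then have "w ((\<tau> ^^ l) v) = w ((\<tau> ^^ l) u)" for l
    using *[of "(\<tau> ^^ l) u" "(\<tau> ^^ l) v"] uv taupow_in by blast
  then have "K v = K u" by (rule K_eqI[OF uv(2,1)])
  then show False using uv by simp
qed

lemma tau_mono:
  assumes \<sigma>: "\<sigma> \<in> compatible V \<tau> w" and uv: "u \<in> V" "v \<in> V" "K u = K v"
  shows "\<sigma> u < \<sigma> v \<longleftrightarrow> \<sigma> (\<tau> u) < \<sigma> (\<tau> v)"
proof -
  have *: "\<sigma> (\<tau> u) < \<sigma> (\<tau> v)" if "u \<in> V" "v \<in> V" "K u = K v" "\<sigma> u < \<sigma> v" for u v
    using compatibleD[OF \<sigma> that(1,2,4)] K_eq[OF that(1-3)] by simp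
  have "\<sigma> u = \<sigma> v \<Longrightarrow> u = v"
    using permutes_inj[OF compatible_permutes[OF \<sigma>]] by (auto dest: injD)
  then show ?thesis using *[OF uv] *[OF uv(2,1)] uv by (cases "\<sigma> u" "\<sigma> v" rule: linorder_cases) auto
qed

text \<open>Passing to successors maps one key class onto another (\<open>K_back\<close> gives
  surjectivity) and preserves the order of labels, so the rank inside the class is constant along a
  cycle.\<close>

lemma rank_tau:
  assumes \<sigma>: "\<sigma> \<in> compatible V \<tau> w" and u: "u \<in> V"
  shows "card {y\<in>V. K y = K (\<tau> u) \<and> \<sigma> y < \<sigma> (\<tau> u)} = card {y\<in>V. K y = K u \<and> \<sigma> y < \<sigma> u}"
proof -
  have "{y\<in>V. K y = K (\<tau> u) \<and> \<sigma> y < \<sigma> (\<tau> u)} = \<tau> ` {y\<in>V. K y = K u \<and> \<sigma> y < \<sigma> u}" (is "?A = \<tau> ` ?B")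
  proof (intro equalityI subsetI)
    fix y assume y: "y \<in> ?A"
    define x where "x = inv \<tau> y"
    have yx: "y = \<tau> x" by (simp add: x_def permutes_inverses[OF \<tau>])
    have "x \<in> V" using y tau_in unfolding yx by blast
    moreover have "K x = K u" using y K_back[OF \<open>x \<in> V\<close> u] unfolding yx by simp
    ultimately show "y \<in> \<tau> ` ?B" using y tau_mono[OF \<sigma> \<open>x \<in> V\<close> u] unfolding yx by blast
  next
    fix y assume "y \<in> \<tau> ` ?B"
    then obtain x where "y = \<tau> x" "x \<in> V" "K x = K u" "\<sigma> x < \<sigma> u" by blast
    then show "y \<in> ?A" using tau_mono[OF \<sigma> \<open>x \<in> V\<close> u] K_eq[OF \<open>x \<in> V\<close> u] tau_in by blast
  qed
  then show ?thesis using card_image[OF permutes_inj_on[OF \<tau>]] by metis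
qed

text \<open>Larger keys receive smaller labels, so the labels of one key class form an interval, and
  a label is the start of the interval plus the rank inside the class. The ranks are the only
  freedom left to \<sigma>.\<close>

lemma label_eq:
  assumes \<sigma>: "\<sigma> \<in> compatible V \<tau> w" and u: "u \<in> V"
  shows "\<sigma> u = card {y\<in>V. K u < K y} + card {y\<in>V. K y = K u \<and> \<sigma> y < \<sigma> u} + 1"
proof -
  have p: "\<sigma> permutes V" using \<sigma> by (rule compatible_permutes)
  have "\<sigma> ` {y\<in>V. \<sigma> y < \<sigma> u} = {1..<\<sigma> u}"
  proof (intro equalityI subsetI)
    fix z assume z: "z \<in> {1..<\<sigma> u}"
    have "\<sigma> u \<in> V" using permutes_in_image[OF p] u by blast
    then have "inv \<sigma> z \<in> V" using z permutes_in_image[OF permutes_inv[OF p], of z] by (auto simp: V)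
    moreover have "\<sigma> (inv \<sigma> z) = z" by (simp add: permutes_inverses[OF p])
    ultimately show "z \<in> \<sigma> ` {y\<in>V. \<sigma> y < \<sigma> u}" using z by (intro image_eqI[of _ _ "inv \<sigma> z"]) auto
  next
    fix z assume "z \<in> \<sigma> ` {y\<in>V. \<sigma> y < \<sigma> u}"
    then obtain y where "y \<in> V" "z = \<sigma> y" "\<sigma> y < \<sigma> u" by blast
    moreover have "\<sigma> y \<in> V" using permutes_in_image[OF p] \<open>y \<in> V\<close> by blast
    ultimately show "z \<in> {1..<\<sigma> u}" by (auto simp: V)
  qed
  then have "card {1..<\<sigma> u} = card {y\<in>V. \<sigma> y < \<sigma> u}"
    using card_image[OF permutes_inj_on[OF p], of "{y\<in>V. \<sigma> y < \<sigma> u}"] by simp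
  also have "{y\<in>V. \<sigma> y < \<sigma> u} = {y\<in>V. K u < K y} \<union> {y\<in>V. K y = K u \<and> \<sigma> y < \<sigma> u}"
  proof -
    have "\<sigma> y < \<sigma> u" if "y \<in> V" "K u < K y" for y using K_imp_less[OF \<sigma> that(1) u that(2)] .
    moreover have "K u < K y \<or> K y = K u" if "y \<in> V" "\<sigma> y < \<sigma> u" for y
      using K_imp_less[OF \<sigma> u that(1)] that(2) by fastforce
    ultimately show ?thesis by blast
  qed
  also have "card ({y\<in>V. K u < K y} \<union> {y\<in>V. K y = K u \<and> \<sigma> y < \<sigma> u}) =
      card {y\<in>V. K u < K y} + card {y\<in>V. K y = K u \<and> \<sigma> y < \<sigma> u}"
    by (rule card_Un_disjoint) auto
  finally have "card {1..<\<sigma> u} = card {y\<in>V. K u < K y} + card {y\<in>V. K y = K u \<and> \<sigma> y < \<sigma> u}" .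
  moreover have "1 \<le> \<sigma> u" using permutes_in_image[OF p] u unfolding V by (metis atLeastAtMost_iff)
  ultimately show ?thesis by simp
qed

text \<open>Distinct key classes occupy disjoint intervals of labels, and these intervals are the
  same for every compatible permutation.\<close>

lemma not_K_less:
  assumes \<sigma>: "\<sigma> \<in> compatible V \<tau> w" and \<sigma>': "\<sigma>' \<in> compatible V \<tau> w"
    and u: "u \<in> V" "u' \<in> V" "\<sigma> u = \<sigma>' u'"
  shows "\<not> K u' < K u"
proof
  assume less: "K u' < K u"
  have "card {y\<in>V. K u < K y} + card {y\<in>V. K y = K u \<and> \<sigma> y < \<sigma> u} =
      card ({y\<in>V. K u < K y} \<union> {y\<in>V. K y = K u \<and> \<sigma> y < \<sigma> u})"
    by (rule card_Un_disjoint[symmetric]) auto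
  also have "\<dots> < card {y\<in>V. K u' < K y}"
  proof (rule psubset_card_mono)
    have "u \<in> {y\<in>V. K u' < K y}" using u(1) less by blast
    moreover have "u \<notin> {y\<in>V. K u < K y} \<union> {y\<in>V. K y = K u \<and> \<sigma> y < \<sigma> u}" by blast
    moreover have "{y\<in>V. K u < K y} \<union> {y\<in>V. K y = K u \<and> \<sigma> y < \<sigma> u} \<subseteq> {y\<in>V. K u' < K y}"
      using less by fastforce
    ultimately show "{y\<in>V. K u < K y} \<union> {y\<in>V. K y = K u \<and> \<sigma> y < \<sigma> u} \<subset> {y\<in>V. K u' < K y}"
      by blast
  qed simp
  finally show False
    using label_eq[OF \<sigma> u(1)] label_eq[OF \<sigma>' u(2)] u(3) by linarith
qed

lemma stab_iff:
  "g \<in> word_stab V \<tau> w \<longleftrightarrow> g \<in> centralizer V \<tau> \<and> (\<forall>v\<in>V. K (g v) = K v)"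
proof (cases "g \<in> centralizer V \<tau>")
  case True
  then have gV: "g v \<in> V \<longleftrightarrow> v \<in> V" for v by (simp add: centralizer_def permutes_in_image)
  have "(\<forall>v\<in>V. w (g v) = w v) \<longleftrightarrow> (\<forall>v\<in>V. K (g v) = K v)"
  proof
    assume *: "\<forall>v\<in>V. w (g v) = w v"
    show "\<forall>v\<in>V. K (g v) = K v"
    proof
      fix v assume v: "v \<in> V"
      have "w ((\<tau> ^^ l) (g v)) = w ((\<tau> ^^ l) v)" for l
        using *[rule_format, of "(\<tau> ^^ l) v"] v centralizer_funpow[OF True, of l v] by simp
      then show "K (g v) = K v" by (rule K_eqI[OF gV[THEN iffD2, OF v] v])
    qed
  next
    assume "\<forall>v\<in>V. K (g v) = K v"
    then show "\<forall>v\<in>V. w (g v) = w v" using K_eq gV by blast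
  qed
  then show ?thesis using True by (simp add: word_stab_def)
qed (simp add: word_stab_def)

text \<open>Equal labels force equal keys and equal ranks. Since ranks are constant along cycles,
  comparing the labels of the successors shows that \<open>g\<close> commutes with \<tau>.\<close>

lemma compatible_transition:
  assumes \<sigma>: "\<sigma> \<in> compatible V \<tau> w" and \<sigma>': "\<sigma>' \<in> compatible V \<tau> w"
  shows "inv \<sigma>' \<circ> \<sigma> \<in> word_stab V \<tau> w"
proof -
  define g where "g = inv \<sigma>' \<circ> \<sigma>"
  have p: "\<sigma> permutes V" and p': "\<sigma>' permutes V" using \<sigma> \<sigma>' by (auto intro: compatible_permutes)
  have g: "g permutes V" unfolding g_def by (intro permutes_compose permutes_inv p p')
  have gV: "g u \<in> V \<longleftrightarrow> u \<in> V" for u using permutes_in_image[OF g] .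
  have s: "\<sigma> u = \<sigma>' (g u)" for u by (simp add: g_def permutes_inverses[OF p'])
  have K: "K (g u) = K u" if u: "u \<in> V" for u
  proof -
    have gu: "g u \<in> V" using u gV by blast
    show ?thesis using not_K_less[OF \<sigma> \<sigma>' u gu s] not_K_less[OF \<sigma>' \<sigma> gu u s[symmetric]] by linarith
  qed
  have "g (\<tau> u) = \<tau> (g u)" for u
  proof (cases "u \<in> V")
    case True
    then have gu: "g u \<in> V" and tu: "\<tau> u \<in> V" and tgu: "\<tau> (g u) \<in> V" using gV tau_in by blast+
    have "card {y\<in>V. K y = K u \<and> \<sigma> y < \<sigma> u} = card {y\<in>V. K y = K (g u) \<and> \<sigma>' y < \<sigma>' (g u)}"
      using label_eq[OF \<sigma> True] label_eq[OF \<sigma>' gu] s[of u] K[OF True] by simp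
    moreover have "K (\<tau> (g u)) = K (\<tau> u)" using K_eq[OF gu True K[OF True]] by simp
    ultimately have "\<sigma>' (\<tau> (g u)) = \<sigma> (\<tau> u)"
      using label_eq[OF \<sigma> tu] label_eq[OF \<sigma>' tgu] rank_tau[OF \<sigma> True] rank_tau[OF \<sigma>' gu] by simp
    then show ?thesis unfolding s using permutes_inj[OF p'] by (simp add: inj_def)
  next
    case False
    then show ?thesis using permutes_not_in[OF g] permutes_not_in[OF \<tau>] by metis
  qed
  then have "g \<in> centralizer V \<tau>" using g by (auto simp: centralizer_def)
  then show ?thesis using K by (simp add: stab_iff g_def)
qed

lemma compatible_comp_stab:
  assumes \<sigma>: "\<sigma> \<in> compatible V \<tau> w" and g: "g \<in> word_stab V \<tau> w"
  shows "\<sigma> \<circ> g \<in> compatible V \<tau> w"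
proof -
  have gp: "g permutes V" "\<And>u. g (\<tau> u) = \<tau> (g u)" and gw: "\<And>v. v \<in> V \<Longrightarrow> w (g v) = w v"
    using g by (auto simp: word_stab_def centralizer_def fun_eq_iff)
  have gV: "g u \<in> V \<longleftrightarrow> u \<in> V" for u using permutes_in_image[OF gp(1)] .
  have "(\<sigma> \<circ> g) permutes V" using permutes_compose[OF gp(1) compatible_permutes[OF \<sigma>]] .
  moreover have "w v < w u \<or> (w u = w v \<and> \<sigma> (g (\<tau> u)) < \<sigma> (g (\<tau> v)))"
    if "u \<in> V" "v \<in> V" "\<sigma> (g u) < \<sigma> (g v)" for u v
    using compatibleD[OF \<sigma>, of "g u" "g v"] that gw[OF that(1)] gw[OF that(2)] gV gp(2) by simp
  ultimately show ?thesis by (simp add: compatible_def)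
qed

text \<open>The compatible permutations, if there are any, form a single coset of the
  stabilizer.\<close>

lemma card_compatible:
  assumes \<sigma>: "\<sigma> \<in> compatible V \<tau> w"
  shows "card (compatible V \<tau> w) = card (word_stab V \<tau> w)"
proof -
  have p: "\<sigma> permutes V" using \<sigma> by (rule compatible_permutes)
  have "compatible V \<tau> w = (\<lambda>g. \<sigma> \<circ> g) ` word_stab V \<tau> w"
  proof (intro equalityI subsetI)
    fix \<sigma>' assume "\<sigma>' \<in> compatible V \<tau> w"
    then have "inv \<sigma> \<circ> \<sigma>' \<in> word_stab V \<tau> w" using \<sigma> by (intro compatible_transition)
    moreover have "\<sigma>' = \<sigma> \<circ> (inv \<sigma> \<circ> \<sigma>')" by (simp add: fun_eq_iff permutes_inverses[OF p])
    ultimately show "\<sigma>' \<in> (\<lambda>g. \<sigma> \<circ> g) ` word_stab V \<tau> w" by blast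
  qed (use compatible_comp_stab[OF \<sigma>] in auto)
  moreover have "inj_on (\<lambda>g. \<sigma> \<circ> g) (word_stab V \<tau> w)"
    by (rule inj_onI) (metis comp_assoc id_comp permutes_inv_o(2)[OF p])
  ultimately show ?thesis by (simp add: card_image)
qed

text \<open>If a cycle reads its word with a shorter period, \<open>\<tau> ^^ a\<close> keeps
  \<open>u\<close> inside one key class, where \<tau> respects the order of labels. Iterating it
  would move the labels strictly in one direction, yet the iteration returns to
  \<open>u\<close>.\<close>

lemma compatible_imp_primitive:
  assumes \<sigma>: "\<sigma> \<in> compatible V \<tau> w" and u: "u \<in> V" and K: "K ((\<tau> ^^ a) u) = K u"
  shows "(\<tau> ^^ a) u = u"
proof (rule ccontr)
  assume ne: "(\<tau> ^^ a) u \<noteq> u"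
  define x where "x l = (\<tau> ^^ (l * a)) u" for l
  have x: "x l \<in> V" for l using u taupow_in by (simp add: x_def)
  have xS: "x (Suc l) = (\<tau> ^^ (l * a)) ((\<tau> ^^ a) u)" for l
    unfolding x_def by (metis add.commute comp_apply funpow_add mult_Suc)
  have mono: "\<sigma> ((\<tau> ^^ l) u) < \<sigma> ((\<tau> ^^ l) v) \<longleftrightarrow> \<sigma> u < \<sigma> v" if "v \<in> V" "K u = K v" for l v
  proof (induction l)
    case (Suc l)
    then show ?case using tau_mono[OF \<sigma>, of "(\<tau> ^^ l) u" "(\<tau> ^^ l) v"] K_funpow[OF u that] taupow_in that u
      by simp
  qed simp
  have mono': "\<sigma> ((\<tau> ^^ l) v) < \<sigma> ((\<tau> ^^ l) u) \<longleftrightarrow> \<sigma> v < \<sigma> u" if "v \<in> V" "K u = K v" for l v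
  proof (induction l)
    case (Suc l)
    then show ?case using tau_mono[OF \<sigma>, of "(\<tau> ^^ l) v" "(\<tau> ^^ l) u"] K_funpow[OF u that] taupow_in that u
      by simp
  qed simp
  have "\<sigma> ((\<tau> ^^ a) u) \<noteq> \<sigma> u"
    using ne permutes_inj[OF compatible_permutes[OF \<sigma>]] by (auto dest: injD)
  then consider "\<sigma> u < \<sigma> ((\<tau> ^^ a) u)" | "\<sigma> ((\<tau> ^^ a) u) < \<sigma> u" by linarith
  moreover obtain N where N: "\<tau> ^^ N = id" "N > 0"
    using permutation_is_nilpotent[of \<tau>] \<tau> finite_V permutation_permutes by blast
  have xN: "x N = u" by (simp add: x_def N flip: funpow_mult)
  have x0: "x 0 = u" by (simp add: x_def)
  have tu: "(\<tau> ^^ a) u \<in> V" using u taupow_in by blast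
  ultimately show False
  proof cases
    case 1
    have "\<sigma> (x l) < \<sigma> (x (Suc l))" for l unfolding xS using mono[OF tu K[symmetric]] 1 by (simp add: x_def)
    then have "strict_mono (\<lambda>l. \<sigma> (x l))" by (simp add: strict_mono_Suc_iff)
    then have "\<sigma> (x 0) < \<sigma> (x N)" using N(2) by (rule strict_monoD)
    then show False using xN x0 by simp
  next
    case 2
    have dec: "\<sigma> (x (Suc l)) < \<sigma> (x l)" for l unfolding xS using mono'[OF tu K[symmetric]] 2 by (simp add: x_def)
    have "\<sigma> (x (i + Suc k)) < \<sigma> (x i)" for i k
    proof (induction k)
      case (Suc k)
      have "\<sigma> (x (i + Suc (Suc k))) < \<sigma> (x (i + Suc k))" using dec[of "i + Suc k"] by simp
      then show ?case using Suc by (rule less_trans)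
    qed (use dec[of i] in simp)
    from this[of 0 "N - 1"] show False using N xN x0 by simp
  qed
qed

text \<open>Conversely, ties between distinct \<open>\<tau>\<close>-cycles are broken by the least elements of the cycles.\<close>

lemma primitive_imp_compatible:
  assumes prim: "\<And>u a. u \<in> V \<Longrightarrow> K ((\<tau> ^^ a) u) = K u \<Longrightarrow> (\<tau> ^^ a) u = u"
  shows "compatible V \<tau> w \<noteq> {}"
proof -
  define b where "b u = Min (orbit \<tau> u)" for u
  have pt: "permutation \<tau>" using \<tau> finite_V permutation_permutes by blast
  have b\<tau>: "b (\<tau> u) = b u" for u by (simp add: b_def permutation_orbit_step[OF pt])
  have b_in: "b u \<in> orbit \<tau> u" for u
    unfolding b_def by (intro Min_in finite_orbit permutation_self_in_orbit pt orbit_nonempty)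
  have b_eq: "u = v" if "u \<in> V" "v \<in> V" "K u = K v" "b u = b v" for u v
  proof -
    have "orbit \<tau> u = orbit \<tau> v"
      using orbit_cyclic_eq3[OF cyclic_on_orbit'[OF pt] b_in[of u]]
        orbit_cyclic_eq3[OF cyclic_on_orbit'[OF pt] b_in[of v]] that(4) by simp
    then have "v \<in> orbit \<tau> u" using permutation_self_in_orbit[OF pt] by simp
    then obtain a where "v = (\<tau> ^^ a) u" by (auto simp: orbit_altdef)
    then show ?thesis using prim[OF that(1), of a] that(3) by simp
  qed
  \<comment> \<open>Since \<open>b\<close> is constant on cycles, this order is passed on from a
    tied pair to its successors, as compatibility demands.\<close>
  define less where "less u v \<longleftrightarrow> K v < K u \<or> (K u = K v \<and> b u < b v)" for u v
  define \<sigma> where "\<sigma> u = (if u \<in> V then card {y\<in>V. less y u} + 1 else u)" for u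
  have mono: "\<sigma> u < \<sigma> v" if "u \<in> V" "v \<in> V" "less u v" for u v
  proof -
    have "card {y\<in>V. less y u} < card {y\<in>V. less y v}"
      by (rule psubset_card_mono) (use that in \<open>auto simp: less_def\<close>)
    then show ?thesis using that by (simp add: \<sigma>_def)
  qed
  have total: "less u v \<or> less v u" if "u \<in> V" "v \<in> V" "u \<noteq> v" for u v
    using b_eq[OF that(1,2)] that(3) unfolding less_def by (metis linorder_neqE_nat)
  have iff: "\<sigma> u < \<sigma> v \<longleftrightarrow> less u v" if "u \<in> V" "v \<in> V" for u v
    using mono[OF that] mono[OF that(2,1)] total[OF that] by (cases "u = v") (auto simp: less_def)
  have inj: "inj_on \<sigma> V"
  proof (rule inj_onI, rule ccontr)
    fix u v assume uv: "u \<in> V" "v \<in> V" "\<sigma> u = \<sigma> v" "u \<noteq> v"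
    then show False using total[OF uv(1,2,4)] mono[OF uv(1,2)] mono[OF uv(2,1)] by auto
  qed
  have "\<sigma> ` V \<subseteq> V"
  proof
    fix z assume "z \<in> \<sigma> ` V"
    then obtain u where u: "u \<in> V" "z = \<sigma> u" by blast
    have "card {y\<in>V. less y u} < card V"
      by (rule psubset_card_mono) (use u in \<open>auto simp: less_def\<close>)
    then show "z \<in> V" using u V by (simp add: \<sigma>_def)
  qed
  then have "bij_betw \<sigma> V V" using inj by (simp add: bij_betw_def endo_inj_surj)
  then have "\<sigma> permutes V" by (rule bij_imp_permutes) (simp add: \<sigma>_def)
  moreover have "w v < w u \<or> (w u = w v \<and> \<sigma> (\<tau> u) < \<sigma> (\<tau> v))" if uv: "u \<in> V" "v \<in> V" "\<sigma> u < \<sigma> v" for u v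
  proof -
    have t: "\<tau> u \<in> V" "\<tau> v \<in> V" using uv tau_in by blast+
    have "less u v" using uv iff by blast
    then consider "K v < K u" | "K u = K v" "b u < b v" unfolding less_def by blast
    then show ?thesis
    proof cases
      case 1
      then show ?thesis using K_less[OF uv(2,1)] iff[OF t] by (auto simp: less_def)
    next
      case 2
      then show ?thesis using K_eq[OF uv(1,2)] iff[OF t] by (auto simp: less_def b\<tau>)
    qed
  qed
  ultimately have "\<sigma> \<in> compatible V \<tau> w" by (simp add: compatible_def)
  then show ?thesis by blast
qed

end

section \<open>A linear character of the centralizer\<close>

locale finite_perm =
  fixes V :: "'a set" and \<tau> :: "'a \<Rightarrow> 'a"
  assumes fin: "finite V" and perm: "\<tau> permutes V"
begin

lemma permutation: "permutation \<tau>"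
  using fin perm permutation_permutes by blast

lemma self_in_orbit: "v \<in> orbit \<tau> v"
  by (rule permutation_self_in_orbit[OF permutation])

lemma orbit_eqI': "u \<in> orbit \<tau> v \<Longrightarrow> orbit \<tau> u = orbit \<tau> v"
  using cyclic_on_orbit'[OF permutation] by (rule orbit_cyclic_eq3)

lemma orbit_eq_iff: "orbit \<tau> u = orbit \<tau> v \<longleftrightarrow> u \<in> orbit \<tau> v"
  using orbit_eqI' self_in_orbit by blast

lemma orbit_funpow: "u \<in> orbit \<tau> v \<longleftrightarrow> (\<exists>a. u = (\<tau> ^^ a) v)"
  using orbit_altdef_permutation[OF permutation, of v] by auto

lemma orbit_step_eq: "orbit \<tau> (\<tau> v) = orbit \<tau> v"
  by (rule permutation_orbit_step[OF permutation])

lemma funpow_in_V: "(\<tau> ^^ a) v \<in> V \<longleftrightarrow> v \<in> V"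
  by (induction a) (use permutes_in_image[OF perm] in auto)

lemma orbit_subset_V: "v \<in> V \<Longrightarrow> orbit \<tau> v \<subseteq> V"
  by (rule permutes_orbit_subset[OF perm])

lemma funpow_fix_iff: "(\<tau> ^^ c) v = v \<longleftrightarrow> card (orbit \<tau> v) dvd c"
proof -
  define p where "p = funpow_dist1 \<tau> v v"
  have inj: "inj_on (\<lambda>n. (\<tau> ^^ n) v) {0..<p}"
    unfolding p_def by (rule inj_on_funpow_dist1[OF self_in_orbit])
  have orb: "orbit \<tau> v = (\<lambda>n. (\<tau> ^^ n) v) ` {0..<p}"
    unfolding p_def by (rule orbit_conv_funpow_dist1[OF self_in_orbit])
  have card: "card (orbit \<tau> v) = p" unfolding orb using card_image[OF inj] by simp
  have p: "(\<tau> ^^ p) v = v" "p > 0" unfolding p_def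
    using funpow_dist1_prop[OF self_in_orbit, of v] by auto
  have "(\<tau> ^^ c) v = (\<tau> ^^ (c mod p)) v" using funpow_mod_eq[OF p(1)] by simp
  moreover have "(\<tau> ^^ (c mod p)) v = v \<longleftrightarrow> c mod p = 0"
    using inj_onD[OF inj, of "c mod p" 0] p by auto
  ultimately show ?thesis unfolding card by (simp add: dvd_eq_mod_eq_0)
qed

lemma card_orbit_pos: "card (orbit \<tau> v) > 0"
  using finite_orbit[OF self_in_orbit[of v]] self_in_orbit[of v] card_gt_0_iff by blast

definition root :: "'a \<Rightarrow> complex" where
  "root v = cis (2 * pi / card (orbit \<tau> v))"

lemma root_power: "root v ^ a = cis (2 * pi * a / card (orbit \<tau> v))"
  unfolding root_def Complex.DeMoivre by (rule arg_cong[of _ _ cis]) simp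

lemma root_power_eq_1_iff: "root v ^ a = 1 \<longleftrightarrow> (\<tau> ^^ a) v = v"
proof -
  define p where "p = card (orbit \<tau> v)"
  have p: "p > 0" using card_orbit_pos by (simp add: p_def)
  have "root v ^ a = 1 \<longleftrightarrow> p dvd a"
  proof
    assume "p dvd a"
    then obtain b where "a = p * b" by blast
    then have "2 * pi * a / p = 2 * pi * real b" using p by simp
    then show "root v ^ a = 1" unfolding root_power p_def[symmetric]
      by (simp add: cis_multiple_2pi)
  next
    assume "root v ^ a = 1"
    then have "cos (2 * pi * a / p) = 1" unfolding root_power p_def[symmetric]
      by (metis cis.simps(1) one_complex.simps(1))
    then obtain m :: int where "2 * pi * a / p = m * 2 * pi"
      using cos_one_2pi_int by auto
    then have "real a = real_of_int (m * int p)" using p by (simp add: field_simps)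
    then have "int a = m * int p" by linarith
    then show "p dvd a" by (metis dvd_triv_right int_dvd_int_iff)
  qed
  then show ?thesis unfolding funpow_fix_iff p_def .
qed

text \<open>Such a function diagonalizes the rotation of every cycle. It is determined up to one
  unimodular constant per cycle, and these constants drop out of \<open>chi\<close>.\<close>

definition eigenfunction :: "('a \<Rightarrow> complex) \<Rightarrow> bool" where
  "eigenfunction f \<longleftrightarrow> (\<forall>v. norm (f v) = 1 \<and> f (\<tau> v) = root v * f v)"

lemma root_step: "root (\<tau> v) = root v"
  by (simp add: root_def orbit_step_eq)

lemma eigenfunction_funpow: "eigenfunction f \<Longrightarrow> f ((\<tau> ^^ a) v) = root v ^ a * f v"
proof (induction a arbitrary: v)
  case (Suc a)
  then have "f ((\<tau> ^^ a) (\<tau> v)) = root (\<tau> v) ^ a * f (\<tau> v)" by blast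
  then show ?case using Suc.prems unfolding eigenfunction_def root_step
    by (simp add: funpow_swap1)
qed simp

text \<open>Powers of \<open>root v\<close>, counted by the distance from the representative, are
  consistent because the order of \<open>root v\<close> is exactly the length of the cycle. The
  freedom to prescribe the value 1 at chosen representatives is what later evaluates
  \<open>chi\<close>.\<close>

lemma eigenfunction_exists:
  assumes "\<And>v. rp v \<in> orbit \<tau> v" "\<And>v. rp (\<tau> v) = rp v"
  obtains f where "eigenfunction f" "\<And>v. f (rp v) = 1"
proof -
  define d where "d v = (SOME a. v = (\<tau> ^^ a) (rp v))" for v
  have d: "v = (\<tau> ^^ d v) (rp v)" for v
  proof -
    have "v \<in> orbit \<tau> (rp v)"
      using assms(1)[of v, folded orbit_eq_iff] self_in_orbit[of v] by simp
    then show ?thesis unfolding d_def orbit_funpow by (rule someI_ex)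
  qed
  have rp_rp: "rp (rp v) = rp v" for v
  proof -
    have "rp ((\<tau> ^^ a) v) = rp v" for a by (induction a) (auto simp: assms(2))
    moreover obtain a where "rp v = (\<tau> ^^ a) v" using assms(1)[of v] unfolding orbit_funpow by blast
    ultimately show ?thesis by simp
  qed
  have root_rp: "root (rp v) = root v" for v
    using assms(1)[of v, folded orbit_eq_iff] by (simp add: root_def)
  define f where "f v = root v ^ d v" for v
  have pow_eq: "root (rp v) ^ a = root (rp v) ^ b" if "(\<tau> ^^ a) (rp v) = (\<tau> ^^ b) (rp v)" for a b v
  proof -
    have *: "root r ^ a = root r ^ (a + c)" if eq: "(\<tau> ^^ a) r = (\<tau> ^^ (a + c)) r" for a c r
    proof -
      have "(\<tau> ^^ a) r = (\<tau> ^^ a) ((\<tau> ^^ c) r)" using eq by (simp add: funpow_add)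
      moreover have "inj (\<tau> ^^ a)" using permutes_inj[OF perm] by (simp add: inj_fn)
      ultimately have "(\<tau> ^^ c) r = r" by (simp add: inj_eq)
      then have "root r ^ c = 1" by (simp add: root_power_eq_1_iff)
      then show ?thesis by (simp add: power_add)
    qed
    show ?thesis
    proof (cases "a \<le> b")
      case True
      then obtain c where "b = a + c" using le_Suc_ex by blast
      then show ?thesis using that by (simp only: *[symmetric])
    next
      case False
      then obtain c where "a = b + c" using le_Suc_ex nat_le_linear by blast
      then show ?thesis using that by (simp only: *[symmetric])
    qed
  qed
  show thesis
  proof
    have "f (\<tau> v) = root v * f v" for v
    proof -
      have "(\<tau> ^^ d (\<tau> v)) (rp v) = (\<tau> ^^ Suc (d v)) (rp v)"
        using d[of "\<tau> v"] d[of v] by (simp add: assms(2))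
      from pow_eq[OF this] show ?thesis by (simp add: f_def root_step root_rp)
    qed
    then show "eigenfunction f"
      by (simp add: eigenfunction_def f_def norm_power root_def)
    show "f (rp v) = 1" for v
      using d[of "rp v", symmetric] by (simp add: f_def root_power_eq_1_iff rp_rp)
  qed
qed

text \<open>One factor per cycle; the choice of the point is immaterial when \<open>h\<close> is
  invariant under \<tau>.\<close>

definition orbit_prod :: "('a \<Rightarrow> complex) \<Rightarrow> complex" where
  "orbit_prod h = (\<Prod>C\<in>orbit \<tau> ` V. h (SOME v. v \<in> C))"

lemma some_in_orbit: "(SOME u. u \<in> orbit \<tau> v) \<in> orbit \<tau> v"
  using self_in_orbit by (rule someI)

lemma invariant_on_orbit:
  assumes "\<And>v. h (\<tau> v) = h v" "u \<in> orbit \<tau> v"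
  shows "h u = h v"
proof -
  have "h ((\<tau> ^^ a) v) = h v" for a by (induction a) (auto simp: assms)
  then show ?thesis using assms(2) orbit_funpow by auto
qed

lemma orbit_prod_transversal:
  assumes "\<And>v. h (\<tau> v) = h v" "inj_on (orbit \<tau>) R" "orbit \<tau> ` R = orbit \<tau> ` V"
  shows "orbit_prod h = prod h R"
  unfolding orbit_prod_def assms(3)[symmetric] prod.reindex[OF assms(2)] o_def
  by (intro prod.cong refl invariant_on_orbit[of h, OF assms(1)] some_in_orbit)

lemma orbit_prod_cong: "(\<And>v. v \<in> V \<Longrightarrow> h v = h' v) \<Longrightarrow> orbit_prod h = orbit_prod h'"
  unfolding orbit_prod_def
  by (intro prod.cong refl) (use some_in_orbit orbit_subset_V in blast)

lemma orbit_prod_mult: "orbit_prod (\<lambda>v. h v * h' v) = orbit_prod h * orbit_prod h'"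
  by (simp add: orbit_prod_def prod.distrib)

lemma orbit_centralizer:
  assumes "g \<in> centralizer V \<tau>"
  shows "orbit \<tau> (g v) = g ` orbit \<tau> v"
  using assms by (intro orbit_inverse[OF self_in_orbit, symmetric]) (auto simp: centralizer_def fun_eq_iff)

lemma centralizer_permutes: "g \<in> centralizer V \<tau> \<Longrightarrow> g permutes V"
  by (simp add: centralizer_def)

lemma centralizer_commute: "g \<in> centralizer V \<tau> \<Longrightarrow> g (\<tau> v) = \<tau> (g v)"
  by (simp add: centralizer_def fun_eq_iff)

lemma root_centralizer: "g \<in> centralizer V \<tau> \<Longrightarrow> root (g v) = root v"
  unfolding root_def orbit_centralizer
  by (subst card_image) (auto intro: permutes_inj_on dest: centralizer_permutes)

text \<open>An element of the centralizer maps cycles to cycles, so composing with it only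
  rearranges the factors.\<close>

lemma orbit_prod_comp:
  assumes h: "\<And>v. h (\<tau> v) = h v" and g: "g \<in> centralizer V \<tau>"
  shows "orbit_prod (\<lambda>v. h (g v)) = orbit_prod h"
proof -
  define s where "s C = (SOME v. v \<in> C)" for C :: "'a set"
  define R where "R = s ` orbit \<tau> ` V"
  have s: "s (orbit \<tau> v) \<in> orbit \<tau> v" for v unfolding s_def by (rule some_in_orbit)
  have os: "orbit \<tau> (s (orbit \<tau> v)) = orbit \<tau> v" for v using s by (simp add: orbit_eq_iff)
  have inj: "inj_on (orbit \<tau>) R" unfolding R_def by (auto simp: inj_on_def os)
  have img: "orbit \<tau> ` R = orbit \<tau> ` V" unfolding R_def by (auto simp: image_image os)
  have gp: "g permutes V" using g by (rule centralizer_permutes)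
  have injg: "inj_on g A" for A by (rule permutes_inj_on[OF gp])
  have "orbit_prod (\<lambda>v. h (g v)) = prod (\<lambda>v. h (g v)) R"
    by (rule orbit_prod_transversal[OF _ inj img]) (simp add: centralizer_commute[OF g] h)
  also have "\<dots> = prod h (g ` R)" by (simp add: prod.reindex[OF injg])
  also have "\<dots> = orbit_prod h"
  proof (rule orbit_prod_transversal[of h, OF h, symmetric])
    show "inj_on (orbit \<tau>) (g ` R)"
      using inj permutes_inj[OF gp] by (auto simp: inj_on_def orbit_centralizer[OF g] inj_image_eq_iff)
    have "orbit \<tau> ` g ` R = (\<lambda>C. g ` C) ` orbit \<tau> ` R"
      by (simp add: image_image orbit_centralizer[OF g])
    also have "\<dots> = orbit \<tau> ` g ` V" unfolding img by (simp add: image_image orbit_centralizer[OF g])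
    finally show "orbit \<tau> ` g ` R = orbit \<tau> ` V" by (simp add: permutes_image[OF gp])
  qed
  finally show ?thesis .
qed

text \<open>The centralizer is a product of wreath products of cyclic with symmetric groups. On it,
  \<open>chi\<close> is the linear character that sends the one-step rotation of a single cycle of
  length l to exp(2 pi i / l) and is trivial on permutations of cycles that match chosen
  representatives.\<close>

definition chi :: "('a \<Rightarrow> complex) \<Rightarrow> ('a \<Rightarrow> 'a) \<Rightarrow> complex" where
  "chi f g = orbit_prod (\<lambda>v. f (g v) / f v)"

lemma eigenfunction_nz: "eigenfunction f \<Longrightarrow> f v \<noteq> 0"
  unfolding eigenfunction_def by (metis norm_zero zero_neq_one)

lemma root_nz: "root v \<noteq> 0"
  by (simp add: root_def)

lemma eigenfunction_quotient:
  assumes "eigenfunction f" "g \<in> centralizer V \<tau>"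
  shows "f (g (\<tau> v)) / f (\<tau> v) = f (g v) / f v"
  using assms root_nz[of v] unfolding eigenfunction_def
  by (simp add: centralizer_commute root_centralizer)

lemma chi_id: "eigenfunction f \<Longrightarrow> chi f id = 1"
  by (simp add: chi_def orbit_prod_def eigenfunction_nz)

lemma norm_chi: "eigenfunction f \<Longrightarrow> norm (chi f g) = 1"
  unfolding chi_def orbit_prod_def prod_norm[symmetric]
  by (simp add: norm_divide eigenfunction_def)

lemma chi_comp:
  assumes f: "eigenfunction f" and g: "g \<in> centralizer V \<tau>" and h: "h \<in> centralizer V \<tau>"
  shows "chi f (g \<circ> h) = chi f g * chi f h"
proof -
  have "chi f (g \<circ> h) = orbit_prod (\<lambda>v. f (g (h v)) / f (h v) * (f (h v) / f v))"
    unfolding chi_def by (intro orbit_prod_cong) (simp add: eigenfunction_nz[OF f])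
  also have "\<dots> = orbit_prod (\<lambda>v. f (g (h v)) / f (h v)) * chi f h"
    unfolding orbit_prod_mult chi_def ..
  also have "orbit_prod (\<lambda>v. f (g (h v)) / f (h v)) = chi f g"
    unfolding chi_def
    using orbit_prod_comp[of "\<lambda>v. f (g v) / f v", OF eigenfunction_quotient[OF f g] h] .
  finally show ?thesis .
qed

text \<open>The ratio of two eigenfunctions is constant on cycles, and \<open>g\<close> only
  permutes the cycles, so the product of the ratios cancels.\<close>

lemma chi_unique:
  assumes f: "eigenfunction f" and f': "eigenfunction f'" and g: "g \<in> centralizer V \<tau>"
  shows "chi f g = chi f' g"
proof -
  have inv: "f (\<tau> v) / f' (\<tau> v) = f v / f' v" for v
    using f f' root_nz[of v] by (simp add: eigenfunction_def)
  have nz: "orbit_prod (\<lambda>v. f v / f' v) \<noteq> 0"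
    using fin by (simp add: orbit_prod_def eigenfunction_nz[OF f] eigenfunction_nz[OF f'])
  have "chi f g * orbit_prod (\<lambda>v. f v / f' v) = chi f' g * orbit_prod (\<lambda>v. f (g v) / f' (g v))"
    unfolding chi_def orbit_prod_mult[symmetric]
    by (intro orbit_prod_cong) (simp add: eigenfunction_nz[OF f] eigenfunction_nz[OF f'])
  also have "orbit_prod (\<lambda>v. f (g v) / f' (g v)) = orbit_prod (\<lambda>v. f v / f' v)"
    using orbit_prod_comp[of "\<lambda>v. f v / f' v", OF inv g] .
  finally show ?thesis using nz by simp
qed

text \<open>By \<open>chi_unique\<close> the eigenfunction may be exchanged for one that equals 1 at
  all representatives; every factor is then 1.\<close>

lemma chi_eq_1:
  assumes f: "eigenfunction f" and g: "g \<in> centralizer V \<tau>"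
    and rp: "\<And>v. rp v \<in> orbit \<tau> v" "\<And>v. rp (\<tau> v) = rp v" and g_rp: "\<And>v. v \<in> V \<Longrightarrow> g (rp v) = rp (g v)"
  shows "chi f g = 1"
proof -
  obtain f' where f': "eigenfunction f'" "\<And>v. f' (rp v) = 1"
    using eigenfunction_exists[OF rp] by blast
  have orp: "orbit \<tau> (rp v) = orbit \<tau> v" for v using rp by (simp add: orbit_eq_iff)
  have rp_rp: "rp u = rp v" if "orbit \<tau> u = orbit \<tau> v" for u v
    using invariant_on_orbit[of rp, OF rp(2)] that by (simp add: orbit_eq_iff)
  have "chi f g = chi f' g" by (rule chi_unique[OF f f'(1) g])
  also have "\<dots> = (\<Prod>v\<in>rp ` V. f' (g v) / f' v)"
    unfolding chi_def
    by (rule orbit_prod_transversal[of "\<lambda>v. f' (g v) / f' v", OF eigenfunction_quotient[OF f'(1) g]])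
      (auto simp: inj_on_def orp image_image dest: rp_rp)
  also have "\<dots> = 1" by (rule prod.neutral) (auto simp: g_rp f')
  finally show ?thesis .
qed

lemma rotation:
  fixes a :: nat
  assumes f: "eigenfunction f" and u: "u \<in> V"
  defines "g \<equiv> \<lambda>v. if v \<in> orbit \<tau> u then (\<tau> ^^ a) v else v"
  shows "g \<in> centralizer V \<tau>" "chi f g = root u ^ a"
proof -
  have orb: "\<tau> v \<in> orbit \<tau> u \<longleftrightarrow> v \<in> orbit \<tau> u" for v
    using orbit_step_eq orbit_eq_iff by metis
  have orba: "(\<tau> ^^ a) v \<in> orbit \<tau> u \<longleftrightarrow> v \<in> orbit \<tau> u" for v a
    by (induction a) (auto simp: orb)
  have inja: "inj (\<tau> ^^ a)" using permutes_inj[OF perm] by (simp add: inj_fn)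
  have "inj g"
    unfolding g_def inj_def by (auto split: if_splits simp: orba inj_eq[OF inja])
  moreover have "g v = v" if "v \<notin> V" for v
    using that orbit_subset_V[OF u] by (auto simp: g_def)
  moreover have "g ` V \<subseteq> V" by (auto simp: g_def funpow_in_V)
  moreover have "inj_on g V" using \<open>inj g\<close> by (rule inj_on_subset) simp
  ultimately have "g permutes V"
    using endo_inj_surj[OF fin, of g] by (intro bij_imp_permutes) (auto simp: bij_betw_def)
  then show g: "g \<in> centralizer V \<tau>"
    by (auto simp: centralizer_def g_def fun_eq_iff orb funpow_swap1)
  have "chi f g = (\<Prod>C\<in>orbit \<tau> ` V. if C = orbit \<tau> u then root u ^ a else 1)"
    unfolding chi_def orbit_prod_def
  proof (intro prod.cong refl)
    fix C assume "C \<in> orbit \<tau> ` V"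
    then obtain v where C: "C = orbit \<tau> v" by blast
    define r where "r = (SOME x. x \<in> C)"
    have r: "r \<in> C" unfolding r_def C by (rule some_in_orbit)
    have "orbit \<tau> r = C" using r C by (simp add: orbit_eq_iff)
    then have iff: "r \<in> orbit \<tau> u \<longleftrightarrow> C = orbit \<tau> u" using orbit_eq_iff by metis
    have "root r = root u" if "C = orbit \<tau> u"
      using that \<open>orbit \<tau> r = C\<close> by (simp add: root_def)
    then show "f (g r) / f r = (if C = orbit \<tau> u then root u ^ a else 1)"
      using iff eigenfunction_nz[OF f] by (simp add: g_def eigenfunction_funpow[OF f])
  qed
  also have "\<dots> = root u ^ a" using u fin by (simp add: prod.delta)
  finally show "chi f g = root u ^ a" .
qed

end

text \<open>If the stabilizer contains a nontrivial rotation of a single cycle, \<open>chi\<close>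
  is nontrivial on it and sums to 0, and there are no compatible permutations. Otherwise every cycle
  reads a primitive word, \<open>chi\<close> is trivial on the stabilizer, and the sum is its
  order.\<close>

lemma card_compatible_eq_sum_chi:
  fixes \<tau> w :: "nat \<Rightarrow> nat"
  assumes \<tau>: "\<tau> permutes {1..n}" and f: "finite_perm.eigenfunction \<tau> f"
  shows "of_nat (card (compatible {1..n} \<tau> w)) = (\<Sum>g\<in>word_stab {1..n} \<tau> w. finite_perm.chi {1..n} \<tau> f g)"
proof -
  define V where "V = {1..n}"
  have V: "V = {1..n}" by (fact V_def)
  have \<tau>V: "\<tau> permutes V" using \<tau> by (simp only: V)
  interpret finite_perm V \<tau> by unfold_locales (use \<tau>V in \<open>auto simp: V\<close>)
  obtain K :: "nat \<Rightarrow> nat" where K: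
    "\<And>u v. u \<in> V \<Longrightarrow> v \<in> V \<Longrightarrow> K u = K v \<Longrightarrow> w u = w v \<and> K (\<tau> u) = K (\<tau> v)"
    "\<And>u v. u \<in> V \<Longrightarrow> v \<in> V \<Longrightarrow> K u < K v \<Longrightarrow> w u < w v \<or> (w u = w v \<and> K (\<tau> u) < K (\<tau> v))"
    "\<And>u v. u \<in> V \<Longrightarrow> v \<in> V \<Longrightarrow> (\<And>l. w ((\<tau> ^^ l) u) = w ((\<tau> ^^ l) v)) \<Longrightarrow> K u = K v"
    "\<And>u v. u \<in> V \<Longrightarrow> v \<in> V \<Longrightarrow> K (\<tau> u) = K (\<tau> v) \<Longrightarrow> K u = K v"
    by (rule word_key[OF fin perm, of w]) blast
  interpret keyed_word V n \<tau> w K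
    by unfold_locales (fact V \<tau>V K)+
  let ?H = "word_stab V \<tau> w"
  have H_cent: "g \<in> centralizer V \<tau>" if "g \<in> ?H" for g using that by (simp add: word_stab_def)
  have "of_nat (card (compatible V \<tau> w)) = (\<Sum>g\<in>?H. chi f g)"
  proof (cases "compatible V \<tau> w = {}")
    case False
    then obtain \<sigma> where \<sigma>: "\<sigma> \<in> compatible V \<tau> w" by blast
    have p: "\<sigma> permutes V" using \<sigma> by (rule compatible_permutes)
    \<comment> \<open>The representative of a cycle is its point of least label. Along the cycle the
      keys are distinct and decide the order of labels; \<open>g\<close> preserves keys, so it
      carries least points to least points.\<close>
    have "chi f g = 1" if g: "g \<in> ?H" for g
    proof (rule chi_eq_1[OF f H_cent[OF g], of "\<lambda>v. inv \<sigma> (Min (\<sigma> ` orbit \<tau> v))"])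
      have fo: "finite (orbit \<tau> v)" for v by (rule finite_orbit[OF self_in_orbit])
      define r where "r v = inv \<sigma> (Min (\<sigma> ` orbit \<tau> v))" for v
      have \<sigma>r: "\<sigma> (r v) = Min (\<sigma> ` orbit \<tau> v)" for v by (simp add: r_def permutes_inverses[OF p])
      show r_in: "inv \<sigma> (Min (\<sigma> ` orbit \<tau> v)) \<in> orbit \<tau> v" for v
      proof -
        have "Min (\<sigma> ` orbit \<tau> v) \<in> \<sigma> ` orbit \<tau> v"
          using fo[of v] orbit_nonempty[of \<tau> v] by (intro Min_in) auto
        then show ?thesis using permutes_inverses[OF p] by auto
      qed
      show "inv \<sigma> (Min (\<sigma> ` orbit \<tau> (\<tau> v))) = inv \<sigma> (Min (\<sigma> ` orbit \<tau> v))" for v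
        by (simp add: orbit_step_eq)
      fix v assume v: "v \<in> V"
      have rV: "r v \<in> V" using r_in[of v] orbit_subset_V[OF v] unfolding r_def by blast
      have gK: "K (g x) = K x" "g x \<in> V" if "x \<in> V" for x
        using g that stab_iff permutes_in_image[OF centralizer_permutes[OF H_cent[OF g]]] by auto
      have "Min (\<sigma> ` orbit \<tau> (g v)) = \<sigma> (g (r v))"
      proof (rule Min_eqI)
        show "\<sigma> (g (r v)) \<in> \<sigma> ` orbit \<tau> (g v)"
          using r_in[of v] unfolding orbit_centralizer[OF H_cent[OF g]] r_def by blast
        fix y assume "y \<in> \<sigma> ` orbit \<tau> (g v)"
        then obtain x where x: "x \<in> orbit \<tau> v" "y = \<sigma> (g x)"
          unfolding orbit_centralizer[OF H_cent[OF g]] by blast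
        have xV: "x \<in> V" using x(1) orbit_subset_V[OF v] by blast
        show "\<sigma> (g (r v)) \<le> y"
        proof (cases "x = r v")
          case False
          have "x \<in> orbit \<tau> (r v)" using r_in[of v, folded orbit_eq_iff] x(1) by (simp add: r_def)
          then obtain a where a: "x = (\<tau> ^^ a) (r v)" unfolding orbit_funpow by blast
          have "K x \<noteq> K (r v)" using False compatible_imp_primitive[OF \<sigma> rV, of a] unfolding a by blast
          moreover have "\<sigma> (r v) \<le> \<sigma> x" unfolding \<sigma>r using x(1) fo by (intro Min_le) auto
          ultimately have "K x < K (r v)" using K_imp_less[OF \<sigma> xV rV] by fastforce
          then show ?thesis using K_imp_less[OF \<sigma> gK(2)[OF rV] gK(2)[OF xV]] gK(1) rV xV x(2) by auto
        qed (simp add: x(2))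
      qed (use fo in auto)
      then show "g (inv \<sigma> (Min (\<sigma> ` orbit \<tau> v))) = inv \<sigma> (Min (\<sigma> ` orbit \<tau> (g v)))"
        by (simp add: r_def permutes_inverses[OF p])
    qed
    then show ?thesis using card_compatible[OF \<sigma>] by simp
  next
    case True
    then obtain u a where u: "u \<in> V" "K ((\<tau> ^^ a) u) = K u" "(\<tau> ^^ a) u \<noteq> u"
      using primitive_imp_compatible by blast
    define h where "h v = (if v \<in> orbit \<tau> u then (\<tau> ^^ a) v else v)" for v
    have h: "h \<in> centralizer V \<tau>" "chi f h = root u ^ a"
      using rotation[OF f u(1), of a] unfolding h_def[abs_def] by auto
    have "K (h v) = K v" for v
    proof (cases "v \<in> orbit \<tau> u")
      case True
      then obtain b where b: "v = (\<tau> ^^ b) u" unfolding orbit_funpow by blast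
      have "K ((\<tau> ^^ b) ((\<tau> ^^ a) u)) = K ((\<tau> ^^ b) u)"
        using u by (intro K_funpow) (auto simp: funpow_in_V)
      moreover have "(\<tau> ^^ b) ((\<tau> ^^ a) u) = (\<tau> ^^ a) ((\<tau> ^^ b) u)"
        by (metis add.commute comp_apply funpow_add)
      ultimately show ?thesis using True by (simp add: h_def b)
    qed (simp add: h_def)
    then have hH: "h \<in> ?H" using h(1) by (simp add: stab_iff)
    have hp: "h permutes V" using h(1) by (rule centralizer_permutes)
    \<comment> \<open>Translation by \<open>h\<close> multiplies the sum by \<open>chi f h\<close>,
      which is not 1; hence the sum is 0.\<close>
    have "(\<Sum>g\<in>?H. chi f g) = (\<Sum>g\<in>?H. chi f (h \<circ> g))"
    proof -
      have hi: "h \<circ> (inv h \<circ> g) = g" "inv h \<circ> (h \<circ> g) = g" for g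
        by (simp_all add: fun_eq_iff permutes_inverses[OF hp])
      show ?thesis
        by (rule sum.reindex_bij_witness[of _ "\<lambda>g. h \<circ> g" "\<lambda>g. inv h \<circ> g"])
          (simp_all add: hi word_stab_comp word_stab_inv hH)
    qed
    also have "\<dots> = chi f h * (\<Sum>g\<in>?H. chi f g)"
      unfolding sum_distrib_left by (intro sum.cong refl chi_comp[OF f h(1) H_cent])
    finally have "(\<Sum>g\<in>?H. chi f g) = chi f h * (\<Sum>g\<in>?H. chi f g)" .
    moreover have "chi f h \<noteq> 1" using u(3) by (simp add: h(2) root_power_eq_1_iff)
    ultimately show ?thesis using True by simp
  qed
  then show ?thesis by (simp only: V)
qed

section \<open>P-partitions of a permutation and double counting\<close>

definition descent_sequences :: "nat \<Rightarrow> nat set \<Rightarrow> nat \<Rightarrow> (nat \<Rightarrow> nat) set" where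
  "descent_sequences n D k = {i \<in> {1..n} \<rightarrow>\<^sub>E {..<k}. \<forall>j\<in>{1..<n}.
     i (Suc j) \<le> i j \<and> (j \<in> D \<longrightarrow> i (Suc j) < i j)}"

lemma finite_descent_sequences: "finite (descent_sequences n D k)"
proof -
  have "finite ({1..n} \<rightarrow>\<^sub>E {..<k})" by (intro finite_PiE) auto
  then show ?thesis by (rule rev_finite_subset) (auto simp: descent_sequences_def)
qed

lemma compatible_iff_descent_sequence:
  fixes \<tau> \<sigma> w :: "nat \<Rightarrow> nat"
  assumes \<tau>: "\<tau> permutes {1..n}" and \<sigma>: "\<sigma> permutes {1..n}"
    and i: "i \<in> {1..n} \<rightarrow>\<^sub>E {..<k}" and w: "\<And>v. v \<in> {1..n} \<Longrightarrow> w v = i (\<sigma> v)"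
  shows "\<sigma> \<in> compatible {1..n} \<tau> w \<longleftrightarrow> i \<in> descent_sequences n (descents n (\<sigma> \<circ> \<tau> \<circ> inv \<sigma>)) k"
proof -
  define V where "V = {1..n}"
  define \<pi> where "\<pi> = \<sigma> \<circ> \<tau> \<circ> inv \<sigma>"
  have \<sigma>V: "\<sigma> v \<in> V \<longleftrightarrow> v \<in> V" for v unfolding V_def by (rule permutes_in_image[OF \<sigma>])
  have inv\<sigma>V: "inv \<sigma> v \<in> V \<longleftrightarrow> v \<in> V" for v unfolding V_def by (rule permutes_in_image[OF permutes_inv[OF \<sigma>]])
  have inj\<pi>: "inj \<pi>" unfolding \<pi>_def
    using permutes_inj[OF permutes_compose[OF permutes_compose[OF permutes_inv[OF \<sigma>] \<tau>] \<sigma>]]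
    by (simp only: o_assoc)
  have \<pi>\<sigma>: "\<sigma> (\<tau> u) = \<pi> (\<sigma> u)" for u by (simp add: \<pi>_def permutes_inverses[OF \<sigma>])
  have w': "w v = i (\<sigma> v)" if "v \<in> V" for v using w that by (simp add: V_def)
  have "\<sigma> \<in> compatible V \<tau> w \<longleftrightarrow> (\<forall>u\<in>V. \<forall>v\<in>V. \<sigma> u < \<sigma> v \<longrightarrow>
     i (\<sigma> v) < i (\<sigma> u) \<or> (i (\<sigma> u) = i (\<sigma> v) \<and> \<pi> (\<sigma> u) < \<pi> (\<sigma> v)))"
    unfolding compatible_def using \<sigma>[folded V_def] by (simp add: w' \<pi>\<sigma>)
  also have "\<dots> \<longleftrightarrow> (\<forall>a\<in>V. \<forall>b\<in>V. a < b \<longrightarrow> i b < i a \<or> (i a = i b \<and> \<pi> a < \<pi> b))"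
    (is "_ \<longleftrightarrow> ?R")
  proof
    assume *: "\<forall>u\<in>V. \<forall>v\<in>V. \<sigma> u < \<sigma> v \<longrightarrow>
       i (\<sigma> v) < i (\<sigma> u) \<or> (i (\<sigma> u) = i (\<sigma> v) \<and> \<pi> (\<sigma> u) < \<pi> (\<sigma> v))"
    show ?R
    proof (intro ballI impI)
      fix a b assume "a \<in> V" "b \<in> V" "a < b"
      then show "i b < i a \<or> (i a = i b \<and> \<pi> a < \<pi> b)"
        using *[rule_format, of "inv \<sigma> a" "inv \<sigma> b"] inv\<sigma>V by (simp add: permutes_inverses[OF \<sigma>])
    qed
  qed (simp add: \<sigma>V)
  also have "\<dots> \<longleftrightarrow> i \<in> descent_sequences n (descents n \<pi>) k"
  proof
    assume R: ?R
    have "i (Suc j) \<le> i j \<and> (j \<in> descents n \<pi> \<longrightarrow> i (Suc j) < i j)" if j: "j \<in> {1..<n}" for j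
    proof -
      have "i (Suc j) < i j \<or> (i j = i (Suc j) \<and> \<pi> j < \<pi> (Suc j))"
        using R[rule_format, of j "Suc j"] j by (auto simp: V_def)
      then show ?thesis by (auto simp: descents_def)
    qed
    then show "i \<in> descent_sequences n (descents n \<pi>) k" using i by (simp add: descent_sequences_def)
  next
    assume D: "i \<in> descent_sequences n (descents n \<pi>) k"
    have step: "i (Suc j) < i j \<or> (i j = i (Suc j) \<and> \<pi> j < \<pi> (Suc j))" if "1 \<le> j" "j < n" for j
    proof -
      have le: "i (Suc j) \<le> i j" and lt: "j \<in> descents n \<pi> \<Longrightarrow> i (Suc j) < i j"
        using D that by (auto simp: descent_sequences_def)
      show ?thesis
      proof (cases "i (Suc j) < i j")
        case False
        then have "\<not> \<pi> (Suc j) < \<pi> j" using lt that by (auto simp: descents_def)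
        moreover have "\<pi> (Suc j) \<noteq> \<pi> j" by (simp add: inj_eq[OF inj\<pi>])
        ultimately show ?thesis using False le by auto
      qed simp
    qed
    \<comment> \<open>Compatibility speaks of all pairs, a descent sequence only of neighbours. The
      lexicographic relation is transitive, so neighbours suffice.\<close>
    have "i (a + Suc m) < i a \<or> (i a = i (a + Suc m) \<and> \<pi> a < \<pi> (a + Suc m))" if "1 \<le> a" "a + Suc m \<le> n" for a m
      using that(2)
    proof (induction m)
      case 0
      then show ?case using step[of a] that(1) by simp
    next
      case (Suc m)
      from Suc have IH: "i (a + Suc m) < i a \<or> (i a = i (a + Suc m) \<and> \<pi> a < \<pi> (a + Suc m))" by simp
      have "i (Suc (a + Suc m)) < i (a + Suc m) \<or>
          (i (a + Suc m) = i (Suc (a + Suc m)) \<and> \<pi> (a + Suc m) < \<pi> (Suc (a + Suc m)))"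
        using that(1) Suc.prems by (intro step) auto
      then show ?case using IH by auto
    qed
    note run = this
    show ?R
    proof (intro ballI impI)
      fix a b assume ab: "a \<in> V" "b \<in> V" "a < b"
      then obtain m where "b = a + Suc m" using less_imp_Suc_add by auto
      then show "i b < i a \<or> (i a = i b \<and> \<pi> a < \<pi> b)" using run[of a m] ab by (auto simp: V_def)
    qed
  qed
  finally show ?thesis unfolding V_def \<pi>_def .
qed

text \<open>Both sides evaluate one weighted sum over pairs of a word \<open>w\<close> and a
  compatible \<sigma>. For fixed \<sigma> the word becomes the descent sequence
  \<open>w \<circ> inv \<sigma>\<close>; for fixed \<open>w\<close> the number of \<sigma> is a
  character sum, and its elements \<open>g\<close> are then moved outside.\<close>

lemma sum_descent_sequences_eq_sum_centralizer:
  fixes \<tau> :: "nat \<Rightarrow> nat" and x :: "nat \<Rightarrow> complex"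
  assumes \<tau>: "\<tau> permutes {1..n}" and f: "finite_perm.eigenfunction \<tau> f"
  shows "(\<Sum>\<sigma> | \<sigma> permutes {1..n}. \<Sum>i\<in>descent_sequences n (descents n (\<sigma> \<circ> \<tau> \<circ> inv \<sigma>)) k. \<Prod>j\<in>{1..n}. x (i j)) =
    (\<Sum>g\<in>centralizer {1..n} \<tau>. finite_perm.chi {1..n} \<tau> f g *
       (\<Sum>w | w \<in> {1..n} \<rightarrow>\<^sub>E {..<k} \<and> (\<forall>v\<in>{1..n}. w (g v) = w v). \<Prod>v\<in>{1..n}. x (w v)))"
proof -
  define V where "V = {1..n}"
  let ?W = "V \<rightarrow>\<^sub>E {..<k}"
  have finV: "finite V" by (simp add: V_def)
  have finW: "finite ?W" by (intro finite_PiE) (auto simp: V_def)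
  have finP: "finite {\<sigma>. \<sigma> permutes V}" by (rule finite_permutations[OF finV])
  have "(\<Sum>i\<in>descent_sequences n (descents n (\<sigma> \<circ> \<tau> \<circ> inv \<sigma>)) k. \<Prod>j\<in>V. x (i j)) =
      (\<Sum>w\<in>?W. if \<sigma> \<in> compatible V \<tau> w then \<Prod>v\<in>V. x (w v) else 0)" if \<sigma>: "\<sigma> permutes V" for \<sigma>
  proof -
    have \<sigma>V: "\<sigma> v \<in> V \<longleftrightarrow> v \<in> V" for v by (rule permutes_in_image[OF \<sigma>])
    have inv\<sigma>V: "inv \<sigma> v \<in> V \<longleftrightarrow> v \<in> V" for v by (rule permutes_in_image[OF permutes_inv[OF \<sigma>]])
    have "(\<Sum>w\<in>?W. if \<sigma> \<in> compatible V \<tau> w then \<Prod>v\<in>V. x (w v) else 0) =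
        (\<Sum>w | w \<in> ?W \<and> \<sigma> \<in> compatible V \<tau> w. \<Prod>v\<in>V. x (w v))"
      using finW by (simp add: sum.If_cases Int_def)
    also have "\<dots> = (\<Sum>i\<in>descent_sequences n (descents n (\<sigma> \<circ> \<tau> \<circ> inv \<sigma>)) k. \<Prod>j\<in>V. x (i j))"
    proof (rule sum.reindex_bij_witness[of _ "\<lambda>i. restrict (i \<circ> \<sigma>) V" "\<lambda>w. restrict (w \<circ> inv \<sigma>) V"])
      fix w assume w: "w \<in> {w. w \<in> ?W \<and> \<sigma> \<in> compatible V \<tau> w}"
      then have wW: "w \<in> ?W" by blast
      show "restrict (restrict (w \<circ> inv \<sigma>) V \<circ> \<sigma>) V = w"
      proof
        fix v show "restrict (restrict (w \<circ> inv \<sigma>) V \<circ> \<sigma>) V v = w v"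
          by (cases "v \<in> V") (simp_all add: permutes_inverses[OF \<sigma>] \<sigma>V PiE_arb[OF wW])
      qed
      have i: "restrict (w \<circ> inv \<sigma>) V \<in> ?W" using w inv\<sigma>V by (auto simp: PiE_mem)
      then show "restrict (w \<circ> inv \<sigma>) V \<in> descent_sequences n (descents n (\<sigma> \<circ> \<tau> \<circ> inv \<sigma>)) k"
        using compatible_iff_descent_sequence[OF \<tau>, of \<sigma> "restrict (w \<circ> inv \<sigma>) V" k w] w \<sigma> \<sigma>V
        unfolding V_def[symmetric] by (simp add: permutes_inverses[OF \<sigma>])
      show "(\<Prod>v\<in>V. x (restrict (w \<circ> inv \<sigma>) V v)) = (\<Prod>v\<in>V. x (w v))"
        using prod.permute[OF permutes_inv[OF \<sigma>], of "\<lambda>v. x (w v)"] by (simp add: o_def)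
    next
      fix i assume i: "i \<in> descent_sequences n (descents n (\<sigma> \<circ> \<tau> \<circ> inv \<sigma>)) k"
      then have iW: "i \<in> ?W" by (simp add: descent_sequences_def V_def)
      show "restrict (restrict (i \<circ> \<sigma>) V \<circ> inv \<sigma>) V = i"
      proof
        fix v show "restrict (restrict (i \<circ> \<sigma>) V \<circ> inv \<sigma>) V v = i v"
          by (cases "v \<in> V") (simp_all add: permutes_inverses[OF \<sigma>] inv\<sigma>V PiE_arb[OF iW])
      qed
      have "restrict (i \<circ> \<sigma>) V \<in> ?W" using iW \<sigma>V by (auto simp: PiE_mem)
      moreover have "\<sigma> \<in> compatible V \<tau> (restrict (i \<circ> \<sigma>) V)"
        using compatible_iff_descent_sequence[OF \<tau>, of \<sigma> i k "restrict (i \<circ> \<sigma>) V"] i iW \<sigma>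
        unfolding V_def[symmetric] by simp
      ultimately show "restrict (i \<circ> \<sigma>) V \<in> {w. w \<in> ?W \<and> \<sigma> \<in> compatible V \<tau> w}" by blast
    qed
    finally show ?thesis ..
  qed
  then have "(\<Sum>\<sigma> | \<sigma> permutes V. \<Sum>i\<in>descent_sequences n (descents n (\<sigma> \<circ> \<tau> \<circ> inv \<sigma>)) k. \<Prod>j\<in>V. x (i j)) =
      (\<Sum>\<sigma> | \<sigma> permutes V. \<Sum>w\<in>?W. if \<sigma> \<in> compatible V \<tau> w then \<Prod>v\<in>V. x (w v) else 0)"
    by (intro sum.cong[of "{\<sigma>. \<sigma> permutes V}"] refl) simp
  also have "\<dots> = (\<Sum>w\<in>?W. \<Sum>\<sigma> | \<sigma> permutes V. if \<sigma> \<in> compatible V \<tau> w then \<Prod>v\<in>V. x (w v) else 0)"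
    by (rule sum.swap)
  also have "\<dots> = (\<Sum>w\<in>?W. of_nat (card (compatible V \<tau> w)) * (\<Prod>v\<in>V. x (w v)))"
  proof (intro sum.cong refl)
    fix w
    have "{\<sigma>. \<sigma> permutes V} \<inter> {\<sigma>. \<sigma> \<in> compatible V \<tau> w} = compatible V \<tau> w"
      by (auto simp: compatible_def)
    then show "(\<Sum>\<sigma> | \<sigma> permutes V. if \<sigma> \<in> compatible V \<tau> w then \<Prod>v\<in>V. x (w v) else 0) =
        of_nat (card (compatible V \<tau> w)) * (\<Prod>v\<in>V. x (w v))"
      using finP by (simp add: sum.If_cases)
  qed
  also have "\<dots> = (\<Sum>w\<in>?W. \<Sum>g\<in>centralizer V \<tau>. if \<forall>v\<in>V. w (g v) = w v
      then finite_perm.chi V \<tau> f g * (\<Prod>v\<in>V. x (w v)) else 0)"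
  proof (intro sum.cong refl)
    fix w
    have "of_nat (card (compatible V \<tau> w)) = (\<Sum>g\<in>word_stab V \<tau> w. finite_perm.chi V \<tau> f g)"
      unfolding V_def by (rule card_compatible_eq_sum_chi[OF \<tau> f])
    then show "of_nat (card (compatible V \<tau> w)) * (\<Prod>v\<in>V. x (w v)) =
      (\<Sum>g\<in>centralizer V \<tau>. if \<forall>v\<in>V. w (g v) = w v
      then finite_perm.chi V \<tau> f g * (\<Prod>v\<in>V. x (w v)) else 0)"
      using finite_centralizer[OF finV, of \<tau>]
      by (simp add: sum.If_cases word_stab_def Int_def sum_distrib_right)
  qed
  also have "\<dots> = (\<Sum>g\<in>centralizer V \<tau>. \<Sum>w\<in>?W. if \<forall>v\<in>V. w (g v) = w v
      then finite_perm.chi V \<tau> f g * (\<Prod>v\<in>V. x (w v)) else 0)"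
    by (rule sum.swap)
  also have "\<dots> = (\<Sum>g\<in>centralizer V \<tau>. finite_perm.chi V \<tau> f g *
       (\<Sum>w | w \<in> ?W \<and> (\<forall>v\<in>V. w (g v) = w v). \<Prod>v\<in>V. x (w v)))"
    using finW by (simp add: sum.If_cases Int_def sum_distrib_left)
  finally show ?thesis unfolding V_def .
qed

section \<open>Descent sequences and the generating function\<close>

lemma descent_sequences_cong: "D \<inter> {1..<n} = D' \<inter> {1..<n} \<Longrightarrow> descent_sequences n D k = descent_sequences n D' k"
  unfolding descent_sequences_def by blast

lemma descent_sequence_antimono:
  assumes "i \<in> descent_sequences n D k" "1 \<le> j" "j \<le> n"
  shows "i n \<le> i j"
proof -
  have "j + m \<le> n \<Longrightarrow> i (j + m) \<le> i j" for m
  proof (induction m)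
    case (Suc m)
    have "i (Suc (j + m)) \<le> i (j + m)"
      using assms Suc.prems by (auto simp: descent_sequences_def)
    then show ?case using Suc by simp
  qed simp
  from this[of "n - j"] show ?thesis using assms by simp
qed

lemma sum_descent_sequences_shift:
  fixes q :: "'a::comm_ring_1"
  assumes n: "n \<ge> 1"
  shows "(\<Sum>i | i \<in> descent_sequences n D (Suc k) \<and> 1 \<le> i n. \<Prod>j\<in>{1..n}. q ^ i j) =
    q ^ n * (\<Sum>i\<in>descent_sequences n D k. \<Prod>j\<in>{1..n}. q ^ i j)"
proof -
  define V where "V = {1..n}"
  have "(\<Sum>i | i \<in> descent_sequences n D (Suc k) \<and> 1 \<le> i n. \<Prod>j\<in>V. q ^ i j) =
     (\<Sum>i\<in>descent_sequences n D k. \<Prod>j\<in>V. q ^ Suc (i j))"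
  proof (rule sum.reindex_bij_witness[of _ "\<lambda>i. \<lambda>j\<in>V. Suc (i j)" "\<lambda>i. \<lambda>j\<in>V. i j - 1"])
    fix i assume i: "i \<in> {i. i \<in> descent_sequences n D (Suc k) \<and> 1 \<le> i n}"
    then have iE: "i \<in> V \<rightarrow>\<^sub>E {..<Suc k}" by (simp add: descent_sequences_def V_def)
    have pos: "1 \<le> i j" if "j \<in> V" for j
      using descent_sequence_antimono[of i n D "Suc k" j] i that by (auto simp: V_def)
    show "(\<lambda>j\<in>V. Suc ((\<lambda>j\<in>V. i j - 1) j)) = i"
    proof
      fix j show "(\<lambda>j\<in>V. Suc ((\<lambda>j\<in>V. i j - 1) j)) j = i j"
        using pos[of j] by (cases "j \<in> V") (simp_all add: PiE_arb[OF iE])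
    qed
    have bd: "i j < Suc k" if "j \<in> V" for j using PiE_mem[OF iE that] by simp
    have "(\<lambda>j\<in>V. i j - 1) \<in> V \<rightarrow>\<^sub>E {..<k}"
    proof (rule restrict_PiE_iff[THEN iffD2], rule ballI)
      fix j assume "j \<in> V"
      then show "i j - 1 \<in> {..<k}" using pos[of j] bd[of j] by auto
    qed
    moreover have "i (Suc j) - 1 \<le> i j - 1 \<and> (j \<in> D \<longrightarrow> i (Suc j) - 1 < i j - 1)" if "j \<in> {1..<n}" for j
    proof -
      have "i (Suc j) \<le> i j \<and> (j \<in> D \<longrightarrow> i (Suc j) < i j)"
        using i that by (simp add: descent_sequences_def)
      moreover have "1 \<le> i (Suc j)" using that by (intro pos) (auto simp: V_def)
      ultimately show ?thesis by auto
    qed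
    ultimately show "(\<lambda>j\<in>V. i j - 1) \<in> descent_sequences n D k"
      unfolding descent_sequences_def by (auto simp: V_def)
    show "(\<Prod>j\<in>V. q ^ Suc ((\<lambda>j\<in>V. i j - 1) j)) = (\<Prod>j\<in>V. q ^ i j)"
      using pos by (intro prod.cong refl) (metis One_nat_def Suc_diff_le diff_Suc_Suc diff_zero restrict_apply')
  next
    fix i assume i: "i \<in> descent_sequences n D k"
    then have iE: "i \<in> V \<rightarrow>\<^sub>E {..<k}" by (simp add: descent_sequences_def V_def)
    show "(\<lambda>j\<in>V. (\<lambda>j\<in>V. Suc (i j)) j - 1) = i"
    proof
      fix j show "(\<lambda>j\<in>V. (\<lambda>j\<in>V. Suc (i j)) j - 1) j = i j"
        by (cases "j \<in> V") (simp_all add: PiE_arb[OF iE])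
    qed
    have "(\<lambda>j\<in>V. Suc (i j)) \<in> V \<rightarrow>\<^sub>E {..<Suc k}"
      using PiE_mem[OF iE] by auto
    moreover have "Suc j \<in> V \<and> j \<in> V" if "j \<in> {1..<n}" for j
      using that by (auto simp: V_def)
    ultimately show "(\<lambda>j\<in>V. Suc (i j)) \<in> {i. i \<in> descent_sequences n D (Suc k) \<and> 1 \<le> i n}"
      using i n unfolding descent_sequences_def by (auto simp: V_def)
  qed
  also have "\<dots> = q ^ n * (\<Sum>i\<in>descent_sequences n D k. \<Prod>j\<in>V. q ^ i j)"
    by (simp add: prod.distrib sum_distrib_left V_def)
  finally show ?thesis by (simp only: V_def)
qed

text \<open>A final zero can be cut off; if \<open>n\<close> is a descent position, strictness
  before the zero survives as a positive last entry. For \<open>n = 0\<close> no entry precedes it,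
  hence the guard \<open>1 \<le> n\<close>.\<close>

lemma sum_descent_sequences_last_zero:
  fixes q :: "'a::comm_ring_1"
  shows "(\<Sum>i | i \<in> descent_sequences (Suc n) D (Suc k) \<and> i (Suc n) = 0. \<Prod>j\<in>{1..Suc n}. q ^ i j) =
    (\<Sum>i | i \<in> descent_sequences n D (Suc k) \<and> (n \<in> D \<and> 1 \<le> n \<longrightarrow> 1 \<le> i n). \<Prod>j\<in>{1..n}. q ^ i j)"
proof (rule sum.reindex_bij_witness[of _ "\<lambda>i. i(Suc n := 0)" "\<lambda>i. restrict i {1..n}"])
  fix i assume i: "i \<in> {i. i \<in> descent_sequences (Suc n) D (Suc k) \<and> i (Suc n) = 0}"
  then have iE: "i \<in> {1..Suc n} \<rightarrow>\<^sub>E {..<Suc k}" by (simp add: descent_sequences_def)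
  show "(restrict i {1..n})(Suc n := 0) = i"
  proof
    fix j show "((restrict i {1..n})(Suc n := 0)) j = i j"
      using i PiE_arb[OF iE, of j] by (cases "j \<in> {1..Suc n}") auto
  qed
  have "restrict i {1..n} \<in> {1..n} \<rightarrow>\<^sub>E {..<Suc k}" using PiE_mem[OF iE] by auto
  moreover have "\<forall>j\<in>{1..<Suc n}. i (Suc j) \<le> i j \<and> (j \<in> D \<longrightarrow> i (Suc j) < i j)"
    using i by (simp add: descent_sequences_def)
  ultimately show "restrict i {1..n} \<in> {i. i \<in> descent_sequences n D (Suc k) \<and> (n \<in> D \<and> 1 \<le> n \<longrightarrow> 1 \<le> i n)}"
    using i unfolding descent_sequences_def by auto
  show "(\<Prod>j\<in>{1..n}. q ^ restrict i {1..n} j) = (\<Prod>j\<in>{1..Suc n}. q ^ i j)"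
    using i by simp
next
  fix i assume i: "i \<in> {i. i \<in> descent_sequences n D (Suc k) \<and> (n \<in> D \<and> 1 \<le> n \<longrightarrow> 1 \<le> i n)}"
  then have iE: "i \<in> {1..n} \<rightarrow>\<^sub>E {..<Suc k}" by (simp add: descent_sequences_def)
  show "restrict (i(Suc n := 0)) {1..n} = i"
  proof
    fix j show "restrict (i(Suc n := 0)) {1..n} j = i j"
      using PiE_arb[OF iE, of j] by (cases "j \<in> {1..n}") auto
  qed
  have "i(Suc n := 0) \<in> {1..Suc n} \<rightarrow>\<^sub>E {..<Suc k}"
  proof (rule PiE_I)
    fix j assume "j \<in> {1..Suc n}"
    then show "(i(Suc n := 0)) j \<in> {..<Suc k}"
      using PiE_mem[OF iE, of j] by (cases "j = Suc n") auto
  qed (use PiE_arb[OF iE] in auto)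
  moreover have "(i(Suc n := 0)) (Suc j) \<le> (i(Suc n := 0)) j \<and>
      (j \<in> D \<longrightarrow> (i(Suc n := 0)) (Suc j) < (i(Suc n := 0)) j)" if "j \<in> {1..<Suc n}" for j
    using i that by (cases "j = n") (auto simp: descent_sequences_def)
  ultimately show "i(Suc n := 0) \<in> {i. i \<in> descent_sequences (Suc n) D (Suc k) \<and> i (Suc n) = 0}"
    by (simp add: descent_sequences_def)
qed

text \<open>The Gaussian binomial coefficient of K + n over n. It vanishes for \<open>K\<close>
  between \<open>-n\<close> and \<open>-1\<close>; such values occur when the alphabet is too small
  for the number of descents.\<close>

definition q_prod :: "complex \<Rightarrow> nat \<Rightarrow> int \<Rightarrow> complex" where
  "q_prod q n K = (\<Prod>j\<in>{1..n}. (q powi (K + int j) - 1) / (q ^ j - 1))"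

text \<open>The q-Pascal rule, which matches the division of descent sequences by whether the last
  entry is positive.\<close>

lemma q_prod_Suc:
  assumes q: "q \<noteq> 0" "\<And>j. j \<ge> 1 \<Longrightarrow> q ^ j \<noteq> 1"
  shows "q_prod q (Suc n) K = q ^ Suc n * q_prod q (Suc n) (K - 1) + q_prod q n K"
proof -
  define d where "d = (\<Prod>j\<in>{1..Suc n}. q ^ j - 1)"
  have nz: "q ^ Suc n - 1 \<noteq> 0" using q(2)[of "Suc n"] by simp
  have 1: "q_prod q (Suc n) K = q_prod q n K * ((q powi (K + int (Suc n)) - 1) / (q ^ Suc n - 1))"
    by (simp add: q_prod_def)
  have "(\<Prod>j\<in>{1..Suc n}. q powi (K - 1 + int j) - 1) = (\<Prod>j\<in>{0..n}. q powi (K + int j) - 1)"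
    by (rule prod.reindex_bij_witness[of _ Suc "\<lambda>j. j - 1"]) (auto simp: algebra_simps of_nat_diff)
  also have "\<dots> = (q powi K - 1) * (\<Prod>j\<in>{1..n}. q powi (K + int j) - 1)"
    by (simp add: prod.atLeast0_atMost_Suc_shift prod.atLeast_Suc_atMost)
  finally have 2: "q_prod q (Suc n) (K - 1) = q_prod q n K * ((q powi K - 1) / (q ^ Suc n - 1))"
    by (simp add: q_prod_def prod_dividef del: power_Suc)
  have "(q powi (K + int (Suc n)) - 1) / (q ^ Suc n - 1) = q ^ Suc n * ((q powi K - 1) / (q ^ Suc n - 1)) + 1"
  proof -
    have "q powi (K + int (Suc n)) = q powi K * q ^ Suc n"
      using q(1) by (simp add: power_int_add power_int_of_nat del: of_nat_Suc power_Suc)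
    then show ?thesis using nz by (simp add: field_simps del: of_nat_Suc power_Suc)
  qed
  then show ?thesis unfolding 1 2 by (simp add: algebra_simps)
qed

text \<open>Sequences with positive last entry are shifted down, which lowers \<open>k\<close>;
  those that end in 0 are cut, which lowers \<open>n\<close>. If \<open>n\<close> is a descent, the
  cut sequence is shifted as well, and the power q^n gained in this way is the contribution of
  \<open>n\<close> to the sum of \<open>D\<close>.\<close>

lemma sum_descent_sequences:
  assumes q: "q \<noteq> 0" "\<And>j. j \<ge> 1 \<Longrightarrow> q ^ j \<noteq> (1::complex)"
    and D: "D \<subseteq> {1..<n}"
  shows "(\<Sum>i\<in>descent_sequences n D k. \<Prod>j\<in>{1..n}. q ^ i j) =
    q ^ (\<Sum>D) * q_prod q n (int k - 1 - int (card D))"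
  using D
proof (induction n arbitrary: D k)
  case 0
  have "descent_sequences 0 D k = {\<lambda>_. undefined}" by (auto simp: descent_sequences_def)
  then show ?case using 0 by (simp add: q_prod_def)
next
  case (Suc n)
  note outer = Suc.IH
  from Suc.prems show ?case
  proof (induction k)
    case 0
    have "descent_sequences (Suc n) D 0 = {}"
      by (auto simp: descent_sequences_def PiE_eq_empty_iff)
    moreover have "q_prod q (Suc n) (int 0 - 1 - int (card D)) = 0"
    proof -
      have "card D \<le> n" using card_mono[OF _ 0] by simp
      \<comment> \<open>The factor with \<open>j = card D + 1\<close> has exponent 0, so it
        vanishes.\<close>
      then have "card D + 1 \<in> {1..Suc n}" by simp
      then show ?thesis unfolding q_prod_def by (intro prod_zero) (auto intro!: bexI[of _ "card D + 1"])
    qed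
    ultimately show ?case by simp
  next
    case (Suc k)
    define S where "S m E l = (\<Sum>i\<in>descent_sequences m E l. \<Prod>j\<in>{1..m}. q ^ i j)" for m E l
    have fin: "finite D" using Suc.prems finite_subset by auto
    have "S (Suc n) D (Suc k) =
        (\<Sum>i | i \<in> descent_sequences (Suc n) D (Suc k) \<and> 1 \<le> i (Suc n). \<Prod>j\<in>{1..Suc n}. q ^ i j) +
        (\<Sum>i | i \<in> descent_sequences (Suc n) D (Suc k) \<and> i (Suc n) = 0. \<Prod>j\<in>{1..Suc n}. q ^ i j)"
      unfolding S_def
      by (subst sum.union_disjoint[symmetric])
        (auto intro!: sum.cong intro: finite_subset[OF _ finite_descent_sequences])
    also have "(\<Sum>i | i \<in> descent_sequences (Suc n) D (Suc k) \<and> 1 \<le> i (Suc n). \<Prod>j\<in>{1..Suc n}. q ^ i j) =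
        q ^ Suc n * S (Suc n) D k"
      unfolding S_def by (rule sum_descent_sequences_shift) simp
    also have "S (Suc n) D k = q ^ (\<Sum>D) * q_prod q (Suc n) (int k - 1 - int (card D))"
      unfolding S_def by (rule Suc.IH[OF Suc.prems])
    also have "(\<Sum>i | i \<in> descent_sequences (Suc n) D (Suc k) \<and> i (Suc n) = 0. \<Prod>j\<in>{1..Suc n}. q ^ i j) =
        q ^ (\<Sum>D) * q_prod q n (int k - int (card D))"
    proof (cases "n \<in> D")
      case True
      then have n: "1 \<le> n" using Suc.prems by auto
      have D': "D - {n} \<subseteq> {1..<n}" using Suc.prems by auto
      have c: "card D = Suc (card (D - {n}))" using True fin by (metis card_Suc_Diff1)
      have s: "\<Sum>D = n + \<Sum>(D - {n})" using True fin by (simp add: sum.remove)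
      have "(\<Sum>i | i \<in> descent_sequences (Suc n) D (Suc k) \<and> i (Suc n) = 0. \<Prod>j\<in>{1..Suc n}. q ^ i j) =
          (\<Sum>i | i \<in> descent_sequences n D (Suc k) \<and> 1 \<le> i n. \<Prod>j\<in>{1..n}. q ^ i j)"
        unfolding sum_descent_sequences_last_zero using True n by simp
      also have "\<dots> = q ^ n * S n D k" unfolding S_def by (rule sum_descent_sequences_shift[OF n])
      also have "S n D k = S n (D - {n}) k"
        unfolding S_def by (subst descent_sequences_cong[of D n "D - {n}"]) auto
      also have "\<dots> = q ^ (\<Sum>(D - {n})) * q_prod q n (int k - 1 - int (card (D - {n})))"
        unfolding S_def by (rule outer[OF D'])
      finally show ?thesis unfolding s c by (simp add: power_add algebra_simps)
    next
      case False
      then have D': "D \<subseteq> {1..<n}" using Suc.prems by (auto simp: less_Suc_eq)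
      have "(\<Sum>i | i \<in> descent_sequences (Suc n) D (Suc k) \<and> i (Suc n) = 0. \<Prod>j\<in>{1..Suc n}. q ^ i j) = S n D (Suc k)"
        unfolding sum_descent_sequences_last_zero S_def using False by simp
      also have "\<dots> = q ^ (\<Sum>D) * q_prod q n (int (Suc k) - 1 - int (card D))"
        unfolding S_def by (rule outer[OF D'])
      finally show ?thesis by simp
    qed
    finally show ?case
      using q_prod_Suc[OF q, of n "int k - int (card D)"] unfolding S_def
      by (simp add: algebra_simps)
  qed
qed

section \<open>Words fixed by a permutation and power sums\<close>

lemma (in finite_perm) orbit_fibre: "v \<in> V \<Longrightarrow> {u\<in>V. orbit \<tau> u = orbit \<tau> v} = orbit \<tau> v"
  using orbit_subset_V by (auto simp: orbit_eq_iff)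

lemma (in finite_perm) prod_over_orbits:
  fixes h :: "'a \<Rightarrow> 'b::comm_monoid_mult"
  shows "(\<Prod>v\<in>V. h v) = (\<Prod>C\<in>orbit \<tau> ` V. \<Prod>v\<in>C. h v)"
proof -
  have "(\<Prod>v\<in>V. h v) = (\<Prod>C\<in>orbit \<tau> ` V. prod h {u\<in>V. orbit \<tau> u = C})"
    by (rule prod.image_gen[OF fin])
  also have "\<dots> = (\<Prod>C\<in>orbit \<tau> ` V. prod h C)"
  proof (rule prod.cong[OF refl])
    fix C assume "C \<in> orbit \<tau> ` V"
    then obtain v where "v \<in> V" "C = orbit \<tau> v" by blast
    then show "prod h {u\<in>V. orbit \<tau> u = C} = prod h C" using orbit_fibre[of v] by simp
  qed
  finally show ?thesis .
qed

text \<open>A fixed word is a free choice of one letter per cycle, so the sum factors into power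
  sums of the alphabet.\<close>

lemma (in finite_perm) sum_fixed_words:
  fixes x :: "'b \<Rightarrow> 'c::comm_semiring_1"
  assumes A: "finite A"
  shows "(\<Sum>w | w \<in> V \<rightarrow>\<^sub>E A \<and> (\<forall>v\<in>V. w (\<tau> v) = w v). \<Prod>v\<in>V. x (w v)) =
    (\<Prod>C\<in>orbit \<tau> ` V. \<Sum>a\<in>A. x a ^ card C)"
proof -
  define s where "s C = (SOME v. v \<in> C)" for C :: "'a set"
  have s: "s (orbit \<tau> v) \<in> orbit \<tau> v" for v unfolding s_def by (rule some_in_orbit)
  have sV: "s C \<in> V" "orbit \<tau> (s C) = C" if "C \<in> orbit \<tau> ` V" for C
    using that s orbit_subset_V orbit_eqI'[OF s] by auto
  have "(\<Prod>C\<in>orbit \<tau> ` V. \<Sum>a\<in>A. x a ^ card C) =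
      (\<Sum>G\<in>orbit \<tau> ` V \<rightarrow>\<^sub>E A. \<Prod>C\<in>orbit \<tau> ` V. x (G C) ^ card C)"
    using fin A by (intro prod_sum_PiE) auto
  also have "\<dots> = (\<Sum>w | w \<in> V \<rightarrow>\<^sub>E A \<and> (\<forall>v\<in>V. w (\<tau> v) = w v). \<Prod>v\<in>V. x (w v))"
  proof (rule sum.reindex_bij_witness[of _ "\<lambda>w. \<lambda>C\<in>orbit \<tau> ` V. w (s C)" "\<lambda>G. \<lambda>v\<in>V. G (orbit \<tau> v)"])
    fix G assume G: "G \<in> orbit \<tau> ` V \<rightarrow>\<^sub>E A"
    show "(\<lambda>C\<in>orbit \<tau> ` V. (\<lambda>v\<in>V. G (orbit \<tau> v)) (s C)) = G"
    proof
      fix C show "(\<lambda>C\<in>orbit \<tau> ` V. (\<lambda>v\<in>V. G (orbit \<tau> v)) (s C)) C = G C"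
        using sV[of C] PiE_arb[OF G, of C] by (cases "C \<in> orbit \<tau> ` V") simp_all
    qed
    show "(\<lambda>v\<in>V. G (orbit \<tau> v)) \<in> {w. w \<in> V \<rightarrow>\<^sub>E A \<and> (\<forall>v\<in>V. w (\<tau> v) = w v)}"
      using PiE_mem[OF G] by (simp add: orbit_step_eq permutes_in_image[OF perm])
    show "(\<Prod>v\<in>V. x ((\<lambda>v\<in>V. G (orbit \<tau> v)) v)) = (\<Prod>C\<in>orbit \<tau> ` V. x (G C) ^ card C)"
    proof -
      have "(\<Prod>v\<in>V. x ((\<lambda>v\<in>V. G (orbit \<tau> v)) v)) = (\<Prod>v\<in>V. x (G (orbit \<tau> v)))" by simp
      also have "\<dots> = (\<Prod>C\<in>orbit \<tau> ` V. \<Prod>v\<in>C. x (G (orbit \<tau> v)))" by (rule prod_over_orbits)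
      also have "\<dots> = (\<Prod>C\<in>orbit \<tau> ` V. x (G C) ^ card C)"
      proof (rule prod.cong[OF refl])
        fix C assume "C \<in> orbit \<tau> ` V"
        then have "orbit \<tau> v = C" if "v \<in> C" for v using that orbit_eqI' by auto
        then have "(\<Prod>v\<in>C. x (G (orbit \<tau> v))) = (\<Prod>v\<in>C. x (G C))" by simp
        then show "(\<Prod>v\<in>C. x (G (orbit \<tau> v))) = x (G C) ^ card C" by simp
      qed
      finally show ?thesis .
    qed
  next
    fix w assume w: "w \<in> {w. w \<in> V \<rightarrow>\<^sub>E A \<and> (\<forall>v\<in>V. w (\<tau> v) = w v)}"
    then have wE: "w \<in> V \<rightarrow>\<^sub>E A" by blast
    have pow: "w ((\<tau> ^^ a) v) = w v" if "v \<in> V" for a v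
      by (induction a) (use w that funpow_in_V in auto)
    show "(\<lambda>v\<in>V. (\<lambda>C\<in>orbit \<tau> ` V. w (s C)) (orbit \<tau> v)) = w"
    proof
      fix v
      obtain a where "s (orbit \<tau> v) = (\<tau> ^^ a) v" using s[of v] unfolding orbit_funpow by blast
      then show "(\<lambda>v\<in>V. (\<lambda>C\<in>orbit \<tau> ` V. w (s C)) (orbit \<tau> v)) v = w v"
        using pow[of v a] PiE_arb[OF wE, of v] by (cases "v \<in> V") simp_all
    qed
    show "(\<lambda>C\<in>orbit \<tau> ` V. w (s C)) \<in> orbit \<tau> ` V \<rightarrow>\<^sub>E A"
      using PiE_mem[OF wE] sV(1) by auto
  qed
  finally show ?thesis ..
qed

section \<open>The generating function as a polynomial identity in \<open>c\<close>\<close>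

definition polynomial_fun :: "(complex \<Rightarrow> complex) \<Rightarrow> bool" where
  "polynomial_fun F \<longleftrightarrow> (\<exists>p. \<forall>c. F c = poly p c)"

lemma polynomial_fun_const: "polynomial_fun (\<lambda>c. a)"
  unfolding polynomial_fun_def by (rule exI[of _ "[:a:]"]) simp

lemma polynomial_fun_ident: "polynomial_fun (\<lambda>c. c)"
  unfolding polynomial_fun_def by (rule exI[of _ "[:0,1:]"]) simp

lemma polynomial_fun_add: "polynomial_fun F \<Longrightarrow> polynomial_fun G \<Longrightarrow> polynomial_fun (\<lambda>c. F c + G c)"
  unfolding polynomial_fun_def by (metis poly_add)

lemma polynomial_fun_mult: "polynomial_fun F \<Longrightarrow> polynomial_fun G \<Longrightarrow> polynomial_fun (\<lambda>c. F c * G c)"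
  unfolding polynomial_fun_def by (metis poly_mult)

lemma polynomial_fun_diff: "polynomial_fun F \<Longrightarrow> polynomial_fun G \<Longrightarrow> polynomial_fun (\<lambda>c. F c - G c)"
  unfolding polynomial_fun_def by (metis poly_diff)

lemma polynomial_fun_divide: "polynomial_fun F \<Longrightarrow> polynomial_fun (\<lambda>c. F c / a)"
  unfolding divide_inverse by (intro polynomial_fun_mult polynomial_fun_const)

lemma polynomial_fun_power: "polynomial_fun F \<Longrightarrow> polynomial_fun (\<lambda>c. F c ^ d)"
  by (induction d) (auto intro: polynomial_fun_const polynomial_fun_mult)

lemma polynomial_fun_sum: "(\<And>a. a \<in> A \<Longrightarrow> polynomial_fun (F a)) \<Longrightarrow> polynomial_fun (\<lambda>c. \<Sum>a\<in>A. F a c)"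
  by (induction A rule: infinite_finite_induct) (auto intro: polynomial_fun_const polynomial_fun_add)

lemma polynomial_fun_prod: "(\<And>a. a \<in> A \<Longrightarrow> polynomial_fun (F a)) \<Longrightarrow> polynomial_fun (\<lambda>c. \<Prod>a\<in>A. F a c)"
  by (induction A rule: infinite_finite_induct) (auto intro: polynomial_fun_const polynomial_fun_mult)

lemma polynomial_fun_eqI:
  assumes "polynomial_fun F" "polynomial_fun G" "infinite {c. F c = G c}"
  shows "F c = G c"
proof -
  obtain p r where p: "\<And>c. F c = poly p c" "\<And>c. G c = poly r c"
    using assms(1,2) unfolding polynomial_fun_def by blast
  have "infinite {c. poly (p - r) c = 0}" using assms(3) unfolding p by simp
  then have "p - r = 0" using poly_roots_finite by blast
  then show ?thesis by (simp add: p)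
qed

definition q_bracket :: "complex \<Rightarrow> int \<Rightarrow> complex" where
  "q_bracket q r = (q powi r - 1) / (q - 1)"

text \<open>For \<open>c = 1 / q_bracket q k\<close> this is \<open>(\<Sum>a<k. q ^ (d * a)) / q_bracket q k ^ d\<close>, a normalized
  power sum of the alphabet \<open>1, q, \<dots>, q ^ (k - 1)\<close>.\<close>

definition power_sum :: "complex \<Rightarrow> complex \<Rightarrow> nat \<Rightarrow> complex" where
  "power_sum q c d = ((c + q - 1) ^ d - c ^ d) / (q ^ d - 1)"

definition cycle_weight :: "complex \<Rightarrow> complex \<Rightarrow> 'a set \<Rightarrow> ('a \<Rightarrow> 'a) \<Rightarrow> complex" where
  "cycle_weight q c V g = (\<Prod>C\<in>orbit g ` V. power_sum q c (card C))"

text \<open>At \<open>c = 1 / q_bracket q k\<close> this is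
  \<open>q_bracket q (r + k) / q_bracket q k\<close>, a normalized factor of the Gaussian binomial;
  it is the continuation of that value to an affine function of \<open>c\<close>.\<close>

definition linear_factor :: "complex \<Rightarrow> complex \<Rightarrow> int \<Rightarrow> complex" where
  "linear_factor q c r = q powi r + c * q_bracket q r"

theorem descent_major_identity:
  fixes \<tau> :: "nat \<Rightarrow> nat"
  assumes \<tau>: "\<tau> permutes {1..n}" and f: "finite_perm.eigenfunction \<tau> f"
    and q: "q \<noteq> 0" "\<And>j. j \<ge> 1 \<Longrightarrow> q ^ j \<noteq> 1"
  shows "(\<Sum>\<sigma> | \<sigma> permutes {1..n}. q ^ maj n (\<sigma> \<circ> \<tau> \<circ> inv \<sigma>) *
      (\<Prod>j\<in>{1..n}. linear_factor q c (int j - int (desc n (\<sigma> \<circ> \<tau> \<circ> inv \<sigma>))) / q_bracket q (int j))) =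
    (\<Sum>g\<in>centralizer {1..n} \<tau>. finite_perm.chi {1..n} \<tau> f g * cycle_weight q c {1..n} g)"
    (is "?L c = ?R c")
proof (rule polynomial_fun_eqI[of ?L ?R])
  show "polynomial_fun ?L" unfolding linear_factor_def
    by (intro polynomial_fun_sum polynomial_fun_mult polynomial_fun_const polynomial_fun_prod
        polynomial_fun_divide polynomial_fun_add polynomial_fun_ident)
  have "polynomial_fun (\<lambda>c. power_sum q c d)" for d
    unfolding power_sum_def
  proof (rule polynomial_fun_divide, rule polynomial_fun_diff)
    have "polynomial_fun (\<lambda>c. c + q - 1)"
      using polynomial_fun_diff[OF polynomial_fun_add[OF polynomial_fun_ident polynomial_fun_const]
          polynomial_fun_const] .
    then show "polynomial_fun (\<lambda>c. (c + q - 1) ^ d)" by (rule polynomial_fun_power)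
    show "polynomial_fun (\<lambda>c. c ^ d)" by (rule polynomial_fun_power[OF polynomial_fun_ident])
  qed
  then have "polynomial_fun (\<lambda>c. cycle_weight q c {1..n} g)" for g
    unfolding cycle_weight_def by (rule polynomial_fun_prod)
  then show "polynomial_fun ?R"
    by (rule polynomial_fun_sum[OF polynomial_fun_mult[OF polynomial_fun_const]])
  define c where "c k = (q - 1) / (q ^ k - 1)" for k
  have q1: "q - 1 \<noteq> 0" using q(2)[of 1] by simp
  have qk: "q ^ k - 1 \<noteq> 0" if "k \<ge> 1" for k using q(2)[OF that] by simp
  have "?L (c k) = ?R (c k)" if k: "k \<ge> 1" for k
  proof -
    have "?L (c k) = c k ^ n * (\<Sum>\<sigma> | \<sigma> permutes {1..n}.
        \<Sum>i\<in>descent_sequences n (descents n (\<sigma> \<circ> \<tau> \<circ> inv \<sigma>)) k. \<Prod>j\<in>{1..n}. q ^ i j)"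
    proof (subst sum_distrib_left, intro sum.cong refl)
      fix \<sigma> :: "nat \<Rightarrow> nat"
      define \<pi> where "\<pi> = \<sigma> \<circ> \<tau> \<circ> inv \<sigma>"
      have D: "descents n \<pi> \<subseteq> {1..<n}" by (auto simp: descents_def)
      have "linear_factor q (c k) (int j - int (desc n \<pi>)) / q_bracket q (int j) =
          c k * ((q powi (int k - 1 - int (card (descents n \<pi>)) + int j) - 1) / (q ^ j - 1))"
        if "j \<in> {1..n}" for j
      proof -
        define a where "a = q powi (int j - int (desc n \<pi>))"
        have e: "int k - 1 - int (card (descents n \<pi>)) + int j = (int j - int (desc n \<pi>)) + int k"
          by (simp add: desc_def)
        have "q powi (int k - 1 - int (card (descents n \<pi>)) + int j) = a * q ^ k"
          unfolding e a_def using q(1) by (simp add: power_int_add power_int_of_nat)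
        then show ?thesis unfolding linear_factor_def q_bracket_def a_def[symmetric] c_def power_int_of_nat
          using q1 qk[OF k] qk[of j] that by (simp add: divide_simps) (simp add: algebra_simps)
      qed
      then have "(\<Prod>j\<in>{1..n}. linear_factor q (c k) (int j - int (desc n \<pi>)) / q_bracket q (int j)) =
          (\<Prod>j\<in>{1..n}. c k * ((q powi (int k - 1 - int (card (descents n \<pi>)) + int j) - 1) / (q ^ j - 1)))"
        by (rule prod.cong[OF refl])
      also have "\<dots> = c k ^ n * q_prod q n (int k - 1 - int (card (descents n \<pi>)))"
        unfolding q_prod_def prod.distrib by simp
      finally have *: "(\<Prod>j\<in>{1..n}. linear_factor q (c k) (int j - int (desc n \<pi>)) / q_bracket q (int j)) =
          c k ^ n * q_prod q n (int k - 1 - int (card (descents n \<pi>)))" .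
      show "q ^ maj n (\<sigma> \<circ> \<tau> \<circ> inv \<sigma>) * (\<Prod>j\<in>{1..n}. linear_factor q (c k)
          (int j - int (desc n (\<sigma> \<circ> \<tau> \<circ> inv \<sigma>))) / q_bracket q (int j)) =
          c k ^ n * (\<Sum>i\<in>descent_sequences n (descents n (\<sigma> \<circ> \<tau> \<circ> inv \<sigma>)) k. \<Prod>j\<in>{1..n}. q ^ i j)"
        unfolding \<pi>_def[symmetric] maj_def * using sum_descent_sequences[OF q D, of k] by (simp only: mult.left_commute)
    qed
    also have "\<dots> = c k ^ n * (\<Sum>g\<in>centralizer {1..n} \<tau>. finite_perm.chi {1..n} \<tau> f g *
       (\<Sum>w | w \<in> {1..n} \<rightarrow>\<^sub>E {..<k} \<and> (\<forall>v\<in>{1..n}. w (g v) = w v). \<Prod>v\<in>{1..n}. q ^ w v))"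
      using sum_descent_sequences_eq_sum_centralizer[OF \<tau> f, where x = "\<lambda>a. q ^ a" and k = k] by simp
    also have "\<dots> = ?R (c k)"
    proof (subst sum_distrib_left, intro sum.cong refl)
      fix g assume "g \<in> centralizer {1..n} \<tau>"
      then interpret g: finite_perm "{1..n}" g by unfold_locales (auto simp: centralizer_def)
      have "c k ^ n * (\<Sum>w | w \<in> {1..n} \<rightarrow>\<^sub>E {..<k} \<and> (\<forall>v\<in>{1..n}. w (g v) = w v). \<Prod>v\<in>{1..n}. q ^ w v) =
          (\<Prod>v\<in>{1..n}. c k) * (\<Prod>C\<in>orbit g ` {1..n}. \<Sum>a<k. (q ^ a) ^ card C)"
        unfolding g.sum_fixed_words[OF finite_lessThan] by simp
      also have "(\<Prod>v\<in>{1..n}. c k) = (\<Prod>C\<in>orbit g ` {1..n}. c k ^ card C)"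
        by (subst g.prod_over_orbits) simp
      also have "\<dots> * (\<Prod>C\<in>orbit g ` {1..n}. \<Sum>a<k. (q ^ a) ^ card C) = cycle_weight q (c k) {1..n} g"
        unfolding cycle_weight_def prod.distrib[symmetric]
      proof (rule prod.cong[OF refl])
        fix C assume "C \<in> orbit g ` {1..n}"
        define d where "d = card C"
        have d: "d \<ge> 1" using \<open>C \<in> _\<close> g.card_orbit_pos by (auto simp: d_def Suc_le_eq)
        have "(\<Sum>a<k. (q ^ a) ^ d) = (\<Sum>a<k. (q ^ d) ^ a)" by (simp add: mult.commute flip: power_mult)
        also have "\<dots> = ((q ^ d) ^ k - 1) / (q ^ d - 1)" using qk[OF d] by (intro geometric_sum) simp
        also have "c k ^ d * \<dots> = ((c k * q ^ k) ^ d - c k ^ d) / (q ^ d - 1)"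
          by (simp add: power_mult_distrib algebra_simps flip: power_mult)
        \<comment> \<open>Here \<open>q ^ k\<close> is eliminated in favour of \<open>c\<close>.
          This is what makes the normalized power sums polynomials in \<open>c\<close> that no
          longer mention \<open>k\<close>.\<close>
        also have "c k * q ^ k = c k + q - 1" using qk[OF k] by (simp add: c_def field_simps)
        finally show "c k ^ card C * (\<Sum>a<k. (q ^ a) ^ card C) = power_sum q (c k) (card C)"
          by (simp add: power_sum_def d_def)
      qed
      finally show "c k ^ n * (finite_perm.chi {1..n} \<tau> f g *
        (\<Sum>w | w \<in> {1..n} \<rightarrow>\<^sub>E {..<k} \<and> (\<forall>v\<in>{1..n}. w (g v) = w v). \<Prod>v\<in>{1..n}. q ^ w v)) =
        finite_perm.chi {1..n} \<tau> f g * cycle_weight q (c k) {1..n} g"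
        by (simp add: mult.left_commute)
    qed
    finally show ?thesis .
  qed
  then have sub: "c ` {1..} \<subseteq> {c. ?L c = ?R c}" by auto
  \<comment> \<open>The sample points are distinct because \<open>q\<close> is not a root of
    unity.\<close>
  have "inj_on c {1..}"
  proof (rule inj_onI)
    have *: "k = l" if "k \<ge> 1" "k \<le> l" "q ^ k = q ^ l" for k l
    proof (rule ccontr)
      assume "k \<noteq> l"
      have "q ^ k * q ^ (l - k) = q ^ k" unfolding power_add[symmetric] using that by simp
      then have "q ^ (l - k) = 1" using q(1) by simp
      then show False using q(2)[of "l - k"] \<open>k \<noteq> l\<close> that by simp
    qed
    fix k l :: nat assume kl: "k \<in> {1..}" "l \<in> {1..}" "c k = c l"
    then have "q ^ k = q ^ l" using q1 qk[of k] qk[of l] by (simp add: c_def field_simps)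
    then show "k = l" using *[of k l] *[of l k] kl linear[of k l] by fastforce
  qed
  then have "infinite (c ` {1..})" by (simp add: finite_image_iff infinite_Ici)
  then show "infinite {c. ?L c = ?R c}" using sub finite_subset by blast
qed

section \<open>Stabilizers of random words\<close>

text \<open>Record the image of \<open>v\<close>. Stabilizing elements with the same image differ by
  one that fixes the orbit of \<open>v\<close> pointwise and so lives on the complement. The image
  must show the same two consecutive letters as \<open>v\<close>; no more are compared, since a
  cycle of length two offers no more.\<close>

lemma (in finite_perm) card_word_stab_le:
  assumes U: "U \<subseteq> V" "\<And>x. x \<in> U \<Longrightarrow> \<tau> x \<in> U" and v: "v \<in> U"
  shows "card (word_stab U \<tau> w) \<le>
    card (word_stab (U - orbit \<tau> v) \<tau> w) * card {u\<in>U. w u = w v \<and> w (\<tau> u) = w (\<tau> v)}"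
proof -
  let ?U0 = "U - orbit \<tau> v" and ?T = "{u\<in>U. w u = w v \<and> w (\<tau> u) = w (\<tau> v)}"
  have finU: "finite U" using U(1) fin by (rule finite_subset)
  have fin0: "finite (word_stab ?U0 \<tau> w)" by (rule finite_word_stab) (use finU in simp)
  have orbU: "orbit \<tau> v \<subseteq> U"
  proof
    fix x assume "x \<in> orbit \<tau> v"
    then show "x \<in> U" by induction (use v U(2) in auto)
  qed
  have in_T: "g v \<in> ?T" if "g \<in> word_stab U \<tau> w" for g
  proof -
    from that have g: "g permutes U" "\<And>x. \<tau> (g x) = g (\<tau> x)" "\<And>x. x \<in> U \<Longrightarrow> w (g x) = w x"
      by (auto simp: word_stab_def centralizer_def fun_eq_iff)
    show ?thesis using g(3)[OF v] g(3)[OF U(2)[OF v]] permutes_in_image[OF g(1)] v by (simp add: g(2))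
  qed
  have fibre: "card {g\<in>word_stab U \<tau> w. g v = u} \<le> card (word_stab ?U0 \<tau> w)" for u
  proof (cases "{g\<in>word_stab U \<tau> w. g v = u} = {}")
    case False
    then obtain g0 where g0: "g0 \<in> word_stab U \<tau> w" "g0 v = u" by blast
    have p0: "g0 permutes U" using g0(1) by (simp add: word_stab_def centralizer_def)
    have "inv g0 \<circ> g \<in> word_stab ?U0 \<tau> w" if g: "g \<in> word_stab U \<tau> w" "g v = u" for g
    proof -
      define h where "h = inv g0 \<circ> g"
      have h: "h \<in> word_stab U \<tau> w" unfolding h_def by (intro word_stab_comp word_stab_inv g0 g)
      then have hc: "h \<in> centralizer U \<tau>" by (simp add: word_stab_def)
      then have hp: "h permutes U" by (simp add: centralizer_def)
      have "h v = v" using g(2) g0(2) permutes_inverses(2)[OF p0, of v] by (simp add: h_def)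
      then have fx: "h x = x" if "x \<in> orbit \<tau> v" for x
        using that centralizer_funpow[OF hc] by (auto simp: orbit_altdef)
      have "h permutes ?U0"
        by (rule permutes_superset[OF hp]) (use fx in auto)
      then show ?thesis using h unfolding h_def[symmetric] by (simp add: word_stab_def centralizer_def)
    qed
    then have "(\<lambda>g. inv g0 \<circ> g) ` {g\<in>word_stab U \<tau> w. g v = u} \<subseteq> word_stab ?U0 \<tau> w" by blast
    moreover have "inj_on (\<lambda>g. inv g0 \<circ> g) {g\<in>word_stab U \<tau> w. g v = u}"
    proof (rule inj_onI)
      fix g g' assume "inv g0 \<circ> g = inv g0 \<circ> g'"
      then have "g0 \<circ> (inv g0 \<circ> g) = g0 \<circ> (inv g0 \<circ> g')" by simp
      then show "g = g'" by (simp add: fun_eq_iff permutes_inverses[OF p0])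
    qed
    ultimately show ?thesis using fin0 card_inj_on_le by blast
  qed (simp only: card.empty)
  have "(\<lambda>g. g v) ` word_stab U \<tau> w \<subseteq> ?T" using in_T by blast
  then have "card (word_stab U \<tau> w) = (\<Sum>u\<in>?T. card {g\<in>word_stab U \<tau> w. g v = u})"
    using sum.group[OF finite_word_stab[OF finU], of ?T "\<lambda>g. g v" \<tau> w "\<lambda>_. 1::nat"] finU by simp
  also have "\<dots> \<le> (\<Sum>u\<in>?T. card (word_stab ?U0 \<tau> w))" by (intro sum_mono fibre)
  finally show ?thesis by (simp add: mult.commute)
qed

lemma card_words_determined:
  assumes A: "finite A" and U: "finite U" "C \<subseteq> U" and E: "E \<subseteq> C"
    and det: "\<And>w w'. w \<in> W \<Longrightarrow> w' \<in> W \<Longrightarrow> (\<And>x. x \<in> C - E \<Longrightarrow> w x = w' x) \<Longrightarrow> (\<And>x. x \<in> E \<Longrightarrow> w x = w' x)"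
    and W: "W \<subseteq> U \<rightarrow>\<^sub>E A" and r: "\<And>w. w \<in> W \<Longrightarrow> restrict w (U - C) = w0"
  shows "card W \<le> card A ^ (card C - card E)"
proof -
  have finC: "finite C" using U finite_subset by blast
  have "inj_on (\<lambda>w. restrict w (C - E)) W"
  proof (rule inj_onI)
    fix w w' assume w: "w \<in> W" "w' \<in> W" and eq: "restrict w (C - E) = restrict w' (C - E)"
    have 1: "w x = w' x" if "x \<in> C - E" for x using fun_cong[OF eq, of x] that by simp
    have 2: "w x = w' x" if "x \<in> U - C" for x
      using fun_cong[OF trans[OF r[OF w(1)] r[OF w(2), symmetric]], of x] that by simp
    show "w = w'"
    proof
      fix x
      have wE: "w \<in> U \<rightarrow>\<^sub>E A" "w' \<in> U \<rightarrow>\<^sub>E A" using w W by auto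
      consider "x \<in> C - E" | "x \<in> E" | "x \<in> U - C" | "x \<notin> U" using U(2) by blast
      then show "w x = w' x"
        by cases (use 1 2 det[OF w 1] PiE_arb[OF wE(1)] PiE_arb[OF wE(2)] in auto)
    qed
  qed
  moreover have "(\<lambda>w. restrict w (C - E)) ` W \<subseteq> (C - E) \<rightarrow>\<^sub>E A"
  proof
    fix z assume "z \<in> (\<lambda>w. restrict w (C - E)) ` W"
    then obtain w where w: "w \<in> W" "z = restrict w (C - E)" by blast
    then have "w \<in> U \<rightarrow>\<^sub>E A" using W by blast
    then show "z \<in> (C - E) \<rightarrow>\<^sub>E A" unfolding w(2) using U(2) by (auto simp: PiE_mem)
  qed
  moreover have "finite ((C - E) \<rightarrow>\<^sub>E A)" using finC A by (intro finite_PiE) auto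
  ultimately have "card W \<le> card ((C - E) \<rightarrow>\<^sub>E A)" by (rule card_inj_on_le)
  also have "\<dots> = card A ^ card (C - E)" using finC by (simp add: card_PiE)
  also have "card (C - E) = card C - card E" using E finC by (meson card_Diff_subset finite_subset)
  finally show ?thesis .
qed

text \<open>Cycles are removed one at a time. Among the candidates \<open>u\<close> for the image of
  \<open>v\<close>, the point \<open>v\<close> itself imposes no condition, another point of its
  cycle \<open>C\<close> determines one letter, and a point outside \<open>C\<close> determines both
  \<open>w v\<close> and \<open>w (\<tau> v)\<close>; these are two positions because there are no
  fixed points. The resulting factor 1 + (card C - 1) / k + card U0 / k^2 is at most the exponential
  charged to \<open>C\<close>.\<close>

lemma (in finite_perm) sum_card_word_stab_le:
  fixes k :: nat
  assumes k: "k \<ge> 1" and "U \<subseteq> V" "\<And>x. x \<in> U \<Longrightarrow> \<tau> x \<in> U" "\<And>x. x \<in> U \<Longrightarrow> \<tau> x \<noteq> x"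
  shows "(\<Sum>w\<in>U \<rightarrow>\<^sub>E {..<k}. real (card (word_stab U \<tau> w))) \<le>
    real k ^ card U * exp (card U * (1 / k + card V / (real k)\<^sup>2))"
  using assms(2-)
proof (induction "card U" arbitrary: U rule: less_induct)
  case less
  have finU: "finite U" using less.prems(1) fin by (rule finite_subset)
  show ?case
  proof (cases "U = {}")
    case True
    have "word_stab {} \<tau> w = {id}" for w :: "'a \<Rightarrow> nat"
      by (auto simp: word_stab_def centralizer_def)
    then show ?thesis using True by simp
  next
    case False
    then obtain v where v: "v \<in> U" by blast
    define C where "C = orbit \<tau> v"
    define U0 where "U0 = U - C"
    define W where "W = U \<rightarrow>\<^sub>E {..<k}"
    define W0 where "W0 = U0 \<rightarrow>\<^sub>E {..<k}"
    define e where "e u = (if u = v then 0 else if u \<in> C then 1 else 2 :: nat)" for u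
    define st where "st w = real (card (word_stab U0 \<tau> w))" for w :: "'a \<Rightarrow> nat"
    have CU: "C \<subseteq> U"
    proof
      fix x assume "x \<in> C"
      then show "x \<in> U" unfolding C_def by induction (use v less.prems(2) in auto)
    qed
    have vC: "v \<in> C" unfolding C_def by (rule self_in_orbit)
    have tv: "\<tau> v \<in> C" "\<tau> v \<noteq> v" unfolding C_def using orbit.base less.prems(3)[OF v] by auto
    have tC: "\<tau> x \<in> C \<longleftrightarrow> x \<in> C" for x
      unfolding C_def orbit_eq_iff[symmetric] orbit_step_eq ..
    have finC: "finite C" using CU finU by (rule finite_subset)
    have C2: "card C \<ge> 2"
    proof -
      have "card {v, \<tau> v} \<le> card C" using vC tv(1) by (intro card_mono finC) auto
      then show ?thesis using tv(2) by simp
    qed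
    have finW: "finite W" and finW0: "finite W0" using finU by (auto simp: W_def W0_def U0_def intro!: finite_PiE)
    have rW: "restrict w U0 \<in> W0" if "w \<in> W" for w
      using that by (auto simp: W_def W0_def U0_def PiE_iff)
    have st_restrict: "st (restrict w U0) = st w" for w
    proof -
      have "word_stab U0 \<tau> (restrict w U0) = word_stab U0 \<tau> w"
        unfolding word_stab_def centralizer_def using permutes_in_image by fastforce
      then show ?thesis by (simp add: st_def)
    qed
    have count: "real (card {w\<in>W. restrict w U0 = w0 \<and> w u = w v \<and> w (\<tau> u) = w (\<tau> v)}) \<le> real k ^ (card C - e u)"
      if u: "u \<in> U" and w0: "w0 \<in> W0" for u w0
    proof -
      define X where "X = {w\<in>W. restrict w U0 = w0 \<and> w u = w v \<and> w (\<tau> u) = w (\<tau> v)}"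
      have X: "X \<subseteq> U \<rightarrow>\<^sub>E {..<k}" "\<And>w. w \<in> X \<Longrightarrow> restrict w (U - C) = w0"
        by (auto simp: X_def W_def U0_def)
      have w0': "w x = w0 x" if "w \<in> X" "x \<in> U0" for w x
        using fun_cong[OF X(2)[OF that(1)], of x] that(2) by (simp add: U0_def)
      define E where "E = (if u = v then {} else if u \<in> C then {v} else {v, \<tau> v})"
      have E: "E \<subseteq> C" using vC tv by (auto simp: E_def)
      have "card X \<le> card {..<k} ^ (card C - card E)"
      proof (rule card_words_determined[OF _ finU CU E _ X])
        fix w w' x assume w: "w \<in> X" "w' \<in> X" and eq: "\<And>x. x \<in> C - E \<Longrightarrow> w x = w' x" and x: "x \<in> E"
        have uv: "u \<noteq> v" using x by (auto simp: E_def split: if_splits)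
        show "w x = w' x"
        proof (cases "u \<in> C")
          case True
          then have "x = v" "u \<in> C - E" using x uv by (auto simp: E_def)
          then show ?thesis using eq[of u] w by (simp add: X_def)
        next
          case False
          then have "u \<in> U0" "\<tau> u \<in> U0" using u less.prems(2)[OF u] tC by (auto simp: U0_def)
          moreover have "x = v \<or> x = \<tau> v" using x uv False by (auto simp: E_def)
          ultimately show ?thesis using w w0'[OF w(1)] w0'[OF w(2)] by (auto simp: X_def)
        qed
      qed simp
      moreover have "card E = e u" using tv by (auto simp: E_def e_def)
      ultimately show ?thesis unfolding X_def[symmetric] by (simp flip: of_nat_power)
    qed
    have "(\<Sum>w\<in>W. real (card (word_stab U \<tau> w))) \<le>
        (\<Sum>w\<in>W. \<Sum>u\<in>U. if w u = w v \<and> w (\<tau> u) = w (\<tau> v) then st (restrict w U0) else 0)"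
    proof (rule sum_mono)
      fix w :: "'a \<Rightarrow> nat"
      have "real (card (word_stab U \<tau> w)) \<le> real (card (word_stab U0 \<tau> w) * card {u\<in>U. w u = w v \<and> w (\<tau> u) = w (\<tau> v)})"
        unfolding of_nat_le_iff U0_def C_def
        by (rule card_word_stab_le[OF less.prems(1,2) v])
      then show "real (card (word_stab U \<tau> w)) \<le>
          (\<Sum>u\<in>U. if w u = w v \<and> w (\<tau> u) = w (\<tau> v) then st (restrict w U0) else 0)"
        using finU unfolding st_restrict by (simp add: sum.If_cases st_def Int_def mult.commute)
    qed
    also have "\<dots> = (\<Sum>u\<in>U. \<Sum>w | w \<in> W \<and> w u = w v \<and> w (\<tau> u) = w (\<tau> v). st (restrict w U0))"
      by (subst sum.swap) (use finW in \<open>simp add: sum.If_cases Int_def\<close>)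
    also have "\<dots> \<le> (\<Sum>u\<in>U. real k ^ (card C - e u) * (\<Sum>w0\<in>W0. st w0))"
    proof (rule sum_mono)
      fix u assume u: "u \<in> U"
      let ?S = "{w. w \<in> W \<and> w u = w v \<and> w (\<tau> u) = w (\<tau> v)}"
      have "(\<Sum>w\<in>?S. st (restrict w U0)) = (\<Sum>w0\<in>W0. \<Sum>w\<in>{w\<in>?S. restrict w U0 = w0}. st (restrict w U0))"
        by (rule sum.group[symmetric, OF _ finW0]) (use finW rW in auto)
      also have "\<dots> = (\<Sum>w0\<in>W0. real (card {w\<in>W. restrict w U0 = w0 \<and> w u = w v \<and> w (\<tau> u) = w (\<tau> v)}) * st w0)"
      proof (rule sum.cong[OF refl])
        fix w0
        have "{w\<in>?S. restrict w U0 = w0} = {w\<in>W. restrict w U0 = w0 \<and> w u = w v \<and> w (\<tau> u) = w (\<tau> v)}" by blast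
        then show "(\<Sum>w\<in>{w\<in>?S. restrict w U0 = w0}. st (restrict w U0)) =
          real (card {w\<in>W. restrict w U0 = w0 \<and> w u = w v \<and> w (\<tau> u) = w (\<tau> v)}) * st w0" by simp
      qed
      also have "\<dots> \<le> (\<Sum>w0\<in>W0. real k ^ (card C - e u) * st w0)"
        by (intro sum_mono mult_right_mono count[OF u]) (simp_all add: st_def)
      finally show "(\<Sum>w\<in>?S. st (restrict w U0)) \<le> real k ^ (card C - e u) * (\<Sum>w0\<in>W0. st w0)"
        by (simp add: sum_distrib_left)
    qed
    also have "\<dots> = (\<Sum>u\<in>U. real k ^ (card C - e u)) * (\<Sum>w0\<in>W0. st w0)" by (simp add: sum_distrib_right)
    finally have 1: "(\<Sum>w\<in>W. real (card (word_stab U \<tau> w))) \<le> (\<Sum>u\<in>U. real k ^ (card C - e u)) * (\<Sum>w0\<in>W0. st w0)" .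
    have 2: "(\<Sum>u\<in>U. real k ^ (card C - e u)) \<le> real k ^ card C * exp (card C * (1 / k + card V / (real k)\<^sup>2))"
    proof -
      have U: "U = insert v ((C - {v}) \<union> U0)" using CU vC by (auto simp: U0_def)
      have "(\<Sum>u\<in>U. real k ^ (card C - e u)) = real k ^ (card C - e v) + ((\<Sum>u\<in>C - {v}. real k ^ (card C - e u)) + (\<Sum>u\<in>U0. real k ^ (card C - e u)))"
        by (subst U, subst sum.insert) (use finC finU vC in \<open>auto simp: U0_def intro!: sum.union_disjoint\<close>)
      also have "(\<Sum>u\<in>C - {v}. real k ^ (card C - e u)) = (card C - 1) * real k ^ (card C - 1)"
        using finC vC by (simp add: e_def)
      also have "(\<Sum>u\<in>U0. real k ^ (card C - e u)) = (\<Sum>u\<in>U0. real k ^ (card C - 2))"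
        by (rule sum.cong) (use vC in \<open>auto simp: e_def U0_def\<close>)
      also have "\<dots> = card U0 * real k ^ (card C - 2)" by simp
      also have "real k ^ (card C - e v) + ((card C - 1) * real k ^ (card C - 1) + card U0 * real k ^ (card C - 2)) =
          real k ^ card C * (1 + ((card C - 1) / k + card U0 / (real k)\<^sup>2))"
      proof -
        have "real k ^ card C = real k ^ (card C - 1) * k" using C2
          by (metis One_nat_def Suc_1 Suc_le_eq power_minus_mult less_imp_le_nat Suc_lessD)
        moreover have "real k ^ card C = real k ^ (card C - 2) * (real k)\<^sup>2"
          by (metis C2 le_add_diff_inverse2 power_add)
        ultimately show ?thesis using k by (simp add: e_def field_simps)
      qed
      also have "\<dots> \<le> real k ^ card C * exp (card C * (1 / k + card V / (real k)\<^sup>2))"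
      proof (rule mult_left_mono)
        have "card U0 \<le> card V" unfolding U0_def using less.prems(1) fin by (intro card_mono) auto
        then have "real (card U0) \<le> card C * real (card V)"
          using C2 by (metis le_trans mult_le_mono1 nat_mult_1 of_nat_le_iff of_nat_mult one_le_numeral)
        then have "real (card U0) / (real k)\<^sup>2 \<le> card C * real (card V) / (real k)\<^sup>2" using k by (intro divide_right_mono) auto
        moreover have "real (card C - 1) / k \<le> card C / k" using k by (intro divide_right_mono) auto
        ultimately have "1 + ((card C - 1) / k + card U0 / (real k)\<^sup>2) \<le> 1 + card C * (1 / k + card V / (real k)\<^sup>2)"
          by (simp add: algebra_simps)
        then show "1 + ((card C - 1) / k + card U0 / (real k)\<^sup>2) \<le> exp (card C * (1 / k + card V / (real k)\<^sup>2))"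
          using exp_ge_add_one_self order_trans by blast
      qed simp
      finally show ?thesis .
    qed
    have 3: "(\<Sum>w0\<in>W0. st w0) \<le> real k ^ card U0 * exp (card U0 * (1 / k + card V / (real k)\<^sup>2))"
      unfolding W0_def st_def
    proof (rule less.hyps)
      show "card U0 < card U" unfolding U0_def using v vC finU by (intro psubset_card_mono) auto
      show "U0 \<subseteq> V" using less.prems(1) by (auto simp: U0_def)
      show "\<tau> x \<in> U0" "\<tau> x \<noteq> x" if "x \<in> U0" for x
        using that less.prems(2,3) tC by (auto simp: U0_def)
    qed
    have "(\<Sum>w\<in>W. real (card (word_stab U \<tau> w))) \<le>
        (real k ^ card C * exp (card C * (1 / k + card V / (real k)\<^sup>2))) * (real k ^ card U0 * exp (card U0 * (1 / k + card V / (real k)\<^sup>2)))"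
      by (rule order_trans[OF 1 mult_mono[OF 2 3]]) (auto intro!: sum_nonneg simp: st_def)
    also have "\<dots> = real k ^ (card C + card U0) * exp ((card C + card U0) * (1 / k + card V / (real k)\<^sup>2))"
      by (simp add: power_add exp_add[symmetric] distrib_right)
    also have "card C + card U0 = card U"
      unfolding U0_def using CU finC finU card_mono[OF finU CU] by (simp add: card_Diff_subset)
    finally show ?thesis unfolding W_def .
  qed
qed

section \<open>Cycle weights: the exact sum on fixed points, a bound on longer cycles\<close>

lemma cycle_weight_transport:
  assumes b: "bij_betw b S S'" and S: "finite S" and g: "g permutes S"
  shows "cycle_weight q c S' (\<lambda>x. if x \<in> S' then b (g (inv_into S b x)) else x) = cycle_weight q c S g"
    (is "cycle_weight q c S' ?g' = _")
proof -
  interpret g: finite_perm S g by unfold_locales (rule S, rule g)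
  have inj: "inj_on b S" and img: "b ` S = S'" using b by (auto simp: bij_betw_def)
  have orb: "orbit ?g' (b x) = b ` orbit g x" if "x \<in> S" for x
  proof (rule orbit_inverse[OF g.self_in_orbit, symmetric])
    fix y assume "y \<in> orbit g x"
    then have "y \<in> S" using g.orbit_subset_V[OF that] by blast
    then show "?g' (b y) = b (g y)" using inj img by auto
  qed
  have "orbit ?g' ` S' = orbit ?g' ` (b ` S)" by (simp only: img)
  then have "orbit ?g' ` S' = (\<lambda>C. b ` C) ` orbit g ` S"
    unfolding image_image using image_cong[OF refl orb] by (rule trans)
  moreover have "inj_on (\<lambda>C. b ` C) (orbit g ` S)"
  proof (rule inj_onI)
    fix C D assume "C \<in> orbit g ` S" "D \<in> orbit g ` S" and eq: "b ` C = b ` D"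
    then have "C \<subseteq> S" "D \<subseteq> S" using g.orbit_subset_V by blast+
    then show "C = D" using eq inj by (simp add: inj_on_image_eq_iff)
  qed
  ultimately have "cycle_weight q c S' ?g' = (\<Prod>C\<in>orbit g ` S. power_sum q c (card (b ` C)))"
    unfolding cycle_weight_def by (simp add: prod.reindex)
  also have "\<dots> = cycle_weight q c S g"
    unfolding cycle_weight_def
  proof (rule prod.cong[OF refl])
    fix C assume "C \<in> orbit g ` S"
    then have "inj_on b C" using g.orbit_subset_V inj by (blast intro: inj_on_subset)
    then show "power_sum q c (card (b ` C)) = power_sum q c (card C)" by (simp add: card_image)
  qed
  finally show ?thesis .
qed

lemma orbit_id: "orbit id v = {v}"
  by (simp add: orbit_eq_singleton_iff)

text \<open>This is \<open>descent_major_identity\<close> for the identity permutation: its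
  centralizer is the whole symmetric group, \<open>chi\<close> is 1, and every conjugate is the
  identity, with \<open>desc\<close> 1 and \<open>maj\<close> 0.\<close>

lemma sum_cycle_weight_permutes:
  assumes S: "finite S" and q: "q \<noteq> 0" "\<And>j. j \<ge> 1 \<Longrightarrow> q ^ j \<noteq> 1"
  shows "(\<Sum>g | g permutes S. cycle_weight q c S g) =
    fact (card S) * (\<Prod>j\<in>{1..card S}. linear_factor q c (int j - 1) / q_bracket q (int j))"
proof -
  define m where "m = card S"
  interpret id: finite_perm "{1..m}" "id :: nat \<Rightarrow> nat" by unfold_locales (auto simp: permutes_id)
  have "card S = card {1..m}" by (simp add: m_def)
  then obtain b where b: "bij_betw b S {1..m}"
    using finite_same_card_bij[OF S, of "{1..m}"] by auto
  have "(\<Sum>g | g permutes S. cycle_weight q c S g) =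
      (\<Sum>g | g permutes S. cycle_weight q c {1..m} (\<lambda>x. if x \<in> {1..m} then b (g (inv_into S b x)) else x))"
    using cycle_weight_transport[OF b S] by (intro sum.cong refl) (simp only: mem_Collect_eq)
  also have "\<dots> = (\<Sum>g | g permutes {1..m}. cycle_weight q c {1..m} g)"
    by (rule sum.reindex_bij_betw[OF bij_betw_permutations[OF b]])
  also have "\<dots> = (\<Sum>g\<in>centralizer {1..m} id. id.chi (\<lambda>_. 1) g * cycle_weight q c {1..m} g)"
  proof (rule sum.cong)
    show "{g. g permutes {1..m}} = centralizer {1..m} id" by (simp add: centralizer_def)
    show "cycle_weight q c {1..m} g = id.chi (\<lambda>_. 1) g * cycle_weight q c {1..m} g" for g
      unfolding id.chi_def id.orbit_prod_def by simp
  qed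
  also have "\<dots> = (\<Sum>\<sigma> | \<sigma> permutes {1..m}. q ^ maj m (\<sigma> \<circ> id \<circ> inv \<sigma>) *
      (\<Prod>j\<in>{1..m}. linear_factor q c (int j - int (desc m (\<sigma> \<circ> id \<circ> inv \<sigma>))) / q_bracket q (int j)))"
  proof (rule descent_major_identity[symmetric, OF id.perm _ q])
    show "id.eigenfunction (\<lambda>_. 1)"
      by (simp add: id.eigenfunction_def id.root_def orbit_id cis_2pi)
  qed simp
  also have "\<dots> = (\<Sum>\<sigma> | \<sigma> permutes {1..m}. \<Prod>j\<in>{1..m}. linear_factor q c (int j - 1) / q_bracket q (int j))"
  proof (rule sum.cong[OF refl])
    fix \<sigma> assume "\<sigma> \<in> {\<sigma>. \<sigma> permutes {1..m}}"
    then have "\<sigma> \<circ> id \<circ> inv \<sigma> = id" by (simp add: permutes_inv_o)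
    moreover have "descents m id = {}" by (auto simp: descents_def)
    ultimately show "q ^ maj m (\<sigma> \<circ> id \<circ> inv \<sigma>) *
      (\<Prod>j\<in>{1..m}. linear_factor q c (int j - int (desc m (\<sigma> \<circ> id \<circ> inv \<sigma>))) / q_bracket q (int j)) =
      (\<Prod>j\<in>{1..m}. linear_factor q c (int j - 1) / q_bracket q (int j))"
      by (simp add: maj_def desc_def)
  qed
  also have "\<dots> = fact m * (\<Prod>j\<in>{1..m}. linear_factor q c (int j - 1) / q_bracket q (int j))"
    by (simp add: card_permutations[of _ m])
  finally show ?thesis unfolding m_def .
qed

text \<open>The right-hand side is the probability that a uniformly random word over
  \<open>k\<close> letters is fixed. A cycle of length d contributes k^(1 - d) to it, just what the
  hypothesis allows for a power sum. Here \<open>k\<close> is an auxiliary alphabet size, unrelated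
  to any that produced \<open>c\<close>.\<close>

lemma (in finite_perm) cycle_weight_bound:
  assumes k: "k \<ge> 1" and R: "\<And>d. 1 \<le> d \<Longrightarrow> d \<le> card V \<Longrightarrow> norm (power_sum q c d) * real k ^ (d - 1) \<le> 1"
  shows "norm (cycle_weight q c V \<tau>) \<le>
    real (card {w. w \<in> V \<rightarrow>\<^sub>E {..<k} \<and> (\<forall>v\<in>V. w (\<tau> v) = w v)}) / real k ^ card V"
proof -
  have "norm (cycle_weight q c V \<tau>) = (\<Prod>C\<in>orbit \<tau> ` V. norm (power_sum q c (card C)))"
    unfolding cycle_weight_def by (simp add: prod_norm)
  also have "\<dots> \<le> (\<Prod>C\<in>orbit \<tau> ` V. real k / real k ^ card C)"
  proof (rule prod_mono, intro conjI)
    fix C assume C: "C \<in> orbit \<tau> ` V"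
    then have "card C \<ge> 1" "card C \<le> card V"
      using card_orbit_pos orbit_subset_V fin by (auto simp: Suc_le_eq intro: card_mono)
    moreover obtain e where e: "card C = Suc e" using \<open>card C \<ge> 1\<close> by (cases "card C") auto
    ultimately show "norm (power_sum q c (card C)) \<le> real k / real k ^ card C"
      using R[of "card C"] k unfolding e by (simp add: field_simps)
  qed simp
  also have "\<dots> = (\<Prod>C\<in>orbit \<tau> ` V. real k) / (\<Prod>C\<in>orbit \<tau> ` V. real k ^ card C)"
    by (rule prod_dividef)
  also have "(\<Prod>C\<in>orbit \<tau> ` V. real k ^ card C) = real k ^ card V"
    using prod_over_orbits[of "\<lambda>_. real k"] by simp
  also have "(\<Prod>C\<in>orbit \<tau> ` V. real k) = real (card {w. w \<in> V \<rightarrow>\<^sub>E {..<k} \<and> (\<forall>v\<in>V. w (\<tau> v) = w v)})"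
    using sum_fixed_words[of "{..<k}" "\<lambda>_. 1::real"] by simp
  finally show ?thesis .
qed

text \<open>The identity contributes 1. All other terms are dominated by the probability of fixing a
  random word, and exchanging the sums turns their total into the expected order of the word
  stabilizer minus 1.\<close>

lemma (in finite_perm) sum_cycle_weight_centralizer_bound:
  fixes h :: "('a \<Rightarrow> 'a) \<Rightarrow> complex"
  assumes k: "k \<ge> 1" and q: "q \<noteq> 1"
    and R: "\<And>d. 1 \<le> d \<Longrightarrow> d \<le> card V \<Longrightarrow> norm (power_sum q c d) * real k ^ (d - 1) \<le> 1"
    and U: "U \<subseteq> V" "\<And>x. x \<in> U \<Longrightarrow> \<tau> x \<in> U" "\<And>x. x \<in> U \<Longrightarrow> \<tau> x \<noteq> x"
    and h: "\<And>g. norm (h g) \<le> 1" "h id = 1"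
  shows "norm ((\<Sum>g\<in>centralizer U \<tau>. h g * cycle_weight q c U g) - 1) \<le>
    exp (card V * (1 / k + card V / (real k)\<^sup>2)) - 1"
proof -
  let ?Z = "centralizer U \<tau>" and ?W = "U \<rightarrow>\<^sub>E {..<k}"
  have finU: "finite U" using U(1) fin by (rule finite_subset)
  have finZ: "finite ?Z" by (rule finite_centralizer[OF finU])
  have finW: "finite ?W" using finU by (intro finite_PiE) auto
  have idZ: "id \<in> ?Z" by (simp add: centralizer_def permutes_id)
  define F where "F g = {w. w \<in> ?W \<and> (\<forall>v\<in>U. w (g v) = w v)}" for g
  have "power_sum q c 1 = 1" using q by (simp add: power_sum_def)
  then have id1: "cycle_weight q c U id = 1"
    unfolding cycle_weight_def by (intro prod.neutral) (auto simp: orbit_id)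
  have "card U \<le> card V" using U(1) fin by (rule card_mono[rotated])
  have bound: "norm (h g * cycle_weight q c U g) \<le> real (card (F g)) / real k ^ card U" if "g \<in> ?Z" for g
  proof -
    interpret g: finite_perm U g using finU that by unfold_locales (auto simp: centralizer_def)
    have "norm (h g * cycle_weight q c U g) \<le> 1 * norm (cycle_weight q c U g)"
      unfolding norm_mult by (intro mult_right_mono h) simp
    also have "\<dots> \<le> real (card (F g)) / real k ^ card U"
      unfolding F_def mult_1 by (rule g.cycle_weight_bound[OF k R]) (use \<open>card U \<le> card V\<close> in auto)
    finally show ?thesis .
  qed
  have "F id = ?W" by (auto simp: F_def)
  then have F_id: "real (card (F id)) / real k ^ card U = 1" using finU k by (simp add: card_PiE)
  have "(\<Sum>g\<in>?Z. h g * cycle_weight q c U g) - 1 = (\<Sum>g\<in>?Z - {id}. h g * cycle_weight q c U g)"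
    using finZ idZ by (simp add: sum.remove id1 h)
  also have "norm \<dots> \<le> (\<Sum>g\<in>?Z - {id}. real (card (F g)) / real k ^ card U)"
    by (intro sum_norm_le bound) auto
  also have "\<dots> = (\<Sum>g\<in>?Z. real (card (F g))) / real k ^ card U - 1"
    using sum.remove[OF finZ idZ, of "\<lambda>g. real (card (F g)) / real k ^ card U"]
    unfolding F_id sum_divide_distrib by linarith
  also have "(\<Sum>g\<in>?Z. real (card (F g))) = (\<Sum>w\<in>?W. real (card (word_stab U \<tau> w)))"
  proof -
    have "(\<Sum>g\<in>?Z. real (card (F g))) = (\<Sum>g\<in>?Z. \<Sum>w\<in>?W. if \<forall>v\<in>U. w (g v) = w v then 1 else 0)"
      using finW by (intro sum.cong refl) (simp add: F_def sum.If_cases Int_def)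
    also have "\<dots> = (\<Sum>w\<in>?W. \<Sum>g\<in>?Z. if \<forall>v\<in>U. w (g v) = w v then 1 else 0)" by (rule sum.swap)
    also have "\<dots> = (\<Sum>w\<in>?W. real (card (word_stab U \<tau> w)))"
      using finZ by (intro sum.cong refl) (simp add: word_stab_def sum.If_cases Int_def)
    finally show ?thesis .
  qed
  also have "\<dots> / real k ^ card U \<le> exp (card U * (1 / k + card V / (real k)\<^sup>2))"
    using sum_card_word_stab_le[OF k U] k by (simp add: divide_le_eq mult.commute)
  also have "exp (card U * (1 / k + card V / (real k)\<^sup>2)) \<le> exp (card V * (1 / k + card V / (real k)\<^sup>2))"
    using \<open>card U \<le> card V\<close> by (simp add: mult_right_mono)
  finally show ?thesis by simp
qed

text \<open>Whatever commutes with \<tau> preserves its fixed points, so the centralizer is the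
  product of the symmetric group on them and the centralizer on the rest. The cycle weight factors
  accordingly and \<open>chi\<close> is trivial on the first group; \<open>T\<close> is the sum over
  the second.\<close>

lemma descent_major_sum_estimate:
  fixes \<tau> :: "nat \<Rightarrow> nat"
  assumes \<tau>: "\<tau> permutes {1..n}"
    and q: "q \<noteq> 0" "\<And>j. j \<ge> 1 \<Longrightarrow> q ^ j \<noteq> 1"
    and k: "k \<ge> 1" and R: "\<And>d. 1 \<le> d \<Longrightarrow> d \<le> n \<Longrightarrow> norm (power_sum q c d) * real k ^ (d - 1) \<le> 1"
  defines "m \<equiv> num_fixed_points n \<tau>"
  obtains T where "norm (T - 1) \<le> exp (n * (1 / k + n / (real k)\<^sup>2)) - 1"
    "(\<Sum>\<sigma> | \<sigma> permutes {1..n}. q ^ maj n (\<sigma> \<circ> \<tau> \<circ> inv \<sigma>) *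
      (\<Prod>j\<in>{1..n}. linear_factor q c (int j - int (desc n (\<sigma> \<circ> \<tau> \<circ> inv \<sigma>))) / q_bracket q (int j))) =
     fact m * (\<Prod>j\<in>{1..m}. linear_factor q c (int j - 1) / q_bracket q (int j)) * T"
proof -
  define V where "V = {1..n}"
  have V: "finite V" "card V = n" by (auto simp: V_def)
  interpret finite_perm V \<tau> using \<tau> by unfold_locales (simp_all add: V_def)
  define F where "F = {v\<in>V. \<tau> v = v}"
  define U where "U = V - F"
  have finF: "finite F" and finU: "finite U" using V by (auto simp: F_def U_def)
  have disj: "F \<inter> U = {}" and un: "F \<union> U = V" by (auto simp: F_def U_def)
  have m: "card F = m" by (simp add: F_def V_def m_def num_fixed_points_def)
  have \<tau>F: "\<tau> v = v" if "v \<in> F" for v using that by (simp add: F_def)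
  have \<tau>U: "\<tau> v \<in> U \<longleftrightarrow> v \<in> U" for v
    using permutes_in_image[OF perm, of v] permutes_inj[OF perm] by (auto simp: U_def F_def inj_eq)
  \<comment> \<open>On longer cycles any choice will do. On a fixed point the choice must be that
    point, so \<open>f\<close> is 1 on \<open>F\<close> and \<open>chi\<close> ignores the
    permutation of \<open>F\<close>.\<close>
  define rp where "rp v = (SOME u. u \<in> orbit \<tau> v)" for v
  have "rp v \<in> orbit \<tau> v" "rp (\<tau> v) = rp v" for v
    unfolding rp_def orbit_step_eq by (rule some_in_orbit) simp
  then obtain f where f: "eigenfunction f" "\<And>v. f (rp v) = 1"
    using eigenfunction_exists[of rp] by blast
  have fF: "f v = 1" if "v \<in> F" for v
  proof -
    have "orbit \<tau> v = {v}" using \<tau>F[OF that] by (simp add: orbit_eq_singleton_iff)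
    then show ?thesis using f(2)[of v] by (simp add: rp_def)
  qed
  have pU: "p v = v" if "p permutes F" "v \<in> U" for p v
    using that disj permutes_not_in[of p F v] by blast
  have gF: "g v = v" if "g permutes U" "v \<in> F" for g v
    using that disj permutes_not_in[of g U v] by blast
  have chi_split: "chi f (p \<circ> g) = chi f g" if p: "p permutes F" and g: "g permutes U" for p g
    unfolding chi_def
  proof (rule orbit_prod_cong)
    fix v assume "v \<in> V"
    then consider "v \<in> F" | "v \<in> U" using un by blast
    then show "f ((p \<circ> g) v) / f v = f (g v) / f v"
    proof cases
      case 1
      then have "p v \<in> F" using permutes_in_image[OF p] by blast
      then show ?thesis using 1 gF[OF g 1] fF by simp
    next
      case 2
      then have "g v \<in> U" using permutes_in_image[OF g] by blast
      then show ?thesis using pU[OF p] by simp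
    qed
  qed
  have weight_split: "cycle_weight q c V (p \<circ> g) = cycle_weight q c F p * cycle_weight q c U g"
    if p: "p permutes F" and g: "g permutes U" for p g
  proof -
    interpret p: finite_perm F p using finF p by unfold_locales
    interpret g: finite_perm U g using finU g by unfold_locales
    have 1: "orbit (p \<circ> g) ` F = orbit p ` F"
    proof (rule image_cong[OF refl])
      fix v assume "v \<in> F"
      then have "(p \<circ> g) s = p s" if "s \<in> orbit p v" for s
        using p.orbit_subset_V[OF \<open>v \<in> F\<close>] gF[OF g, of s] that by auto
      then show "orbit (p \<circ> g) v = orbit p v" by (rule orbit_cong[OF p.self_in_orbit])
    qed
    have 2: "orbit (p \<circ> g) ` U = orbit g ` U"
    proof (rule image_cong[OF refl])
      fix v assume v: "v \<in> U"
      show "orbit (p \<circ> g) v = orbit g v"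
      proof (rule orbit_cong[OF g.self_in_orbit])
        fix s assume "s \<in> orbit g v"
        then have "g s \<in> U" using g.orbit_subset_V[OF v] permutes_in_image[OF g] by blast
        then show "(p \<circ> g) s = g s" using pU[OF p] by simp
      qed
    qed
    have d: "orbit p ` F \<inter> orbit g ` U = {}"
    proof -
      have False if "v \<in> F" "u \<in> U" "orbit p v = orbit g u" for u v
        using p.orbit_subset_V[OF that(1)] g.orbit_subset_V[OF that(2)] that(3) p.self_in_orbit[of v] disj by blast
      then show ?thesis by blast
    qed
    have "orbit (p \<circ> g) ` V = orbit p ` F \<union> orbit g ` U"
      unfolding un[symmetric] image_Un 1 2 ..
    then show ?thesis unfolding cycle_weight_def
      using d finF finU by (simp add: prod.union_disjoint)
  qed
  have commuteI: "p (g (\<tau> v)) = \<tau> (p (g v))" if p: "p permutes F" and g: "g \<in> centralizer U \<tau>" for p g v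
  proof -
    have gp: "g permutes U" and gc: "g (\<tau> x) = \<tau> (g x)" for x
      using g by (auto simp: centralizer_def fun_eq_iff)
    show ?thesis
    proof (cases "v \<in> F")
      case True
      then show ?thesis using gF[OF gp True] \<tau>F[OF True] \<tau>F permutes_in_image[OF p, of v] by simp
    next
      case False
      then have "g v \<notin> F" using permutes_in_image[OF gp, of v] permutes_not_in[OF gp, of v] disj by (cases "v \<in> U") auto
      moreover have "\<tau> (g v) \<notin> F"
      proof
        assume "\<tau> (g v) \<in> F"
        then have "\<tau> (\<tau> (g v)) = \<tau> (g v)" by (rule \<tau>F)
        then have "\<tau> (g v) = g v" using permutes_inj[OF perm] by (simp add: inj_eq)
        then show False using \<open>\<tau> (g v) \<in> F\<close> \<open>g v \<notin> F\<close> by simp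
      qed
      ultimately show ?thesis using permutes_not_in[OF p] by (simp add: gc)
    qed
  qed
  have "(\<Sum>g\<in>centralizer V \<tau>. chi f g * cycle_weight q c V g) =
      (\<Sum>(p, g)\<in>{p. p permutes F} \<times> centralizer U \<tau>. chi f (p \<circ> g) * cycle_weight q c V (p \<circ> g))"
  proof (rule sum.reindex_bij_witness[of _ "\<lambda>(p, g). p \<circ> g" "\<lambda>g. (perm_restrict g F, perm_restrict g U)"])
    fix g assume g: "g \<in> centralizer V \<tau>"
    then have gp: "g permutes V" and gc: "g (\<tau> x) = \<tau> (g x)" for x
      by (auto simp: centralizer_def fun_eq_iff)
    have gF': "g v \<in> F \<longleftrightarrow> v \<in> F" for v
      using permutes_in_image[OF gp, of v] permutes_inj[OF gp] gc[of v, symmetric] by (auto simp: F_def inj_eq)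
    have gU': "g v \<in> U \<longleftrightarrow> v \<in> U" for v
      using permutes_in_image[OF gp, of v] gF' by (auto simp: U_def)
    have restr: "perm_restrict g S permutes S" if S: "finite S" "\<And>v. g v \<in> S \<longleftrightarrow> v \<in> S" for S
    proof (rule bij_imp_permutes)
      have "perm_restrict g S ` S \<subseteq> S" using S by (auto simp: perm_restrict_def)
      moreover have "inj_on (perm_restrict g S) S"
        by (simp add: inj_on_def perm_restrict_def inj_eq[OF permutes_inj[OF gp]])
      ultimately show "bij_betw (perm_restrict g S) S S"
        using S(1) by (simp add: bij_betw_def endo_inj_surj)
    qed (simp add: perm_restrict_def)
    show "(case (perm_restrict g F, perm_restrict g U) of (p, g) \<Rightarrow> p \<circ> g) = g"
    proof
      fix v
      consider "v \<in> F" | "v \<in> U" | "v \<notin> V" using un by blast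
      then show "(case (perm_restrict g F, perm_restrict g U) of (p, g) \<Rightarrow> p \<circ> g) v = g v"
        using disj un gU'[of v] permutes_not_in[OF gp, of v]
        by cases (auto simp: perm_restrict_def)
    qed
    have "perm_restrict g U \<circ> \<tau> = \<tau> \<circ> perm_restrict g U"
      using \<tau>U gc by (auto simp: fun_eq_iff perm_restrict_def)
    then show "(perm_restrict g F, perm_restrict g U) \<in> {p. p permutes F} \<times> centralizer U \<tau>"
      using restr[OF finF gF'] restr[OF finU gU'] by (simp add: centralizer_def)
    then show "(case (perm_restrict g F, perm_restrict g U) of (p, g) \<Rightarrow> chi f (p \<circ> g) * cycle_weight q c V (p \<circ> g)) =
        chi f g * cycle_weight q c V g"
      using \<open>(case (perm_restrict g F, perm_restrict g U) of (p, g) \<Rightarrow> p \<circ> g) = g\<close> by simp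
  next
    fix x assume x: "x \<in> {p. p permutes F} \<times> centralizer U \<tau>"
    then obtain p g where pg: "x = (p, g)" "p permutes F" "g \<in> centralizer U \<tau>" by blast
    have gp: "g permutes U" using pg(3) by (simp add: centralizer_def)
    have "p permutes V" "g permutes V" using pg(2) gp un permutes_subset by blast+
    then have "p \<circ> g permutes V" by (intro permutes_compose)
    then show "(case x of (p, g) \<Rightarrow> p \<circ> g) \<in> centralizer V \<tau>"
      using commuteI[OF pg(2,3)] by (auto simp: pg(1) centralizer_def)
    have "perm_restrict (p \<circ> g) F = p"
    proof
      fix v show "perm_restrict (p \<circ> g) F v = p v"
        using gF[OF gp, of v] permutes_not_in[OF pg(2), of v] by (simp add: perm_restrict_def)
    qed
    moreover have "perm_restrict (p \<circ> g) U = g"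
    proof
      fix v show "perm_restrict (p \<circ> g) U v = g v"
        using pU[OF pg(2), of "g v"] permutes_in_image[OF gp, of v] permutes_not_in[OF gp, of v]
        by (simp add: perm_restrict_def)
    qed
    ultimately show "(perm_restrict (case x of (p, g) \<Rightarrow> p \<circ> g) F, perm_restrict (case x of (p, g) \<Rightarrow> p \<circ> g) U) = x"
      by (simp add: pg(1))
  qed
  also have "\<dots> = (\<Sum>(p, g)\<in>{p. p permutes F} \<times> centralizer U \<tau>. cycle_weight q c F p * (chi f g * cycle_weight q c U g))"
    by (intro sum.cong refl) (auto simp: chi_split weight_split centralizer_def)
  also have "\<dots> = (\<Sum>p | p permutes F. cycle_weight q c F p) * (\<Sum>g\<in>centralizer U \<tau>. chi f g * cycle_weight q c U g)"
    by (simp add: sum_product sum.cartesian_product)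
  finally have main: "(\<Sum>g\<in>centralizer V \<tau>. chi f g * cycle_weight q c V g) =
    (\<Sum>p | p permutes F. cycle_weight q c F p) * (\<Sum>g\<in>centralizer U \<tau>. chi f g * cycle_weight q c U g)" .
  show thesis
  proof
    have U: "U \<subseteq> V" "\<And>x. x \<in> U \<Longrightarrow> \<tau> x \<in> U" "\<And>x. x \<in> U \<Longrightarrow> \<tau> x \<noteq> x"
      using \<tau>U by (auto simp: U_def F_def)
    have "q \<noteq> 1" using q(2)[of 1] by simp
    then show "norm ((\<Sum>g\<in>centralizer U \<tau>. chi f g * cycle_weight q c U g) - 1) \<le>
        exp (n * (1 / k + n / (real k)\<^sup>2)) - 1"
      using sum_cycle_weight_centralizer_bound[OF k _ _ U, of q c "chi f"] R norm_chi[OF f(1)] chi_id[OF f(1)]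
      by (simp add: V(2))
    show "(\<Sum>\<sigma> | \<sigma> permutes {1..n}. q ^ maj n (\<sigma> \<circ> \<tau> \<circ> inv \<sigma>) *
      (\<Prod>j\<in>{1..n}. linear_factor q c (int j - int (desc n (\<sigma> \<circ> \<tau> \<circ> inv \<sigma>))) / q_bracket q (int j))) =
     fact m * (\<Prod>j\<in>{1..m}. linear_factor q c (int j - 1) / q_bracket q (int j)) *
      (\<Sum>g\<in>centralizer U \<tau>. chi f g * cycle_weight q c U g)"
      using descent_major_identity[OF \<tau> f(1) q, of c] main sum_cycle_weight_permutes[OF finF q, of c]
      unfolding V_def[symmetric] m by simp
  qed
qed

section \<open>Averages over a conjugation invariant set\<close>

lemma sum_conj_invariant:
  fixes h :: "(nat \<Rightarrow> nat) \<Rightarrow> complex"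
  assumes A: "A \<subseteq> {\<pi>. \<pi> permutes {1..n}}" and conj: "conj_invariant n A"
  shows "(\<Sum>\<tau>\<in>A. \<Sum>\<sigma> | \<sigma> permutes {1..n}. h (\<sigma> \<circ> \<tau> \<circ> inv \<sigma>)) = fact n * (\<Sum>\<pi>\<in>A. h \<pi>)"
proof -
  have "(\<Sum>\<tau>\<in>A. h (\<sigma> \<circ> \<tau> \<circ> inv \<sigma>)) = (\<Sum>\<pi>\<in>A. h \<pi>)" if \<sigma>: "\<sigma> permutes {1..n}" for \<sigma>
  proof (rule sum.reindex_bij_betw)
    have inv: "inv (inv \<sigma>) = \<sigma>" using permutes_inv_inv[OF \<sigma>] .
    have 1: "\<sigma> \<circ> \<pi> \<circ> inv \<sigma> \<in> A" if "\<pi> \<in> A" for \<pi>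
      using conj that \<sigma> unfolding conj_invariant_def by blast
    have "inv \<sigma> \<circ> \<pi> \<circ> inv (inv \<sigma>) \<in> A" if "\<pi> \<in> A" for \<pi>
      using conj that permutes_inv[OF \<sigma>] unfolding conj_invariant_def by blast
    then have 2: "inv \<sigma> \<circ> \<pi> \<circ> \<sigma> \<in> A" if "\<pi> \<in> A" for \<pi>
      using that by (simp only: inv)
    have 3: "inv \<sigma> \<circ> (\<sigma> \<circ> \<pi> \<circ> inv \<sigma>) \<circ> \<sigma> = \<pi>" "\<sigma> \<circ> (inv \<sigma> \<circ> \<pi> \<circ> \<sigma>) \<circ> inv \<sigma> = \<pi>" for \<pi>
      by (rule ext; simp add: permutes_inverses[OF \<sigma>])+
    show "bij_betw (\<lambda>\<tau>. \<sigma> \<circ> \<tau> \<circ> inv \<sigma>) A A"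
    proof (rule bij_betw_byWitness[where f' = "\<lambda>\<pi>. inv \<sigma> \<circ> \<pi> \<circ> \<sigma>"])
      show "\<forall>\<pi>\<in>A. inv \<sigma> \<circ> (\<sigma> \<circ> \<pi> \<circ> inv \<sigma>) \<circ> \<sigma> = \<pi>" by (rule ballI, rule 3)
      show "\<forall>\<pi>\<in>A. \<sigma> \<circ> (inv \<sigma> \<circ> \<pi> \<circ> \<sigma>) \<circ> inv \<sigma> = \<pi>" by (rule ballI, rule 3)
      show "(\<lambda>\<tau>. \<sigma> \<circ> \<tau> \<circ> inv \<sigma>) ` A \<subseteq> A" by (rule image_subsetI, rule 1)
      show "(\<lambda>\<pi>. inv \<sigma> \<circ> \<pi> \<circ> \<sigma>) ` A \<subseteq> A" by (rule image_subsetI, rule 2)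
    qed
  qed
  then have "(\<Sum>\<sigma> | \<sigma> permutes {1..n}. \<Sum>\<tau>\<in>A. h (\<sigma> \<circ> \<tau> \<circ> inv \<sigma>)) = (\<Sum>\<sigma> | \<sigma> permutes {1..n}. \<Sum>\<pi>\<in>A. h \<pi>)"
    by (intro sum.cong[of "{\<sigma>. \<sigma> permutes {1..n}}"] refl) (simp only: mem_Collect_eq)
  then show ?thesis by (subst sum.swap) (simp add: card_permutations[of _ n])
qed

text \<open>Each \<tau> in \<open>A\<close> has its own error \<open>T\<close>, but the main term
  depends only on the number of fixed points, and averaging the errors keeps their bound. The
  brackets up to \<open>m\<close> cancel, which leaves the quotients [j] / j for j > m.\<close>

lemma average_estimate:
  assumes A: "A \<subseteq> {\<pi>. \<pi> permutes {1..n}}" "A \<noteq> {}" and conj: "conj_invariant n A"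
    and m: "\<And>\<pi>. \<pi> \<in> A \<Longrightarrow> num_fixed_points n \<pi> = m"
    and q: "q \<noteq> 0" "\<And>j. j \<ge> 1 \<Longrightarrow> q ^ j \<noteq> 1"
    and k: "k \<ge> 1" and R: "\<And>d. 1 \<le> d \<Longrightarrow> d \<le> n \<Longrightarrow> norm (power_sum q c d) * real k ^ (d - 1) \<le> 1"
  obtains T where "norm (T - 1) \<le> exp (n * (1 / k + n / (real k)\<^sup>2)) - 1"
    "(\<Sum>\<pi>\<in>A. q ^ maj n \<pi> * (\<Prod>j\<in>{1..n}. linear_factor q c (int j - int (desc n \<pi>)))) / of_nat (card A) =
     (\<Prod>j\<in>{m<..n}. q_bracket q (int j) / of_nat j) * (\<Prod>j\<in>{1..m}. linear_factor q c (int j - 1)) * T"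
proof -
  define B where "B = exp (n * (1 / k + n / (real k)\<^sup>2)) - 1"
  define br where "br a b = (\<Prod>j\<in>{a<..b}. q_bracket q (int j))" for a b :: nat
  define h where "h \<pi> = q ^ maj n \<pi> * (\<Prod>j\<in>{1..n}. linear_factor q c (int j - int (desc n \<pi>)))" for \<pi>
  define L where "L = (\<Prod>j\<in>{1..m}. linear_factor q c (int j - 1))"
  have finA: "finite A" using A(1) finite_permutations[of "{1..n}"] finite_subset by blast
  have mn: "m \<le> n"
  proof -
    obtain \<pi> where "\<pi> \<in> A" using A(2) by blast
    have "num_fixed_points n \<pi> \<le> card {1..n}" unfolding num_fixed_points_def by (rule card_mono) auto
    then show ?thesis using m[OF \<open>\<pi> \<in> A\<close>] by simp
  qed
  have brnz: "q_bracket q (int j) \<noteq> 0" if "j \<ge> 1" for j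
    using q(2)[OF that] q(2)[of 1] by (simp add: q_bracket_def power_int_of_nat)
  have nz: "br 0 n \<noteq> 0" "br 0 m \<noteq> 0" using brnz by (auto simp: br_def)
  have "\<exists>T. norm (T - 1) \<le> B \<and> (\<Sum>\<sigma> | \<sigma> permutes {1..n}. h (\<sigma> \<circ> \<tau> \<circ> inv \<sigma>)) / br 0 n = fact m * (L / br 0 m) * T"
    if \<tau>: "\<tau> \<in> A" for \<tau>
  proof -
    have p: "\<tau> permutes {1..n}" using A \<tau> by blast
    have I: "{1..x} = {0<..x}" for x :: nat by auto
    obtain T where T: "norm (T - 1) \<le> B"
      "(\<Sum>\<sigma> | \<sigma> permutes {1..n}. q ^ maj n (\<sigma> \<circ> \<tau> \<circ> inv \<sigma>) *
      (\<Prod>j\<in>{1..n}. linear_factor q c (int j - int (desc n (\<sigma> \<circ> \<tau> \<circ> inv \<sigma>))) / q_bracket q (int j))) =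
     fact m * (\<Prod>j\<in>{1..m}. linear_factor q c (int j - 1) / q_bracket q (int j)) * T"
      unfolding B_def m[OF \<tau>, symmetric]
      by (rule descent_major_sum_estimate[OF p q k R]) (assumption | rule that)+
    have "(\<Sum>\<sigma> | \<sigma> permutes {1..n}. h (\<sigma> \<circ> \<tau> \<circ> inv \<sigma>)) / br 0 n = fact m * (L / br 0 m) * T"
      using T(2) unfolding h_def L_def br_def I prod_dividef sum_divide_distrib times_divide_eq_right .
    then show ?thesis using T(1) by blast
  qed
  then have "\<forall>\<tau>\<in>A. \<exists>T. norm (T - 1) \<le> B \<and>
      (\<Sum>\<sigma> | \<sigma> permutes {1..n}. h (\<sigma> \<circ> \<tau> \<circ> inv \<sigma>)) / br 0 n = fact m * (L / br 0 m) * T" ..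
  from bchoice[OF this] obtain T where T: "\<And>\<tau>. \<tau> \<in> A \<Longrightarrow> norm (T \<tau> - 1) \<le> B"
    "\<And>\<tau>. \<tau> \<in> A \<Longrightarrow> (\<Sum>\<sigma> | \<sigma> permutes {1..n}. h (\<sigma> \<circ> \<tau> \<circ> inv \<sigma>)) / br 0 n = fact m * (L / br 0 m) * T \<tau>"
    by auto
  define T' where "T' = (\<Sum>\<tau>\<in>A. T \<tau>) / of_nat (card A)"
  have cA: "card A > 0" using finA A(2) by (simp add: card_gt_0_iff)
  show thesis
  proof
    have "T' - 1 = (\<Sum>\<tau>\<in>A. T \<tau> - 1) / of_nat (card A)"
      using cA by (simp add: T'_def sum_subtractf diff_divide_distrib)
    also have "norm \<dots> \<le> (\<Sum>\<tau>\<in>A. B) / card A"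
      unfolding norm_divide norm_of_nat by (intro divide_right_mono sum_norm_le T) auto
    also have "\<dots> = B" using cA by simp
    finally show "norm (T' - 1) \<le> exp (n * (1 / k + n / (real k)\<^sup>2)) - 1" unfolding B_def .
    have "fact n * (\<Sum>\<pi>\<in>A. h \<pi>) = (\<Sum>\<tau>\<in>A. br 0 n * (fact m * (L / br 0 m) * T \<tau>))"
      unfolding sum_conj_invariant[OF A(1) conj, symmetric]
      by (intro sum.cong refl) (use T(2) nz in \<open>simp add: field_simps\<close>)
    also have "\<dots> = br 0 n / br 0 m * fact m * L * (\<Sum>\<tau>\<in>A. T \<tau>)"
      unfolding sum_distrib_left by (intro sum.cong refl) simp
    also have "br 0 n / br 0 m = br m n"
    proof -
      have "{0<..n} = {0<..m} \<union> {m<..n}" using mn by auto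
      then have "br 0 n = br 0 m * br m n" unfolding br_def by (simp add: prod.union_disjoint)
      then show ?thesis using nz by simp
    qed
    finally have "(\<Sum>\<pi>\<in>A. h \<pi>) = br m n * fact m * L * (\<Sum>\<tau>\<in>A. T \<tau>) / fact n"
      by (simp add: eq_divide_eq mult.commute)
    then have "(\<Sum>\<pi>\<in>A. h \<pi>) / of_nat (card A) = br m n * (fact m / fact n) * L * T'"
      by (simp add: T'_def)
    also have "br m n * (fact m / fact n) = (\<Prod>j\<in>{m<..n}. q_bracket q (int j) / of_nat j)"
    proof -
      have "(fact n :: complex) = fact m * (\<Prod>j\<in>{m<..n}. of_nat j)"
      proof -
        have eq: "{1..n} = {1..m} \<union> {m<..n}" using mn by auto
        show ?thesis unfolding fact_prod of_nat_prod
          by (subst eq, rule prod.union_disjoint) auto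
      qed
      moreover have "(\<Prod>j\<in>{m<..n}. of_nat j :: complex) \<noteq> 0" by auto
      ultimately show ?thesis unfolding br_def prod_dividef by (simp add: field_simps)
    qed
    finally show "(\<Sum>\<pi>\<in>A. q ^ maj n \<pi> * (\<Prod>j\<in>{1..n}. linear_factor q c (int j - int (desc n \<pi>)))) / of_nat (card A) =
      (\<Prod>j\<in>{m<..n}. q_bracket q (int j) / of_nat j) * (\<Prod>j\<in>{1..m}. linear_factor q c (int j - 1)) * T'"
      unfolding h_def L_def .
  qed
qed

section \<open>Asymptotics of the product formula\<close>

lemma norm_exp_minus_quadratic:
  fixes z :: complex
  assumes "norm z \<le> 1"
  shows "norm (exp z - (1 + z + z\<^sup>2 / 2)) \<le> 2 * norm z ^ 3"
proof -
  have "norm (exp z - (\<Sum>k\<le>2. z ^ k / fact k)) \<le> exp \<bar>Re z\<bar> * norm z ^ 3 / fact 2"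
    using Taylor_exp[of z 2] by (simp add: eval_nat_numeral)
  moreover have "(\<Sum>k\<le>2. z ^ k / fact k) = 1 + z + z\<^sup>2 / 2"
    by (simp add: numeral_2_eq_2)
  moreover have "exp \<bar>Re z\<bar> \<le> 4"
  proof -
    have "\<bar>Re z\<bar> \<le> 1" using abs_Re_le_cmod[of z] assms by linarith
    then have "exp \<bar>Re z\<bar> \<le> exp 1" by simp
    then show ?thesis using exp_le by linarith
  qed
  then have "exp \<bar>Re z\<bar> * norm z ^ 3 / fact 2 \<le> 4 * norm z ^ 3 / fact 2"
    by (intro divide_right_mono mult_right_mono) auto
  ultimately show ?thesis by (simp add: fact_2)
qed

lemma norm_cis_minus_linear: "norm (cis x - 1 - \<i> * x) \<le> x\<^sup>2 / 2"
  using iexp_approx1[of x 1] by (simp add: cis_conv_exp power2_eq_square algebra_simps)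

lemma norm_cis_minus_cubic:
  "norm (cis x - (1 + \<i> * x - x\<^sup>2 / 2 - \<i> * x ^ 3 / 6)) \<le> x ^ 4 / 24"
proof -
  have "(\<Sum>k\<le>3. (\<i> * complex_of_real x) ^ k / fact k) = 1 + \<i> * x - x\<^sup>2 / 2 - \<i> * x ^ 3 / 6"
    by (simp add: eval_nat_numeral algebra_simps)
  then show ?thesis using iexp_approx1[of x 3] by (simp add: cis_conv_exp fact_numeral)
qed

lemma norm_cis_minus_1_ge: "\<bar>x\<bar> \<le> 1 \<Longrightarrow> \<bar>x\<bar> / 2 \<le> norm (cis x - 1)"
proof -
  assume x: "\<bar>x\<bar> \<le> 1"
  have "norm (\<i> * complex_of_real x) \<le> norm (cis x - 1) + norm (cis x - 1 - \<i> * x)"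
    using norm_triangle_ineq4[of "cis x - 1" "cis x - 1 - \<i> * x"] by simp
  moreover have "x\<^sup>2 \<le> \<bar>x\<bar>" using x mult_left_le[of "\<bar>x\<bar>" "\<bar>x\<bar>"] by (simp add: power2_eq_square abs_mult_self_eq)
  ultimately show ?thesis using norm_cis_minus_linear[of x] by (simp add: norm_mult)
qed

lemma norm_cis_minus_1_le: "norm (cis x - 1) \<le> \<bar>x\<bar>"
  using iexp_approx1[of x 0] by (simp add: cis_conv_exp)

lemma cis_power_int: "cis x powi r = cis (x * of_int r)"
proof (cases "r \<ge> 0")
  case True
  then show ?thesis by (simp add: power_int_def Complex.DeMoivre mult.commute)
next
  case False
  then show ?thesis by (simp add: power_int_def Complex.DeMoivre mult.commute)
qed

text \<open>With u = \<theta> r, the bracket is r times the quotient of (exp(i u) - 1) / (i u) by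
  (exp(i \<theta>) - 1) / (i \<theta>). In the application \<theta> is far smaller than the bound on
  \<open>u\<close>, so the denominator is merely compared with 1, at a cost of order \<theta>, while
  the numerator is expanded to second order.\<close>

lemma q_bracket_approx:
  fixes r :: int and \<theta> :: real
  assumes \<theta>: "\<theta> \<noteq> 0" "\<bar>\<theta>\<bar> \<le> 1" "\<bar>\<theta> * r\<bar> \<le> 1"
  shows "norm (q_bracket (cis \<theta>) r - r * (1 + \<i> * (\<theta> * r) / 2 - (\<theta> * r)\<^sup>2 / 6)) \<le>
    \<bar>r\<bar> * (\<bar>\<theta> * r\<bar> ^ 3 + 3 * \<bar>\<theta>\<bar>)"
proof (cases "r = 0")
  case True
  then show ?thesis by (simp add: q_bracket_def)
next
  case False
  define u where "u = \<theta> * real_of_int r"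
  have u: "u \<noteq> 0" "\<bar>u\<bar> \<le> 1" using False \<theta> by (auto simp: u_def)
  define X where "X = 1 + \<i> * u / 2 - u\<^sup>2 / 6"
  define \<eta> where "\<eta> = (cis \<theta> - 1) / (\<i> * \<theta>) - 1"
  define Y where "Y = (cis u - 1) / (\<i> * u)"
  have eta: "cis \<theta> - 1 = \<i> * \<theta> * (1 + \<eta>)" using \<theta> by (simp add: \<eta>_def)
  have Y: "cis u - 1 = \<i> * u * Y" using u by (simp add: Y_def)
  have "norm (\<i> * \<theta>) * norm \<eta> \<le> \<theta>\<^sup>2 / 2"
    using norm_cis_minus_linear[of \<theta>] unfolding norm_mult[symmetric]
    using eta by (simp add: algebra_simps)
  then have "\<bar>\<theta>\<bar> * norm \<eta> \<le> \<bar>\<theta>\<bar> * (\<bar>\<theta>\<bar> / 2)" by (simp add: norm_mult power2_eq_square abs_mult_self_eq)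
  then have \<eta>1: "norm \<eta> \<le> \<bar>\<theta>\<bar> / 2" by (rule mult_left_le_imp_le) (use \<theta> in simp)
  then have \<eta>2: "norm (1 + \<eta>) \<ge> 1 / 2"
    using norm_triangle_ineq2[of 1 "- \<eta>"] \<theta> by simp
  then have \<eta>nz: "1 + \<eta> \<noteq> 0" by auto
  have "\<i> * u * (Y - X) = cis u - (1 + \<i> * u - u\<^sup>2 / 2 - \<i> * u ^ 3 / 6)"
    unfolding right_diff_distrib Y[symmetric] X_def by (simp add: algebra_simps power2_eq_square power3_eq_cube)
  then have "norm (\<i> * u * (Y - X)) \<le> u ^ 4 / 24" using norm_cis_minus_cubic[of u] by simp
  then have "\<bar>u\<bar> * norm (Y - X) \<le> \<bar>u\<bar> * (\<bar>u\<bar> ^ 3 / 24)"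
    by (simp add: norm_mult eval_nat_numeral abs_mult_self_eq)
  then have YX: "norm (Y - X) \<le> \<bar>u\<bar> ^ 3 / 24" using u by (simp add: mult_le_cancel_left)
  have u3: "\<bar>u\<bar> ^ 3 \<le> 1" "u\<^sup>2 \<le> 1" using u by (auto simp: power_le_one abs_square_le_1)
  have "norm X \<le> norm (1 + \<i> * u / 2) + norm (complex_of_real (u\<^sup>2 / 6))"
    unfolding X_def by (rule norm_triangle_ineq4)
  also have "norm (1 + \<i> * u / 2) \<le> 1 + \<bar>u\<bar> / 2"
    using norm_triangle_ineq[of 1 "\<i> * u / 2"] by (simp add: norm_mult)
  finally have X: "norm X \<le> 2" using u u3 by (simp add: norm_divide norm_power)
  have "norm Y \<le> norm X + norm (Y - X)" using norm_triangle_ineq[of X "Y - X"] by simp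
  then have Y3: "norm Y \<le> 3" using X YX u3 by simp
  have "Y / (1 + \<eta>) - X = (Y - X) - Y * \<eta> / (1 + \<eta>)" using \<eta>nz by (simp add: field_simps)
  also have "norm \<dots> \<le> norm (Y - X) + norm (Y * \<eta> / (1 + \<eta>))" by (rule norm_triangle_ineq4)
  also have "norm (Y * \<eta> / (1 + \<eta>)) \<le> 3 * (\<bar>\<theta>\<bar> / 2) / (1 / 2)"
    unfolding norm_divide norm_mult using Y3 \<eta>1 \<eta>2 by (intro frac_le mult_mono) auto
  finally have main: "norm (Y / (1 + \<eta>) - X) \<le> \<bar>u\<bar> ^ 3 / 24 + 3 * \<bar>\<theta>\<bar>" using YX by simp
  have "q_bracket (cis \<theta>) r = r * (Y / (1 + \<eta>))"
  proof -
    define w where "w = 1 + \<eta>"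
    have "w \<noteq> 0" using \<eta>nz by (simp add: w_def)
    then show ?thesis
      unfolding q_bracket_def cis_power_int u_def[symmetric] eta Y w_def[symmetric]
      using \<theta> by (simp add: u_def field_simps)
  qed
  then have "norm (q_bracket (cis \<theta>) r - r * X) = \<bar>r\<bar> * norm (Y / (1 + \<eta>) - X)"
    by (metis norm_mult norm_of_int of_int_abs right_diff_distrib)
  also have "\<dots> \<le> \<bar>r\<bar> * (\<bar>u\<bar> ^ 3 / 24 + 3 * \<bar>\<theta>\<bar>)" by (intro mult_left_mono main) simp
  also have "\<dots> \<le> \<bar>r\<bar> * (\<bar>u\<bar> ^ 3 + 3 * \<bar>\<theta>\<bar>)" by (intro mult_left_mono add_right_mono) auto
  finally show ?thesis by (simp add: X_def u_def)
qed


text \<open>With x = \<epsilon> r the factor is 1 - i s x + s t x^2 / 2 up to third order,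
  \<open>t\<close> having cancelled from the linear term; the exponent is the logarithm of this. For
  \<delta> = n^(-1/2) and \<epsilon> = \<delta>^3, one factor costs order \<delta>^3, so
  \<open>n\<close> factors cost order \<delta>.\<close>

lemma norm_linear_factor_approx:
  fixes r :: int and s t \<epsilon> \<delta> B :: real
  assumes B: "B \<ge> 1" "\<bar>s\<bar> \<le> B" "\<bar>t\<bar> \<le> B" and t: "t * \<epsilon> \<noteq> 0"
    and x: "\<bar>\<epsilon> * r\<bar> \<le> \<delta>" and \<epsilon>: "0 \<le> \<epsilon>" "\<epsilon> \<le> \<delta> ^ 3" and \<delta>: "2 * B\<^sup>2 * \<delta> \<le> 1" "0 \<le> \<delta>"
  shows "norm (linear_factor (cis (t * \<epsilon>)) (- \<i> * (s + t) * \<epsilon>) r -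
      exp (- \<i> * s * (\<epsilon> * r) + s * (s + t) * (\<epsilon> * r)\<^sup>2 / 2)) \<le> 30 * B ^ 3 * \<delta> ^ 3"
proof -
  define x where "x = \<epsilon> * r"
  define u where "u = t * x"
  have xd: "\<bar>x\<bar> \<le> \<delta>" using x by (simp add: x_def)
  have B2: "B \<le> B\<^sup>2" using B by (simp add: self_le_power)
  have Bd: "2 * B * \<delta> \<le> 1"
    using mult_right_mono[OF B2 \<delta>(2)] \<delta>(1) by simp
  have d1: "\<delta> \<le> 1 / 2" using Bd mult_right_mono[OF B(1) \<delta>(2)] by simp
  have d32: "\<delta> ^ 3 \<le> \<delta>\<^sup>2" using \<delta> d1 by (intro power_decreasing) auto
  have ux: "\<bar>u\<bar> \<le> B * \<delta>" unfolding u_def abs_mult using B xd by (intro mult_mono) auto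
  have u2: "u\<^sup>2 \<le> B\<^sup>2 * \<delta>\<^sup>2" using power_mono[OF ux, of 2] by (simp add: power_mult_distrib)
  have u3: "\<bar>u\<bar> ^ 3 \<le> B ^ 3 * \<delta> ^ 3" using power_mono[OF ux, of 3] by (simp add: power_mult_distrib)
  have u32: "\<bar>u\<bar> ^ 3 \<le> B\<^sup>2 * \<delta>\<^sup>2"
  proof -
    have "\<bar>u\<bar> ^ 3 \<le> \<bar>u\<bar>\<^sup>2" using ux Bd by (intro power_decreasing) auto
    then show ?thesis using u2 by simp
  qed
  have st: "\<bar>s + t\<bar> \<le> 2 * B" using B by linarith
  have sx: "\<bar>s * x\<bar> \<le> B * \<delta>" unfolding abs_mult using B xd by (intro mult_mono) auto
  have x2: "x\<^sup>2 \<le> \<delta>\<^sup>2" using power_mono[OF xd, of 2] by simp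
  define p where "p = s * (s + t) * x\<^sup>2 / 2"
  have p: "\<bar>p\<bar> \<le> B\<^sup>2 * \<delta>\<^sup>2"
  proof -
    have "\<bar>s\<bar> * \<bar>s + t\<bar> * x\<^sup>2 \<le> B * (2 * B) * \<delta>\<^sup>2" using B st x2 by (intro mult_mono) auto
    then show ?thesis by (simp add: p_def abs_mult power2_eq_square)
  qed
  have p1: "\<bar>p\<bar> \<le> B * \<delta>"
  proof -
    have "B\<^sup>2 * \<delta>\<^sup>2 = (B * \<delta>) * (B * \<delta>)" by (simp add: power2_eq_square)
    also have "\<dots> \<le> (B * \<delta>) * 1" using Bd B \<delta> by (intro mult_left_mono) auto
    finally show ?thesis using p by simp
  qed
  define z where "z = - \<i> * complex_of_real (s * x) + complex_of_real p"
  define T1 where "T1 = 1 - \<i> * complex_of_real (s * x) + complex_of_real (s * t * x\<^sup>2 / 2)"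
  have "norm z \<le> \<bar>s * x\<bar> + \<bar>p\<bar>"
    unfolding z_def by (rule order_trans[OF norm_triangle_ineq]) (simp add: norm_mult)
  then have nz: "norm z \<le> 2 * B * \<delta>" using sx p1 by linarith
  have "norm (exp z - (1 + z + z\<^sup>2 / 2)) \<le> 2 * norm z ^ 3"
    using nz Bd by (intro norm_exp_minus_quadratic) simp
  also have "\<dots> \<le> 2 * (2 * B * \<delta>) ^ 3" using nz by (intro mult_left_mono power_mono) auto
  finally have A1: "norm (exp z - (1 + z + z\<^sup>2 / 2)) \<le> 16 * (B ^ 3 * \<delta> ^ 3)" by (simp add: power_mult_distrib)
  have "1 + z + z\<^sup>2 / 2 - T1 = - \<i> * complex_of_real (s * x * p) + complex_of_real (p * p / 2)"
    unfolding z_def T1_def by (simp add: power2_eq_square algebra_simps p_def add_divide_distrib diff_divide_distrib)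
  also have "norm \<dots> \<le> \<bar>s * x * p\<bar> + \<bar>p * p / 2\<bar>"
    by (rule order_trans[OF norm_triangle_ineq]) (simp add: norm_mult)
  also have "\<dots> \<le> 2 * (B ^ 3 * \<delta> ^ 3)"
  proof -
    have "\<bar>s * x * p\<bar> \<le> (B * \<delta>) * (B\<^sup>2 * \<delta>\<^sup>2)" unfolding abs_mult[of _ p] using sx p by (intro mult_mono) auto
    moreover have "\<bar>p * p / 2\<bar> \<le> (B * \<delta>) * (B\<^sup>2 * \<delta>\<^sup>2)"
    proof -
      have "\<bar>p\<bar> * \<bar>p\<bar> \<le> (B * \<delta>) * (B\<^sup>2 * \<delta>\<^sup>2)" using p p1 by (intro mult_mono) auto
      then have "p * p \<le> (B * \<delta>) * (B\<^sup>2 * \<delta>\<^sup>2)" by (simp flip: abs_mult)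
      then show ?thesis using zero_le_square[of p] by linarith
    qed
    moreover have "(B * \<delta>) * (B\<^sup>2 * \<delta>\<^sup>2) = B ^ 3 * \<delta> ^ 3" by (simp add: power2_eq_square power3_eq_cube)
    ultimately show ?thesis by linarith
  qed
  finally have A2: "norm (1 + z + z\<^sup>2 / 2 - T1) \<le> 2 * (B ^ 3 * \<delta> ^ 3)" .
  define \<theta> where "\<theta> = t * \<epsilon>"
  have \<theta>r: "\<theta> * r = u" by (simp add: \<theta>_def u_def x_def)
  have \<theta>b: "\<bar>\<theta>\<bar> \<le> B * \<delta> ^ 3" unfolding \<theta>_def abs_mult using B \<epsilon> by (intro mult_mono) auto
  have \<theta>1: "\<bar>\<theta>\<bar> \<le> 1"
  proof -
    have "\<delta>\<^sup>2 \<le> \<delta>" using \<delta> d1 by (simp add: power2_eq_square mult_left_le)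
    then have "B * \<delta> ^ 3 \<le> B * \<delta>" using d32 B by (intro mult_left_mono) auto
    then show ?thesis using \<theta>b Bd by linarith
  qed
  define e where "e = q_bracket (cis \<theta>) r - r * (1 + \<i> * (\<theta> * r) / 2 - (\<theta> * r)\<^sup>2 / 6)"
  have e: "norm e \<le> \<bar>r\<bar> * (\<bar>u\<bar> ^ 3 + 3 * \<bar>\<theta>\<bar>)"
    unfolding e_def using q_bracket_approx[of \<theta> r] t \<theta>1 ux Bd unfolding \<theta>r by (simp add: \<theta>_def)
  have "norm (cis u - (1 + \<i> * u - u\<^sup>2 / 2)) \<le> \<bar>u\<bar> ^ 3 / 6"
    using iexp_approx1[of u 2] by (simp add: cis_conv_exp eval_nat_numeral algebra_simps)
  then have A3: "norm (cis u - (1 + \<i> * u - u\<^sup>2 / 2)) \<le> B ^ 3 * \<delta> ^ 3" using u3 zero_le_power_abs[of u 3] by linarith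
  have nI: "norm (\<i> * complex_of_real a) = \<bar>a\<bar>" "norm (\<i> * complex_of_real a * v) = \<bar>a\<bar> * norm v" for a v
    by (simp_all add: norm_mult)
  have BD: "0 \<le> B ^ 3 * \<delta> ^ 3" using B \<delta> by simp
  define c where "c = - \<i> * (s + t) * \<epsilon>"
  define lf where "lf = linear_factor (cis \<theta>) c r"
  have "lf - T1 = (cis u - (1 + \<i> * u - u\<^sup>2 / 2)) + (\<i> * complex_of_real ((s + t) * x * u\<^sup>2 / 6) - \<i> * complex_of_real ((s + t) * \<epsilon>) * e)"
  proof -
    have "q_bracket (cis \<theta>) r = r * (1 + \<i> * u / 2 - u\<^sup>2 / 6) + e"
      by (simp add: e_def flip: \<theta>r)
    moreover have "c * r = - \<i> * complex_of_real ((s + t) * x)" by (simp add: c_def x_def)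
    ultimately have "c * q_bracket (cis \<theta>) r = - \<i> * complex_of_real ((s + t) * x) * (1 + \<i> * u / 2 - u\<^sup>2 / 6) + c * e"
      by (simp add: distrib_left flip: mult.assoc)
    then show ?thesis
      unfolding lf_def linear_factor_def cis_power_int \<theta>r
      by (simp add: T1_def c_def u_def algebra_simps power2_eq_square add_divide_distrib diff_divide_distrib)
  qed
  also have "norm \<dots> \<le> B ^ 3 * \<delta> ^ 3 + (\<bar>(s + t) * x * u\<^sup>2 / 6\<bar> + \<bar>(s + t) * \<epsilon>\<bar> * norm e)"
    by (intro order_trans[OF norm_triangle_ineq] add_mono A3 order_trans[OF norm_triangle_ineq4]) (simp_all only: nI order_refl)
  also have "\<bar>(s + t) * x * u\<^sup>2 / 6\<bar> \<le> B ^ 3 * \<delta> ^ 3"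
  proof -
    have "\<bar>s + t\<bar> * \<bar>x\<bar> * u\<^sup>2 \<le> (2 * B) * \<delta> * (B\<^sup>2 * \<delta>\<^sup>2)"
      using st xd u2 B \<delta> by (intro mult_mono) auto
    also have "\<dots> = 2 * (B ^ 3 * \<delta> ^ 3)" by (simp add: power2_eq_square power3_eq_cube)
    finally show ?thesis using BD by (simp add: abs_mult)
  qed
  also have "\<bar>(s + t) * \<epsilon>\<bar> * norm e \<le> 8 * (B ^ 3 * \<delta> ^ 3)"
  proof -
    have "\<bar>(s + t) * \<epsilon>\<bar> * norm e \<le> \<bar>(s + t) * \<epsilon>\<bar> * (\<bar>r\<bar> * (\<bar>u\<bar> ^ 3 + 3 * \<bar>\<theta>\<bar>))"
      by (intro mult_left_mono e) simp
    also have "\<dots> = \<bar>s + t\<bar> * \<bar>x\<bar> * (\<bar>u\<bar> ^ 3 + 3 * \<bar>\<theta>\<bar>)" by (simp add: x_def abs_mult)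
    also have "\<dots> \<le> (2 * B) * \<delta> * (4 * (B\<^sup>2 * \<delta>\<^sup>2))"
    proof (intro mult_mono)
      have "B * \<delta> ^ 3 \<le> B\<^sup>2 * \<delta>\<^sup>2" using B2 d32 B \<delta> by (intro mult_mono) auto
      then show "\<bar>u\<bar> ^ 3 + 3 * \<bar>\<theta>\<bar> \<le> 4 * (B\<^sup>2 * \<delta>\<^sup>2)" using u32 \<theta>b by linarith
    qed (use st xd B \<delta> in auto)
    also have "\<dots> = 8 * (B ^ 3 * \<delta> ^ 3)" by (simp add: power2_eq_square power3_eq_cube)
    finally show ?thesis .
  qed
  finally have A4: "norm (lf - T1) \<le> 10 * (B ^ 3 * \<delta> ^ 3)" by simp
  have "norm (lf - exp z) \<le> norm (lf - T1) + (norm (exp z - (1 + z + z\<^sup>2 / 2)) + norm (1 + z + z\<^sup>2 / 2 - T1))"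
  proof -
    have "lf - exp z = (lf - T1) - ((exp z - (1 + z + z\<^sup>2 / 2)) + (1 + z + z\<^sup>2 / 2 - T1))" by simp
    then show ?thesis by (metis norm_triangle_ineq4 norm_triangle_ineq order_trans add_left_mono)
  qed
  then have "norm (lf - exp z) \<le> 28 * (B ^ 3 * \<delta> ^ 3)" using A1 A2 A4 by linarith
  moreover have "0 \<le> B ^ 3 * \<delta> ^ 3" using B \<delta> by simp
  ultimately have "norm (lf - exp z) \<le> 30 * B ^ 3 * \<delta> ^ 3" by linarith
  moreover have "z = - \<i> * s * (\<epsilon> * r) + s * (s + t) * (\<epsilon> * r)\<^sup>2 / 2"
    by (simp add: z_def p_def x_def)
  ultimately show ?thesis by (simp add: lf_def c_def \<theta>_def)
qed

text \<open>To second order the logarithm of 1 + i u / 2 - u^2 / 6 is i u / 2 - u^2 / 6 + u^2 / 8,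
  which explains the 24.\<close>

lemma norm_q_bracket_quotient_approx:
  fixes j :: nat and t \<epsilon> \<delta> B :: real
  assumes B: "B \<ge> 1" "\<bar>t\<bar> \<le> B" and t: "t * \<epsilon> \<noteq> 0" and j: "j \<ge> 1"
    and x: "\<bar>\<epsilon> * j\<bar> \<le> \<delta>" and \<epsilon>: "0 \<le> \<epsilon>" "\<epsilon> \<le> \<delta> ^ 3" and \<delta>: "2 * B\<^sup>2 * \<delta> \<le> 1" "0 \<le> \<delta>"
  shows "norm (q_bracket (cis (t * \<epsilon>)) (int j) / of_nat j -
      exp (\<i> * (t * \<epsilon> * j) / 2 - (t * \<epsilon> * j)\<^sup>2 / 24)) \<le> 30 * B ^ 3 * \<delta> ^ 3"
proof -
  define \<theta> where "\<theta> = t * \<epsilon>"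
  define u where "u = \<theta> * j"
  have B2: "B \<le> B\<^sup>2" using B by (simp add: self_le_power)
  have B3: "B \<le> B ^ 3" using B by (simp add: self_le_power)
  have Bd: "2 * B * \<delta> \<le> 1" using mult_right_mono[OF B2 \<delta>(2)] \<delta>(1) by simp
  have d1: "\<delta> \<le> 1 / 2" using Bd mult_right_mono[OF B(1) \<delta>(2)] by simp
  have "\<bar>u\<bar> = \<bar>t\<bar> * \<bar>\<epsilon> * j\<bar>" by (simp add: u_def \<theta>_def abs_mult)
  also have "\<dots> \<le> B * \<delta>" using B x by (intro mult_mono) auto
  finally have ux: "\<bar>u\<bar> \<le> B * \<delta>" .
  then have u1: "\<bar>u\<bar> \<le> 1 / 2" using Bd by linarith
  have u3: "\<bar>u\<bar> ^ 3 \<le> B ^ 3 * \<delta> ^ 3" using power_mono[OF ux, of 3] by (simp add: power_mult_distrib)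
  have \<theta>b: "\<bar>\<theta>\<bar> \<le> B ^ 3 * \<delta> ^ 3"
    unfolding \<theta>_def abs_mult using B \<epsilon> B3 by (intro mult_mono) auto
  have "\<bar>\<theta>\<bar> * 1 \<le> \<bar>\<theta>\<bar> * j" using j by (intro mult_left_mono) auto
  then have \<theta>1: "\<bar>\<theta>\<bar> \<le> 1" using u1 by (simp add: u_def abs_mult)
  define X where "X = 1 + \<i> * u / 2 - u\<^sup>2 / 6"
  have "norm (q_bracket (cis \<theta>) (int j) - of_nat j * X) \<le> real j * (\<bar>u\<bar> ^ 3 + 3 * \<bar>\<theta>\<bar>)"
    using q_bracket_approx[of \<theta> "int j"] t \<theta>1 u1 by (simp add: \<theta>_def u_def X_def)
  moreover have "norm (q_bracket (cis \<theta>) (int j) - of_nat j * X) = real j * norm (q_bracket (cis \<theta>) (int j) / of_nat j - X)"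
  proof -
    have "q_bracket (cis \<theta>) (int j) - of_nat j * X = of_nat j * (q_bracket (cis \<theta>) (int j) / of_nat j - X)"
      using j by (simp add: field_simps)
    then show ?thesis by (simp add: norm_mult)
  qed
  ultimately have A1: "norm (q_bracket (cis \<theta>) (int j) / of_nat j - X) \<le> \<bar>u\<bar> ^ 3 + 3 * \<bar>\<theta>\<bar>"
    using j by simp
  define z where "z = \<i> * complex_of_real (u / 2) - complex_of_real (u\<^sup>2 / 24)"
  have u2: "u\<^sup>2 \<le> \<bar>u\<bar>" using u1 mult_left_le[of "\<bar>u\<bar>" "\<bar>u\<bar>"] by (simp add: power2_eq_square abs_mult_self_eq)
  have "norm z \<le> \<bar>u\<bar> / 2 + u\<^sup>2 / 24"
    unfolding z_def by (rule order_trans[OF norm_triangle_ineq4]) (simp add: norm_mult norm_power)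
  then have nz: "norm z \<le> \<bar>u\<bar>" using u2 by linarith
  have "norm (exp z - (1 + z + z\<^sup>2 / 2)) \<le> 2 * norm z ^ 3"
    using nz u1 by (intro norm_exp_minus_quadratic) simp
  also have "\<dots> \<le> 2 * \<bar>u\<bar> ^ 3" using nz by (intro mult_left_mono power_mono) auto
  finally have A2: "norm (exp z - (1 + z + z\<^sup>2 / 2)) \<le> 2 * \<bar>u\<bar> ^ 3" .
  have "1 + z + z\<^sup>2 / 2 - X = - \<i> * complex_of_real (u ^ 3 / 48) + complex_of_real (u ^ 4 / 1152)"
    unfolding z_def X_def by (simp add: power2_eq_square eval_nat_numeral field_simps)
  also have "norm \<dots> \<le> \<bar>u\<bar> ^ 3 / 48 + u ^ 4 / 1152"
    by (rule order_trans[OF norm_triangle_ineq]) (simp add: norm_mult norm_power power_even_abs)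
  also have "u ^ 4 = \<bar>u\<bar> ^ 4" by (simp add: power_even_abs)
  also have "\<bar>u\<bar> ^ 4 \<le> \<bar>u\<bar> ^ 3" using u1 by (intro power_decreasing) auto
  finally have A3: "norm (1 + z + z\<^sup>2 / 2 - X) \<le> \<bar>u\<bar> ^ 3" using zero_le_power_abs[of u 3] by linarith
  have "norm (q_bracket (cis \<theta>) (int j) / of_nat j - exp z) \<le> norm (q_bracket (cis \<theta>) (int j) / of_nat j - X) +
     (norm (exp z - (1 + z + z\<^sup>2 / 2)) + norm (1 + z + z\<^sup>2 / 2 - X))"
  proof -
    have "q_bracket (cis \<theta>) (int j) / of_nat j - exp z = (q_bracket (cis \<theta>) (int j) / of_nat j - X) -
        ((exp z - (1 + z + z\<^sup>2 / 2)) + (1 + z + z\<^sup>2 / 2 - X))" by simp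
    then show ?thesis by (metis norm_triangle_ineq4 norm_triangle_ineq order_trans add_left_mono)
  qed
  also have "\<dots> \<le> 30 * (B ^ 3 * \<delta> ^ 3)" using A1 A2 A3 u3 \<theta>b zero_le_power_abs[of u 3] by linarith
  also have "z = \<i> * (t * \<epsilon> * j) / 2 - (t * \<epsilon> * j)\<^sup>2 / 24"
    by (simp add: z_def u_def \<theta>_def)
  finally show ?thesis by (simp add: \<theta>_def mult.assoc)
qed

text \<open>Factors are exchanged one at a time. Bounding a factor by \<open>exp K\<close> keeps
  partial products bounded as long as \<open>card J * K\<close> is bounded.\<close>

lemma norm_prod_diff_le:
  fixes a b :: "'i \<Rightarrow> complex" and K D :: real
  assumes "finite J" and K: "0 \<le> K" "0 \<le> D"
    and "\<And>j. j \<in> J \<Longrightarrow> norm (a j - b j) \<le> D" "\<And>j. j \<in> J \<Longrightarrow> norm (b j) \<le> exp K"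
  shows "norm (prod a J - prod b J) \<le> card J * D * exp (card J * (K + D))"
  using assms(1,4,5)
proof (induction J rule: finite_induct)
  case (insert x J)
  define c where "c = card J"
  have IH: "norm (prod a J - prod b J) \<le> c * D * exp (c * (K + D))"
    using insert by (simp add: c_def)
  have bJ: "norm (prod b J) \<le> exp (c * (K + D))"
  proof -
    have "norm (prod b J) \<le> (\<Prod>j\<in>J. exp K)"
      unfolding prod_norm[symmetric] using insert.prems by (intro prod_mono) auto
    also have "\<dots> = exp (c * K)" by (simp add: c_def exp_of_nat_mult)
    also have "\<dots> \<le> exp (c * (K + D))" using K by (simp add: mult_left_mono)
    finally show ?thesis .
  qed
  have "norm (a x) \<le> norm (b x) + norm (a x - b x)" using norm_triangle_ineq[of "b x" "a x - b x"] by simp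
  also have "\<dots> \<le> exp K + D" using insert.prems by (intro add_mono) auto
  also have "\<dots> \<le> exp K * (1 + D)"
    using mult_right_mono[of 1 "exp K" D] K by (simp add: algebra_simps)
  also have "\<dots> \<le> exp K * exp D" using exp_ge_add_one_self[of D] by (intro mult_left_mono) auto
  finally have ax: "norm (a x) \<le> exp (K + D)" by (simp add: exp_add)
  have "prod a (insert x J) - prod b (insert x J) = a x * (prod a J - prod b J) + (a x - b x) * prod b J"
    using insert by (simp add: algebra_simps)
  also have "norm \<dots> \<le> norm (a x) * norm (prod a J - prod b J) + norm (a x - b x) * norm (prod b J)"
    unfolding norm_mult[symmetric] by (rule norm_triangle_ineq)
  also have "\<dots> \<le> exp (K + D) * (c * D * exp (c * (K + D))) + D * exp (c * (K + D))"
    using ax IH bJ insert.prems K by (intro add_mono mult_mono) auto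
  also have "D * exp (c * (K + D)) \<le> exp (K + D) * (D * exp (c * (K + D)))"
    using mult_right_mono[of 1 "exp (K + D)" "D * exp (c * (K + D))"] K by simp
  also have "exp (K + D) * (c * D * exp (c * (K + D))) + exp (K + D) * (D * exp (c * (K + D))) =
      Suc c * D * exp (Suc c * (K + D))"
    by (simp add: algebra_simps exp_add)
  finally show ?case using insert by (simp add: c_def)
qed simp

text \<open>The numerator is (q - 1) times a sum of norm at most d y^(d - 1), and the denominator
  has norm at least d |\<theta>| / 2, because n |\<theta>| \<le> 1 keeps the angle of
  \<open>q ^ d\<close> small. The remaining factor 2 is absorbed by y k \<le> 1/2, except for d = 1,
  where the power sum is exactly 1.\<close>

lemma power_sum_bound:
  assumes \<theta>: "\<theta> \<noteq> 0" "n * \<bar>\<theta>\<bar> \<le> 1" and n: "n \<ge> 1"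
    and y: "norm c \<le> y" "norm (c + cis \<theta> - 1) \<le> y" "y * real k \<le> 1 / 2" and d: "1 \<le> d" "d \<le> n"
  shows "norm (power_sum (cis \<theta>) c d) * real k ^ (d - 1) \<le> 1"
proof -
  have \<theta>1: "\<bar>\<theta>\<bar> \<le> 1"
    using \<theta>(2) n mult_right_mono[of 1 "real n" "\<bar>\<theta>\<bar>"] by simp
  have q1: "cis \<theta> - 1 \<noteq> 0" using norm_cis_minus_1_ge[OF \<theta>1] \<theta>(1) by auto
  have y0: "y \<ge> 0" using y(1) norm_ge_zero order_trans by blast
  show ?thesis
  proof (cases "d = 1")
    case True
    then show ?thesis using q1 by (simp add: power_sum_def)
  next
    case False
    then obtain e where e: "d = Suc (Suc e)" using d by (metis One_nat_def Suc_le_D not0_implies_Suc le_zero_eq nat.simps(3))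
    define S where "S = (\<Sum>p<d. (c + cis \<theta> - 1) ^ p * c ^ (d - 1 - p))"
    have "(c + cis \<theta> - 1) ^ d - c ^ d = (cis \<theta> - 1) * S"
      unfolding S_def e using diff_power_eq_sum[of "c + cis \<theta> - 1" "Suc e" c] by simp
    then have "power_sum (cis \<theta>) c d = (cis \<theta> - 1) * S / (cis (d * \<theta>) - 1)"
      by (simp add: power_sum_def Complex.DeMoivre)
    also have "norm \<dots> \<le> \<bar>\<theta>\<bar> * (d * y ^ (d - 1)) / (\<bar>d * \<theta>\<bar> / 2)"
      unfolding norm_divide norm_mult
    proof (intro frac_le mult_mono norm_cis_minus_1_le norm_cis_minus_1_ge)
      have "norm S \<le> (\<Sum>p<d. y ^ (d - 1))"
        unfolding S_def
      proof (rule sum_norm_le)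
        fix p assume "p \<in> {..<d}"
        then have "norm ((c + cis \<theta> - 1) ^ p * c ^ (d - 1 - p)) \<le> y ^ p * y ^ (d - 1 - p)"
          unfolding norm_mult norm_power using y y0 by (intro mult_mono power_mono) auto
        also have "\<dots> = y ^ (d - 1)" using \<open>p \<in> _\<close> by (simp flip: power_add)
        finally show "norm ((c + cis \<theta> - 1) ^ p * c ^ (d - 1 - p)) \<le> y ^ (d - 1)" .
      qed
      then show "norm S \<le> d * y ^ (d - 1)" by simp
      have "\<bar>d * \<theta>\<bar> \<le> n * \<bar>\<theta>\<bar>" using d by (simp add: abs_mult mult_right_mono)
      then show "\<bar>d * \<theta>\<bar> \<le> 1" using \<theta> by linarith
    qed (use \<theta> d y0 in auto)
    also have "\<dots> = 2 * y ^ (d - 1)" using \<theta> d by (simp add: abs_mult)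
    finally have "norm (power_sum (cis \<theta>) c d) * real k ^ (d - 1) \<le> 2 * y ^ (d - 1) * real k ^ (d - 1)"
      by (rule mult_right_mono) simp
    also have "\<dots> = 2 * ((y * k) * (y * k) ^ e)" by (simp add: e power_mult_distrib mult_ac)
    also have "\<dots> \<le> 2 * (1 / 2 * 1)"
      using y y0 by (intro mult_left_mono mult_mono power_le_one) auto
    finally show ?thesis by simp
  qed
qed

section \<open>The product formula at scale n^(-3/2)\<close>

definition average :: "'a set \<Rightarrow> ('a \<Rightarrow> 'b) \<Rightarrow> 'b::real_normed_field" where
  "average A h = (\<Sum>\<pi>\<in>A. h \<pi>) / of_nat (card A)"

lemma norm_average_le:
  assumes "finite A" "A \<noteq> {}" "\<And>\<pi>. \<pi> \<in> A \<Longrightarrow> norm (h \<pi>) \<le> C"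
  shows "norm (average A h) \<le> C"
proof -
  have c: "card A > 0" using assms by (simp add: card_gt_0_iff)
  have "norm (average A h) \<le> (\<Sum>\<pi>\<in>A. C) / card A"
    unfolding average_def norm_divide norm_of_nat
    by (intro divide_right_mono sum_norm_le assms) auto
  also have "\<dots> = C" using c by simp
  finally show ?thesis .
qed

lemma average_diff: "average A (\<lambda>\<pi>. g \<pi> - h \<pi>) = average A g - average A h"
  by (simp add: average_def sum_subtractf diff_divide_distrib)

lemma average_mult_left: "average A (\<lambda>\<pi>. a * h \<pi>) = a * average A h"
  by (simp add: average_def sum_distrib_left)

text \<open>\<open>\<eta>\<close> bounds the error of replacing one product by exponentials, and
  \<open>G\<close> the size of such a product. The last term is the bound for \<open>T - 1\<close>,
  with 12 B \<delta> standing for n / k.\<close>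

definition approx_error :: "real \<Rightarrow> real \<Rightarrow> real" where
  "approx_error B \<delta> = (let \<eta> = 30 * B ^ 3 * \<delta> * exp (16 * B\<^sup>2); G = exp (16 * B\<^sup>2)
     in \<eta> + 2 * \<eta> * G + G\<^sup>2 * (exp (12 * B * \<delta> + 144 * B\<^sup>2 * \<delta>\<^sup>2) - 1))"

lemma approx_error_tendsto_0:
  assumes "\<delta> \<longlonglongrightarrow> 0"
  shows "(\<lambda>n. approx_error B (\<delta> n)) \<longlonglongrightarrow> 0"
proof -
  have "(\<lambda>n. approx_error B (\<delta> n)) \<longlonglongrightarrow> approx_error B 0"
    unfolding approx_error_def Let_def by (intro tendsto_intros assms)
  then show ?thesis by (simp add: approx_error_def)
qed

text \<open>The logarithm of \<open>linear_factor\<close> to second order in x = \<epsilon> r, at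
  the chosen \<open>q\<close> and \<open>c\<close>.\<close>

definition exponent :: "real \<Rightarrow> real \<Rightarrow> real \<Rightarrow> complex" where
  "exponent s t x = - \<i> * s * x + s * (s + t) * x\<^sup>2 / 2"

lemma norm_exp_exponent_le:
  assumes "B \<ge> 1" "\<bar>s\<bar> \<le> B" "\<bar>t\<bar> \<le> B" "\<bar>x\<bar> \<le> \<delta>"
  shows "norm (exp (exponent s t x)) \<le> exp (B\<^sup>2 * \<delta>\<^sup>2)"
proof -
  have "s * (s + t) * x\<^sup>2 \<le> \<bar>s\<bar> * \<bar>s + t\<bar> * \<bar>x\<bar>\<^sup>2"
    using abs_ge_self[of "s * (s + t) * x\<^sup>2"] by (simp add: abs_mult)
  also have "\<dots> \<le> B * (2 * B) * \<delta>\<^sup>2" using assms by (intro mult_mono power_mono) auto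
  finally show ?thesis by (simp add: exponent_def power2_eq_square)
qed

lemma average_asymptotics:
  fixes A :: "(nat \<Rightarrow> nat) set" and B s t \<delta> :: real
  assumes n: "n \<ge> 1" and A: "A \<subseteq> {\<pi>. \<pi> permutes {1..n}}" "A \<noteq> {}" and conj: "conj_invariant n A"
    and m: "\<And>\<pi>. \<pi> \<in> A \<Longrightarrow> num_fixed_points n \<pi> = m"
    and B: "B \<ge> 2" "\<bar>s\<bar> \<le> B" "\<bar>t\<bar> \<le> B" and \<delta>: "\<delta> > 0" "n * \<delta>\<^sup>2 = 1" "2 * B\<^sup>2 * \<delta> \<le> 1"
    and t: "\<And>j. j \<ge> 1 \<Longrightarrow> cis (t * \<delta> ^ 3) ^ j \<noteq> 1"
  shows "norm (average A (\<lambda>\<pi>. cis (t * \<delta> ^ 3) ^ maj n \<pi> *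
        exp (\<Sum>j\<in>{1..n}. exponent s t (\<delta> ^ 3 * of_int (int j - int (desc n \<pi>))))) -
      exp (\<Sum>j\<in>{m<..n}. \<i> * (t * \<delta> ^ 3 * real j) / 2 - (t * \<delta> ^ 3 * real j)\<^sup>2 / 24) *
      exp (\<Sum>j\<in>{1..m}. exponent s t (\<delta> ^ 3 * of_int (int j - 1)))) \<le> approx_error B \<delta>"
proof -
  define \<epsilon> where "\<epsilon> = \<delta> ^ 3"
  define q where "q = cis (t * \<epsilon>)"
  define c where "c = - \<i> * (s + t) * \<epsilon>"
  define G where "G = exp (16 * B\<^sup>2)"
  define D where "D = 30 * B ^ 3 * \<delta> ^ 3"
  define K where "K = B\<^sup>2 * \<delta>\<^sup>2"
  define \<eta> where "\<eta> = 30 * B ^ 3 * \<delta> * G"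
  \<comment> \<open>Both \<open>c\<close> and \<open>c + q - 1\<close> have norm at most 3 B
    \<epsilon>, and \<open>power_sum_bound\<close> wants this times \<open>k\<close> to be at most
    1/2. The alphabet is taken as large as that permits, since the bound on \<open>T - 1\<close>
    decreases in \<open>k\<close>.\<close>
  define k where "k = nat \<lfloor>1 / (6 * B * \<epsilon>)\<rfloor>"
  have B1: "B \<ge> 1" using B by simp
  have finA: "finite A" using A(1) finite_permutations[of "{1..n}"] finite_subset by blast
  have \<epsilon>: "\<epsilon> > 0" using \<delta> by (simp add: \<epsilon>_def)
  have n\<epsilon>: "n * \<epsilon> = \<delta>" using \<delta> by (simp add: \<epsilon>_def power3_eq_cube power2_eq_square mult.assoc[symmetric])
  have B2: "B \<le> B\<^sup>2" using B by (simp add: self_le_power)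
  have Bd: "2 * B * \<delta> \<le> 1" using mult_right_mono[OF B2, of \<delta>] \<delta> unfolding mult.assoc by linarith
  have qj: "q ^ j \<noteq> 1" if "j \<ge> 1" for j using t[OF that] by (simp add: q_def \<epsilon>_def)
  have t0: "t * \<epsilon> \<noteq> 0" using qj[of 1] by (auto simp: q_def)
  \<comment> \<open>\<open>n * K\<close> is B^2 and \<open>n * D\<close> is at most 15 B^2, hence
    the 16 in \<open>G\<close>.\<close>
  have nKD: "n * (K + D) \<le> 16 * B\<^sup>2"
  proof -
    have "n * D = 30 * B\<^sup>2 * (B * \<delta>) * (n * \<delta>\<^sup>2)" by (simp add: D_def power3_eq_cube power2_eq_square)
    also have "\<dots> \<le> 30 * B\<^sup>2 * (1 / 2)" unfolding \<delta>(2) mult_1_right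
      using Bd by (intro mult_left_mono) auto
    finally have "n * D \<le> 15 * B\<^sup>2" by simp
    moreover have "n * K = B\<^sup>2" using \<delta>(2) by (simp add: K_def mult.left_commute)
    ultimately show ?thesis by (simp add: distrib_left)
  qed
  have KD: "0 \<le> K" "0 \<le> D" using B \<delta> by (auto simp: K_def D_def)
  have nD: "n * D = 30 * B ^ 3 * \<delta>" using \<delta>(2) by (simp add: D_def power3_eq_cube power2_eq_square)
  have cardKD: "x * (K + D) \<le> 16 * B\<^sup>2" if "x \<le> n" for x :: nat
    using that nKD mult_right_mono[of "real x" "real n" "K + D"] KD by simp
  have prod_diff: "norm (prod a J - prod b J) \<le> \<eta> \<and> norm (prod b J) \<le> G \<and> norm (prod a J) \<le> G"
    if "finite J" "card J \<le> n" "\<And>j. j \<in> J \<Longrightarrow> norm (a j - b j) \<le> D" "\<And>j. j \<in> J \<Longrightarrow> norm (b j) \<le> exp K"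
    for J :: "nat set" and a b :: "nat \<Rightarrow> complex"
  proof -
    have "norm (prod a J - prod b J) \<le> card J * D * exp (card J * (K + D))"
      by (rule norm_prod_diff_le[OF that(1) KD that(3,4)])
    also have "\<dots> \<le> (n * D) * G" unfolding G_def
      using that(2) KD cardKD[OF that(2)] by (intro mult_mono) (auto simp: mult_right_mono)
    finally have 1: "norm (prod a J - prod b J) \<le> \<eta>" by (simp add: nD \<eta>_def)
    have pow: "norm (prod f J) \<le> G" if "\<And>j. j \<in> J \<Longrightarrow> norm (f j) \<le> exp (K + D)" for f :: "nat \<Rightarrow> complex"
    proof -
      have "norm (prod f J) \<le> (\<Prod>j\<in>J. exp (K + D))"
        unfolding prod_norm[symmetric] using that by (intro prod_mono) auto
      also have "\<dots> = exp (card J * (K + D))" by (simp add: exp_of_nat_mult)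
      also have "\<dots> \<le> G" using cardKD[OF \<open>card J \<le> n\<close>] by (simp add: G_def)
      finally show ?thesis .
    qed
    have "norm (prod b J) \<le> G"
    proof (rule pow)
      fix j assume "j \<in> J"
      have "exp K \<le> exp (K + D)" using KD by simp
      then show "norm (b j) \<le> exp (K + D)" using that(4)[OF \<open>j \<in> J\<close>] by linarith
    qed
    moreover have "norm (prod a J) \<le> G"
    proof (rule pow)
      fix j assume j: "j \<in> J"
      have "norm (a j) \<le> norm (b j) + norm (a j - b j)" using norm_triangle_ineq[of "b j" "a j - b j"] by simp
      also have "\<dots> \<le> exp K + D" using that(3,4)[OF j] by linarith
      also have "\<dots> \<le> exp K * (1 + D)" using mult_right_mono[of 1 "exp K" D] KD by (simp add: algebra_simps)
      also have "\<dots> \<le> exp K * exp D" using exp_ge_add_one_self[of D] by (intro mult_left_mono) auto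
      finally show "norm (a j) \<le> exp (K + D)" by (simp add: exp_add)
    qed
    ultimately show ?thesis using 1 by blast
  qed
  have lf: "norm (linear_factor q c r - exp (exponent s t (\<epsilon> * r))) \<le> D \<and> norm (exp (exponent s t (\<epsilon> * r))) \<le> exp K"
    if "\<bar>r\<bar> \<le> n" for r :: int
  proof -
    have "\<bar>real_of_int r\<bar> \<le> n" using that by linarith
    then have "\<epsilon> * \<bar>real_of_int r\<bar> \<le> \<epsilon> * n" using \<epsilon> by (intro mult_left_mono) auto
    also have "\<epsilon> * n = \<delta>" using n\<epsilon> by (simp add: mult.commute)
    finally have x: "\<bar>\<epsilon> * r\<bar> \<le> \<delta>" using \<epsilon> by (simp add: abs_mult)
    show ?thesis
      using norm_linear_factor_approx[OF B1 B(2,3) t0 x] norm_exp_exponent_le[OF B1 B(2,3) x] \<delta>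
      unfolding D_def K_def q_def c_def exponent_def \<epsilon>_def by auto
  qed
  have br: "norm (q_bracket q (int j) / of_nat j - exp (\<i> * (t * \<epsilon> * j) / 2 - (t * \<epsilon> * j)\<^sup>2 / 24)) \<le> D \<and>
      norm (exp (\<i> * (t * \<epsilon> * j) / 2 - (t * \<epsilon> * j)\<^sup>2 / 24)) \<le> exp K" if "1 \<le> j" "j \<le> n" for j :: nat
  proof -
    have "\<epsilon> * j \<le> \<epsilon> * n" using that \<epsilon> by (intro mult_left_mono) auto
    also have "\<epsilon> * n = \<delta>" using n\<epsilon> by (simp add: mult.commute)
    finally have x: "\<bar>\<epsilon> * j\<bar> \<le> \<delta>" using \<epsilon> by (simp add: abs_mult)
    have "norm (exp (\<i> * (t * \<epsilon> * j) / 2 - (t * \<epsilon> * j)\<^sup>2 / 24)) \<le> exp 0" by simp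
    also have "exp 0 \<le> exp K" using KD by simp
    finally show ?thesis
      using norm_q_bracket_quotient_approx[OF B1 B(3) t0 that(1) x] \<epsilon> \<delta>
      unfolding D_def q_def by (simp add: \<epsilon>_def)
  qed
  \<comment> \<open>\<open>B \<ge> 2\<close> and \<open>2 * B\<^sup>2 * \<delta> \<le> 1\<close>
    make 1 / (6 B \<epsilon>) at least 2, so rounding down loses at most half of it.\<close>
  have k: "k \<ge> 1" "n / k \<le> 12 * B * \<delta>" "real k \<le> 1 / (6 * B * \<epsilon>)"
  proof -
    have "\<delta> ^ 3 \<le> (1 / (2 * B\<^sup>2)) ^ 3" using \<delta> B by (intro power_mono) (auto simp: field_simps)
    also have "\<dots> = 1 / (8 * B ^ 6)" by (simp add: power_divide power_mult_distrib flip: power_mult)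
    finally have "12 * B * \<epsilon> \<le> 12 * B / (8 * B ^ 6)" unfolding \<epsilon>_def using B by (simp add: field_simps)
    also have "\<dots> = 12 / (8 * B ^ 5)" using B by (simp add: eval_nat_numeral)
    also have "\<dots> \<le> 12 / (8 * 2 ^ 5)" using power_mono[OF B(1), of 5] B by (intro divide_left_mono) auto
    finally have small: "12 * B * \<epsilon> \<le> 1" by simp
    have pos: "6 * B * \<epsilon> > 0" using B \<epsilon> by simp
    define v where "v = 1 / (6 * B * \<epsilon>)"
    have v: "v \<ge> 2" unfolding v_def using small pos by (simp add: field_simps)
    have kv: "real k \<le> v" "v - 1 \<le> real k" using v by (auto simp: k_def v_def[symmetric])
    show "k \<ge> 1" using kv v by linarith
    show "real k \<le> 1 / (6 * B * \<epsilon>)" using kv by (simp add: v_def)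
    have kv2: "v / 2 \<le> real k" using kv v by linarith
    have "n / k \<le> n / (v / 2)" using kv2 v by (intro divide_left_mono) auto
    also have "\<dots> = 12 * B * (n * \<epsilon>)" using pos by (simp add: v_def field_simps)
    finally show "n / k \<le> 12 * B * \<delta>" by (simp add: n\<epsilon>)
  qed
  have R: "norm (power_sum q c d) * real k ^ (d - 1) \<le> 1" if "1 \<le> d" "d \<le> n" for d
    unfolding q_def
  proof (rule power_sum_bound[where y = "3 * B * \<epsilon>" and n = n])
    have tB: "\<bar>t * \<epsilon>\<bar> \<le> B * \<epsilon>" using B \<epsilon> by (simp add: abs_mult mult_right_mono)
    have "n * \<bar>t * \<epsilon>\<bar> \<le> n * (B * \<epsilon>)" using tB by (intro mult_left_mono) auto
    also have "\<dots> = B * \<delta>" using n\<epsilon> by (simp add: mult.left_commute)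
    also have "\<dots> \<le> 1" using Bd B \<delta> by simp
    finally show "n * \<bar>t * \<epsilon>\<bar> \<le> 1" .
    have "norm c = \<bar>s + t\<bar> * \<epsilon>" unfolding c_def using \<epsilon> by (simp add: norm_mult flip: of_real_add)
    also have "\<dots> \<le> 2 * B * \<epsilon>" using B \<epsilon> by (intro mult_right_mono) auto
    finally have c: "norm c \<le> 2 * B * \<epsilon>" .
    have BE: "0 \<le> B * \<epsilon>" using B \<epsilon> by simp
    then show "norm c \<le> 3 * B * \<epsilon>" using c by linarith
    have "norm (c + cis (t * \<epsilon>) - 1) \<le> norm c + norm (cis (t * \<epsilon>) - 1)"
      using norm_triangle_ineq[of c "cis (t * \<epsilon>) - 1"] by (simp add: algebra_simps)
    then show "norm (c + cis (t * \<epsilon>) - 1) \<le> 3 * B * \<epsilon>"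
      using c norm_cis_minus_1_le[of "t * \<epsilon>"] tB by linarith
    show "3 * B * \<epsilon> * real k \<le> 1 / 2" using k(3) B \<epsilon> by (simp add: field_simps)
  qed (use t0 n that in auto)
  obtain T where T: "norm (T - 1) \<le> exp (n * (1 / k + n / (real k)\<^sup>2)) - 1"
    "(\<Sum>\<pi>\<in>A. q ^ maj n \<pi> * (\<Prod>j\<in>{1..n}. linear_factor q c (int j - int (desc n \<pi>)))) / of_nat (card A) =
     (\<Prod>j\<in>{m<..n}. q_bracket q (int j) / of_nat j) * (\<Prod>j\<in>{1..m}. linear_factor q c (int j - 1)) * T"
  proof (rule average_estimate[OF A conj m _ qj k(1) R])
    show "q \<noteq> 0" by (simp add: q_def)
  qed
  have mn: "m \<le> n"
  proof -
    obtain \<pi> where "\<pi> \<in> A" using A(2) by blast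
    have "num_fixed_points n \<pi> \<le> card {1..n}" unfolding num_fixed_points_def by (rule card_mono) auto
    then show ?thesis using m[OF \<open>\<pi> \<in> A\<close>] by simp
  qed
  have T1: "norm (T - 1) \<le> exp (12 * B * \<delta> + 144 * B\<^sup>2 * \<delta>\<^sup>2) - 1"
  proof -
    have "n * (1 / k + n / (real k)\<^sup>2) = n / k + (n / k)\<^sup>2" by (simp add: power2_eq_square algebra_simps)
    also have "\<dots> \<le> 12 * B * \<delta> + (12 * B * \<delta>)\<^sup>2" using k(2) by (intro add_mono power_mono) auto
    also have "\<dots> = 12 * B * \<delta> + 144 * B\<^sup>2 * \<delta>\<^sup>2" by (simp add: power_mult_distrib)
    finally show ?thesis using T(1) by (meson diff_right_mono exp_le_cancel_iff order_trans)
  qed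
  define a where "a \<pi> = (\<Prod>j\<in>{1..n}. linear_factor q c (int j - int (desc n \<pi>)))" for \<pi>
  define b where "b \<pi> = (\<Prod>j\<in>{1..n}. exp (exponent s t (\<epsilon> * of_int (int j - int (desc n \<pi>)))))" for \<pi>
  define P1 where "P1 = (\<Prod>j\<in>{m<..n}. q_bracket q (int j) / of_nat j)"
  define P1' where "P1' = (\<Prod>j\<in>{m<..n}. exp (\<i> * (t * \<epsilon> * real j) / 2 - (t * \<epsilon> * real j)\<^sup>2 / 24))"
  define P2 where "P2 = (\<Prod>j\<in>{1..m}. linear_factor q c (int j - 1))"
  define P2' where "P2' = (\<Prod>j\<in>{1..m}. exp (exponent s t (\<epsilon> * of_int (int j - 1))))"
  have ab: "norm (a \<pi> - b \<pi>) \<le> \<eta>" for \<pi>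
  proof -
    have "card (descents n \<pi>) \<le> card {1..<n}" unfolding descents_def by (rule card_mono) auto
    then have d: "1 \<le> desc n \<pi>" "desc n \<pi> \<le> n" using n by (auto simp: desc_def)
    have "\<bar>int j - int (desc n \<pi>)\<bar> \<le> int n" if "j \<in> {1..n}" for j using d that by auto
    note bd = this
    show ?thesis unfolding a_def b_def
    proof (rule prod_diff[THEN conjunct1])
      fix j assume "j \<in> {1..n}"
      from lf[OF bd[OF this]]
      show "norm (linear_factor q c (int j - int (desc n \<pi>)) - exp (exponent s t (\<epsilon> * of_int (int j - int (desc n \<pi>))))) \<le> D"
        "norm (exp (exponent s t (\<epsilon> * of_int (int j - int (desc n \<pi>))))) \<le> exp K" by blast+
    qed simp_all
  qed
  have P1: "norm (P1 - P1') \<le> \<eta>" "norm P1' \<le> G" "norm P1 \<le> G"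
    unfolding P1_def P1'_def
    using prod_diff[of "{m<..n}" "\<lambda>j. q_bracket q (int j) / of_nat j"
        "\<lambda>j. exp (\<i> * (t * \<epsilon> * real j) / 2 - (t * \<epsilon> * real j)\<^sup>2 / 24)"] br mn by auto
  have P2: "norm (P2 - P2') \<le> \<eta>" "norm P2' \<le> G" "norm P2 \<le> G"
    unfolding P2_def P2'_def
    using prod_diff[of "{1..m}" "\<lambda>j. linear_factor q c (int j - 1)"
        "\<lambda>j. exp (exponent s t (\<epsilon> * of_int (int j - 1)))"] lf[of "int j - 1" for j] mn by auto
  have G0: "G > 0" "\<eta> \<ge> 0" using B \<delta> by (auto simp: G_def \<eta>_def)
  have avg: "average A (\<lambda>\<pi>. q ^ maj n \<pi> * a \<pi>) = P1 * P2 * T"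
    unfolding average_def a_def P1_def P2_def by (rule T(2))
  have "norm (average A (\<lambda>\<pi>. q ^ maj n \<pi> * b \<pi>) - average A (\<lambda>\<pi>. q ^ maj n \<pi> * a \<pi>)) \<le> \<eta>"
    unfolding average_diff[symmetric]
  proof (rule norm_average_le[OF finA A(2)])
    fix \<pi>
    have "norm (q ^ maj n \<pi> * b \<pi> - q ^ maj n \<pi> * a \<pi>) = norm (a \<pi> - b \<pi>)"
      unfolding right_diff_distrib[symmetric] by (simp add: norm_mult norm_power q_def norm_minus_commute)
    then show "norm (q ^ maj n \<pi> * b \<pi> - q ^ maj n \<pi> * a \<pi>) \<le> \<eta>" using ab by simp
  qed
  moreover have "norm (P1 * P2 * T - P1' * P2') \<le> G\<^sup>2 * norm (T - 1) + 2 * \<eta> * G"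
  proof -
    have "P1 * P2 * T - P1' * P2' = P1 * P2 * (T - 1) + ((P1 - P1') * P2 + P1' * (P2 - P2'))"
      by (simp add: algebra_simps)
    also have "norm \<dots> \<le> norm (P1 * P2 * (T - 1)) + (norm ((P1 - P1') * P2) + norm (P1' * (P2 - P2')))"
      by (intro order_trans[OF norm_triangle_ineq] add_left_mono norm_triangle_ineq)
    also have "\<dots> \<le> G * G * norm (T - 1) + (\<eta> * G + G * \<eta>)"
      unfolding norm_mult using P1 P2 G0 by (intro add_mono mult_mono) auto
    finally show ?thesis by (simp add: power2_eq_square algebra_simps)
  qed
  moreover have "G\<^sup>2 * norm (T - 1) \<le> G\<^sup>2 * (exp (12 * B * \<delta> + 144 * B\<^sup>2 * \<delta>\<^sup>2) - 1)"
    using T1 by (intro mult_left_mono) auto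
  ultimately have "norm (average A (\<lambda>\<pi>. q ^ maj n \<pi> * b \<pi>) - P1' * P2') \<le> approx_error B \<delta>"
    using norm_triangle_ineq[of "average A (\<lambda>\<pi>. q ^ maj n \<pi> * b \<pi>) - average A (\<lambda>\<pi>. q ^ maj n \<pi> * a \<pi>)"
        "P1 * P2 * T - P1' * P2'"]
    unfolding avg approx_error_def Let_def G_def[symmetric] \<eta>_def[symmetric] by simp
  then show ?thesis
    unfolding b_def P1'_def P2'_def q_def \<epsilon>_def by (simp only: exp_sum finite_atLeastAtMost finite_greaterThanAtMost)
qed

section \<open>Closed forms of the exponents and the centering\<close>

lemma sum_exponent:
  "(\<Sum>j\<in>{1..n}. exponent s t (e * of_int (int j - int d))) =
    - \<i> * complex_of_real (s * e * (real n * (real n + 1) / 2 - real n * real d)) +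
    complex_of_real (s * (s + t) / 2 * (e\<^sup>2 *
      (real n * (real n + 1) * (2 * real n + 1) / 6 - real d * real n * (real n + 1) + real n * (real d)\<^sup>2)))"
proof (induction n)
  case (Suc n)
  have "exponent s t (e * of_int (int (Suc n) - int d)) =
      - \<i> * complex_of_real (s * (e * (real n + 1 - real d))) + complex_of_real (s * (s + t) * (e * (real n + 1 - real d))\<^sup>2 / 2)"
    by (simp add: exponent_def algebra_simps)
  moreover have "s * e * (real (Suc n) * (real (Suc n) + 1) / 2 - real (Suc n) * real d) =
     s * e * (real n * (real n + 1) / 2 - real n * real d) + s * (e * (real n + 1 - real d))"
    by (simp add: field_simps)
  moreover have "s * (s + t) / 2 * (e\<^sup>2 * (real (Suc n) * (real (Suc n) + 1) * (2 * real (Suc n) + 1) / 6 -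
        real d * real (Suc n) * (real (Suc n) + 1) + real (Suc n) * (real d)\<^sup>2)) =
      s * (s + t) / 2 * (e\<^sup>2 * (real n * (real n + 1) * (2 * real n + 1) / 6 - real d * real n * (real n + 1) + real n * (real d)\<^sup>2)) +
      s * (s + t) * (e * (real n + 1 - real d))\<^sup>2 / 2"
    by (simp add: power2_eq_square field_simps)
  ultimately show ?case
    by (simp only: Suc sum.cl_ivl_Suc of_real_add distrib_left) (simp add: algebra_simps)
qed simp

lemma sum_quadratic_exponent:
  assumes "m \<le> n"
  shows "(\<Sum>j\<in>{m<..n}. \<i> * complex_of_real (u * real j) / 2 - complex_of_real ((u * real j)\<^sup>2 / 24)) =
    \<i> * complex_of_real (u * (real n * (real n + 1) - real m * (real m + 1)) / 4) -
    complex_of_real (u\<^sup>2 * (real n * (real n + 1) * (2 * real n + 1) - real m * (real m + 1) * (2 * real m + 1)) / 144)"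
  using assms
proof (induction n rule: dec_induct)
  case (step n)
  have I: "{m<..Suc n} = insert (Suc n) {m<..n}" using step.hyps by auto
  have e0: "\<i> * complex_of_real (u * real (Suc n)) / 2 = \<i> * complex_of_real (u * (real n + 1) / 2)" by (simp add: algebra_simps)
  have e1: "u * (real (Suc n) * (real (Suc n) + 1) - real m * (real m + 1)) / 4 =
      u * (real n * (real n + 1) - real m * (real m + 1)) / 4 + u * (real n + 1) / 2" by (simp add: field_simps)
  have e2: "u\<^sup>2 * (real (Suc n) * (real (Suc n) + 1) * (2 * real (Suc n) + 1) - real m * (real m + 1) * (2 * real m + 1)) / 144 =
      u\<^sup>2 * (real n * (real n + 1) * (2 * real n + 1) - real m * (real m + 1) * (2 * real m + 1)) / 144 + (u * real (Suc n))\<^sup>2 / 24"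
    by (simp add: power2_eq_square field_simps)
  have merge: "(\<i> * complex_of_real p - complex_of_real r) + (\<i> * complex_of_real P - complex_of_real Q) =
      \<i> * complex_of_real (P + p) - complex_of_real (Q + r)" for p r P Q :: real
    by (simp add: algebra_simps)
  have "(\<Sum>j\<in>insert (Suc n) {m<..n}. \<i> * complex_of_real (u * real j) / 2 - complex_of_real ((u * real j)\<^sup>2 / 24)) =
      (\<i> * complex_of_real (u * real (Suc n)) / 2 - complex_of_real ((u * real (Suc n))\<^sup>2 / 24)) +
      (\<Sum>j\<in>{m<..n}. \<i> * complex_of_real (u * real j) / 2 - complex_of_real ((u * real j)\<^sup>2 / 24))"
    by (rule sum.insert) auto
  then show ?case unfolding I e0 step.IH merge e1 e2 .
qed simp

text \<open>The mean of ((j - d) / n)^2 over j = 1, ..., n, for h = 1 / n and x = d / n.\<close>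

definition quadratic_term :: "real \<Rightarrow> real \<Rightarrow> real" where
  "quadratic_term h x = (1 + h) * (2 + h) / 6 - x * (1 + h) + x\<^sup>2"

text \<open>The exponent of the main term after centering, for density \<open>a\<close> of fixed
  points and \<delta> = n^(-1/2); it is continuous at \<delta> = 0. The factor after t^2 / 24 is the
  sum of j^2 over m < j \<le> n, divided by n^3.\<close>

definition limit_exponent :: "real \<Rightarrow> real \<Rightarrow> real \<Rightarrow> real \<Rightarrow> complex" where
  "limit_exponent s t \<delta> a =
    \<i> * complex_of_real (s * \<delta> / 2 + s * a * \<delta> / 2 + t * \<delta> * (1 - a) / 4) +
    complex_of_real (s * (s + t) / 2 * (a * (a - \<delta>\<^sup>2) * (2 * a - \<delta>\<^sup>2) / 6) -
      t\<^sup>2 / 24 * (((1 + \<delta>\<^sup>2) * (2 + \<delta>\<^sup>2) - a * (a + \<delta>\<^sup>2) * (2 * a + \<delta>\<^sup>2)) / 6))"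

definition scaled_desc :: "nat \<Rightarrow> real \<Rightarrow> (nat \<Rightarrow> nat) \<Rightarrow> real" where
  "scaled_desc n a \<pi> = (real (desc n \<pi>) - (1 - a\<^sup>2) / 2 * real n) / real n powr (1/2)"

definition scaled_maj :: "nat \<Rightarrow> real \<Rightarrow> (nat \<Rightarrow> nat) \<Rightarrow> real" where
  "scaled_maj n a \<pi> = (real (maj n \<pi>) - (1 - a\<^sup>2) / 4 * (real n)\<^sup>2) / real n powr (3/2)"

lemma normalized_asymptotics:
  fixes A :: "(nat \<Rightarrow> nat) set" and B s t :: real
  assumes n: "n \<ge> 1" and A: "A \<subseteq> {\<pi>. \<pi> permutes {1..n}}" "A \<noteq> {}" and conj: "conj_invariant n A"
    and m: "\<And>\<pi>. \<pi> \<in> A \<Longrightarrow> num_fixed_points n \<pi> = m"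
    and B: "B \<ge> 2" "\<bar>s\<bar> \<le> B" "\<bar>t\<bar> \<le> B" "2 * B\<^sup>2 / sqrt n \<le> 1"
    and t: "\<And>j. j \<ge> 1 \<Longrightarrow> cis (t / sqrt n ^ 3) ^ j \<noteq> 1"
  defines "a \<equiv> real m / real n"
  shows "norm (average A (\<lambda>\<pi>. cis (s * scaled_desc n a \<pi> + t * scaled_maj n a \<pi>) *
        exp (of_real (s * (s + t) / 2 * quadratic_term (1 / n) (desc n \<pi> / n)))) -
      exp (limit_exponent s t (1 / sqrt n) a)) \<le> approx_error B (1 / sqrt n)"
proof -
  define \<delta> where "\<delta> = 1 / sqrt n"
  define \<epsilon> where "\<epsilon> = \<delta> ^ 3"
  have \<delta>: "\<delta> > 0" "n * \<delta>\<^sup>2 = 1" using n by (auto simp: \<delta>_def power_divide)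
  have h: "\<delta>\<^sup>2 = 1 / n" using \<delta>(2) n by (simp add: field_simps)
  have n\<epsilon>: "n * \<epsilon> = \<delta>" using \<delta> by (simp add: \<epsilon>_def power3_eq_cube power2_eq_square mult.assoc[symmetric])
  have p1: "1 / real n powr (1/2) = \<delta>" using n by (simp add: \<delta>_def powr_half_sqrt)
  have p3: "1 / real n powr (3/2) = \<epsilon>"
  proof -
    have "real n powr (3/2) = (real n powr (1/2)) ^ 3" using n by (simp add: powr_powr flip: powr_realpow)
    then show ?thesis using p1 by (simp add: \<epsilon>_def flip: p1) (simp add: power_divide)
  qed
  have D: "scaled_desc n a \<pi> = (real (desc n \<pi>) - (1 - a\<^sup>2) / 2 * real n) * \<delta>" for \<pi>
    unfolding scaled_desc_def p1[symmetric] by simp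
  have M: "scaled_maj n a \<pi> = (real (maj n \<pi>) - (1 - a\<^sup>2) / 4 * (real n)\<^sup>2) * \<epsilon>" for \<pi>
    unfolding scaled_maj_def p3[symmetric] by simp
  have mn: "m \<le> n"
  proof -
    obtain \<pi> where "\<pi> \<in> A" using A(2) by blast
    have "num_fixed_points n \<pi> \<le> card {1..n}" unfolding num_fixed_points_def by (rule card_mono) auto
    then show ?thesis using m[OF \<open>\<pi> \<in> A\<close>] by simp
  qed
  have ma: "real m = a * n" using n by (simp add: a_def)
  define N where "N = real n"
  have N: "N * \<epsilon> = \<delta>" "N \<noteq> 0" "\<delta>\<^sup>2 = 1 / N" "\<epsilon>\<^sup>2 = 1 / N ^ 3"
  proof -
    show "N * \<epsilon> = \<delta>" "N \<noteq> 0" "\<delta>\<^sup>2 = 1 / N" using n\<epsilon> n h by (auto simp: N_def)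
    have "\<epsilon>\<^sup>2 = (\<delta>\<^sup>2) ^ 3" unfolding \<epsilon>_def by (simp flip: power_mult)
    then show "\<epsilon>\<^sup>2 = 1 / N ^ 3" by (simp add: h N_def power_divide)
  qed
  have merge: "\<i> * complex_of_real X + (\<i> * complex_of_real T + (- \<i> * complex_of_real S + Q)) =
      \<i> * complex_of_real (X + T - S) + Q" for X T S :: real and Q :: complex
    by (simp add: algebra_simps)
  have merge': "\<i> * complex_of_real X + ((\<i> * complex_of_real T - complex_of_real R) + (- \<i> * complex_of_real S + complex_of_real Q)) =
      \<i> * complex_of_real (X + T - S) + complex_of_real (Q - R)" for X T S R Q :: real
    by (simp add: algebra_simps)
  \<comment> \<open>The phase that produces the centering. Its terms of order sqrt n, those with
    \<open>N * \<delta>\<close>, cancel against the main term; this is where the means (1 - a^2) / 2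
    and (1 - a^2) / 4 come from.\<close>
  define \<phi> where "\<phi> = s * \<delta> / 2 + s * a\<^sup>2 * (N * \<delta>) / 2 - t * (1 - a\<^sup>2) * (N * \<delta>) / 4"
  have lhs: "cis \<phi> * (cis (t * \<epsilon>) ^ maj n \<pi> * exp (\<Sum>j\<in>{1..n}. exponent s t (\<epsilon> * of_int (int j - int (desc n \<pi>))))) =
      cis (s * scaled_desc n a \<pi> + t * scaled_maj n a \<pi>) *
        exp (of_real (s * (s + t) / 2 * quadratic_term (1 / n) (desc n \<pi> / n)))" for \<pi>
  proof -
    define d where "d = real (desc n \<pi>)"
    define M where "M = real (maj n \<pi>)"
    have 1: "\<epsilon>\<^sup>2 * (N * (N + 1) * (2 * N + 1) / 6 - d * N * (N + 1) + N * d\<^sup>2) = quadratic_term (1 / N) (d / N)"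
      unfolding N(4) quadratic_term_def using N(2) by (simp add: field_simps power2_eq_square power3_eq_cube)
    have 2: "\<phi> + t * \<epsilon> * M - s * \<epsilon> * (N * (N + 1) / 2 - N * d) = s * ((d - (1 - a\<^sup>2) / 2 * N) * \<delta>) + t * ((M - (1 - a\<^sup>2) / 4 * N\<^sup>2) * \<epsilon>)"
      unfolding \<phi>_def N(1)[symmetric] by (simp add: field_simps power2_eq_square)
    have "cis \<phi> * (cis (t * \<epsilon>) ^ maj n \<pi> * exp (\<Sum>j\<in>{1..n}. exponent s t (\<epsilon> * of_int (int j - int (desc n \<pi>))))) =
        exp (\<i> * \<phi> + (\<i> * complex_of_real (t * \<epsilon> * M) + (- \<i> * complex_of_real (s * \<epsilon> * (N * (N + 1) / 2 - N * d)) +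
          complex_of_real (s * (s + t) / 2 * quadratic_term (1 / N) (d / N)))))"
      unfolding sum_exponent d_def[symmetric] N_def[symmetric] 1 exp_add
      by (simp add: cis_conv_exp M_def mult_ac flip: exp_of_nat_mult)
    also have "\<i> * \<phi> + (\<i> * complex_of_real (t * \<epsilon> * M) + (- \<i> * complex_of_real (s * \<epsilon> * (N * (N + 1) / 2 - N * d)) +
          complex_of_real (s * (s + t) / 2 * quadratic_term (1 / N) (d / N)))) =
        \<i> * complex_of_real (\<phi> + t * \<epsilon> * M - s * \<epsilon> * (N * (N + 1) / 2 - N * d)) +
          complex_of_real (s * (s + t) / 2 * quadratic_term (1 / N) (d / N))"
      by (rule merge)
    finally show ?thesis
      unfolding 2 exp_add D \<open>\<And>\<pi>. scaled_maj n a \<pi> = _\<close> cis_conv_exp by (simp add: d_def M_def N_def)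
  qed
  have rhs: "cis \<phi> * (exp (\<Sum>j\<in>{m<..n}. \<i> * (t * \<epsilon> * real j) / 2 - (t * \<epsilon> * real j)\<^sup>2 / 24) *
      exp (\<Sum>j\<in>{1..m}. exponent s t (\<epsilon> * of_int (int j - 1)))) = exp (limit_exponent s t \<delta> a)"
  proof -
    have 1: "(t * \<epsilon>)\<^sup>2 * (N * (N + 1) * (2 * N + 1) - a * N * (a * N + 1) * (2 * (a * N) + 1)) / 144 =
        t\<^sup>2 / 24 * (((1 + \<delta>\<^sup>2) * (2 + \<delta>\<^sup>2) - a * (a + \<delta>\<^sup>2) * (2 * a + \<delta>\<^sup>2)) / 6)"
      unfolding power_mult_distrib N(3,4) using N(2) by (simp add: field_simps power2_eq_square power3_eq_cube)
    have 2: "\<epsilon>\<^sup>2 * (a * N * (a * N + 1) * (2 * (a * N) + 1) / 6 - 1 * (a * N) * (a * N + 1) + a * N * 1\<^sup>2) =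
        a * (a - \<delta>\<^sup>2) * (2 * a - \<delta>\<^sup>2) / 6"
      unfolding N(3,4) using N(2) by (simp add: field_simps power2_eq_square power3_eq_cube)
    have 3: "\<phi> + t * \<epsilon> * (N * (N + 1) - a * N * (a * N + 1)) / 4 - s * \<epsilon> * (a * N * (a * N + 1) / 2 - a * N * 1) =
        s * \<delta> / 2 + s * a * \<delta> / 2 + t * \<delta> * (1 - a) / 4"
      unfolding \<phi>_def N(1)[symmetric] by (simp add: field_simps power2_eq_square)
    have se: "(\<Sum>j\<in>{1..m}. exponent s t (\<epsilon> * of_int (int j - 1))) =
        - \<i> * complex_of_real (s * \<epsilon> * (a * N * (a * N + 1) / 2 - a * N * 1)) +
          complex_of_real (s * (s + t) / 2 * (a * (a - \<delta>\<^sup>2) * (2 * a - \<delta>\<^sup>2) / 6))"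
      using sum_exponent[where d = 1 and e = \<epsilon> and n = m] unfolding of_nat_1 ma N_def[symmetric] 2 .
    have "cis \<phi> * (exp (\<Sum>j\<in>{m<..n}. \<i> * (t * \<epsilon> * real j) / 2 - (t * \<epsilon> * real j)\<^sup>2 / 24) *
      exp (\<Sum>j\<in>{1..m}. exponent s t (\<epsilon> * of_int (int j - 1)))) =
      exp (\<i> * \<phi> + ((\<Sum>j\<in>{m<..n}. \<i> * (t * \<epsilon> * real j) / 2 - (t * \<epsilon> * real j)\<^sup>2 / 24) +
        (\<Sum>j\<in>{1..m}. exponent s t (\<epsilon> * of_int (int j - 1)))))"
      unfolding exp_add cis_conv_exp ..
    also have "\<i> * \<phi> + ((\<Sum>j\<in>{m<..n}. \<i> * (t * \<epsilon> * real j) / 2 - (t * \<epsilon> * real j)\<^sup>2 / 24) +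
        (\<Sum>j\<in>{1..m}. exponent s t (\<epsilon> * of_int (int j - 1)))) =
      \<i> * \<phi> + ((\<i> * complex_of_real (t * \<epsilon> * (N * (N + 1) - a * N * (a * N + 1)) / 4) -
          complex_of_real (t\<^sup>2 / 24 * (((1 + \<delta>\<^sup>2) * (2 + \<delta>\<^sup>2) - a * (a + \<delta>\<^sup>2) * (2 * a + \<delta>\<^sup>2)) / 6))) +
        (- \<i> * complex_of_real (s * \<epsilon> * (a * N * (a * N + 1) / 2 - a * N * 1)) +
          complex_of_real (s * (s + t) / 2 * (a * (a - \<delta>\<^sup>2) * (2 * a - \<delta>\<^sup>2) / 6))))"
      unfolding se sum_quadratic_exponent[OF mn] ma N_def[symmetric] 1 ..
    also have "\<dots> = \<i> * complex_of_real (\<phi> + t * \<epsilon> * (N * (N + 1) - a * N * (a * N + 1)) / 4 - s * \<epsilon> * (a * N * (a * N + 1) / 2 - a * N * 1)) +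
        complex_of_real (s * (s + t) / 2 * (a * (a - \<delta>\<^sup>2) * (2 * a - \<delta>\<^sup>2) / 6) -
          t\<^sup>2 / 24 * (((1 + \<delta>\<^sup>2) * (2 + \<delta>\<^sup>2) - a * (a + \<delta>\<^sup>2) * (2 * a + \<delta>\<^sup>2)) / 6))"
      by (rule merge')
    also have "\<dots> = limit_exponent s t \<delta> a" unfolding 3 limit_exponent_def ..
    finally show ?thesis .
  qed
  have "2 * B\<^sup>2 * \<delta> \<le> 1" using B(4) by (simp add: \<delta>_def)
  moreover have "cis (t * \<delta> ^ 3) ^ j \<noteq> 1" if "j \<ge> 1" for j
    using t[OF that] by (simp add: \<delta>_def power_divide)
  ultimately have est: "norm (average A (\<lambda>\<pi>. cis (t * \<epsilon>) ^ maj n \<pi> *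
        exp (\<Sum>j\<in>{1..n}. exponent s t (\<epsilon> * of_int (int j - int (desc n \<pi>))))) -
      exp (\<Sum>j\<in>{m<..n}. \<i> * (t * \<epsilon> * real j) / 2 - (t * \<epsilon> * real j)\<^sup>2 / 24) *
      exp (\<Sum>j\<in>{1..m}. exponent s t (\<epsilon> * of_int (int j - 1)))) \<le> approx_error B \<delta>" (is "norm (?X - ?Y) \<le> _")
    unfolding \<epsilon>_def by (intro average_asymptotics[OF n A conj m B(1-3) \<delta>])
  have "norm (cis \<phi> * ?X - cis \<phi> * ?Y) = norm (?X - ?Y)"
    unfolding right_diff_distrib[symmetric] norm_mult by simp
  moreover have "cis \<phi> * ?X = average A (\<lambda>\<pi>. cis (s * scaled_desc n a \<pi> + t * scaled_maj n a \<pi>) *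
        exp (of_real (s * (s + t) / 2 * quadratic_term (1 / n) (desc n \<pi> / n))))"
    unfolding average_mult_left[symmetric] lhs ..
  moreover have "cis \<phi> * ?Y = exp (limit_exponent s t \<delta> a)" using rhs .
  ultimately show ?thesis using est unfolding \<delta>_def by simp
qed

section \<open>The characteristic function of descents and major index\<close>

lemma average_mono:
  fixes g h :: "'a \<Rightarrow> real"
  assumes "\<And>\<pi>. \<pi> \<in> A \<Longrightarrow> g \<pi> \<le> h \<pi>"
  shows "average A g \<le> average A h"
  unfolding average_def by (intro divide_right_mono sum_mono assms) auto

lemma norm_average_le_average: "norm (average A h) \<le> average A (\<lambda>\<pi>. norm (h \<pi>))"
  unfolding average_def norm_divide norm_of_nat by (intro divide_right_mono norm_sum) auto

lemma average_add: "average A (\<lambda>\<pi>. g \<pi> + h \<pi>) = average A g + average A h"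
  by (simp add: average_def sum.distrib add_divide_distrib)

lemma average_const: "finite A \<Longrightarrow> A \<noteq> {} \<Longrightarrow> average A (\<lambda>_. c) = c"
  by (simp add: average_def)

lemma Re_average: "Re (average A h) = average A (\<lambda>\<pi>. Re (h \<pi>))"
  by (simp add: average_def Re_divide_of_nat)

lemma norm_cis_diff_le: "norm (cis x - cis y) \<le> \<bar>x - y\<bar>"
proof -
  have "cis x - cis y = cis y * (cis (x - y) - 1)" by (simp add: cis_mult right_diff_distrib)
  then show ?thesis using norm_cis_minus_1_le[of "x - y"] by (simp add: norm_mult)
qed

lemma exp_diff_le:
  fixes u v :: real
  assumes "\<bar>u\<bar> \<le> C" "\<bar>v\<bar> \<le> C"
  shows "\<bar>exp u - exp v\<bar> \<le> exp C * \<bar>u - v\<bar>"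
proof -
  have *: "exp x - exp y \<le> exp C * \<bar>x - y\<bar>" if "y \<le> x" "x \<le> C" for x y
  proof -
    have "exp x - exp y = exp x * (1 - exp (y - x))" by (simp add: exp_diff algebra_simps)
    also have "\<dots> \<le> exp x * (x - y)"
    proof (rule mult_left_mono)
      show "1 - exp (y - x) \<le> x - y" using exp_ge_add_one_self[of "y - x"] by linarith
    qed simp
    also have "\<dots> \<le> exp C * (x - y)" using that by (intro mult_right_mono) auto
    finally show ?thesis using that by simp
  qed
  show ?thesis
  proof (cases "v \<le> u")
    case True
    then show ?thesis using *[of v u] assms by simp
  next
    case False
    then show ?thesis using *[of u v] assms by (simp add: abs_minus_commute)
  qed
qed

text \<open>Recovers a second moment from a characteristic function at a single argument, for a
  variable bounded by 1.\<close>

lemma square_le_one_minus_cos: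
  fixes x :: real
  assumes "\<bar>x\<bar> \<le> 1"
  shows "x\<^sup>2 \<le> 4 * (1 - cos x)"
proof -
  have r: "Re (cis x - (1 + \<i> * x - x\<^sup>2 / 2 - \<i> * x ^ 3 / 6)) = cos x - 1 + x\<^sup>2 / 2"
    by simp
  have "\<bar>Re (cis x - (1 + \<i> * x - x\<^sup>2 / 2 - \<i> * x ^ 3 / 6))\<bar> \<le> x ^ 4 / 24"
    using order_trans[OF abs_Re_le_cmod norm_cis_minus_cubic] .
  then have "\<bar>cos x - 1 + x\<^sup>2 / 2\<bar> \<le> x ^ 4 / 24" unfolding r .
  moreover have "x ^ 4 \<le> x\<^sup>2"
  proof -
    have "\<bar>x\<bar> ^ 4 \<le> \<bar>x\<bar>\<^sup>2" using assms by (intro power_decreasing) auto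
    then show ?thesis by (simp add: power_even_abs)
  qed
  ultimately show ?thesis using zero_le_power2[of x] unfolding abs_le_iff by argo
qed

text \<open>The excluded values form a countable set, so every interval contains an admissible
  one.\<close>

lemma exists_near_non_root_of_unity:
  fixes t e r :: real
  assumes "e > 0" "r \<noteq> 0"
  shows "\<exists>t'. \<bar>t' - t\<bar> < e \<and> (\<forall>j\<ge>1. cis (t' / r) ^ j \<noteq> 1)"
proof -
  define Bad where "Bad = (\<lambda>(j, l). 2 * pi * real_of_int l * r / real j) ` (UNIV :: (nat \<times> int) set)"
  have "countable Bad" unfolding Bad_def by (intro countable_image) auto
  moreover have "uncountable {t<..<t + e}" using assms by (simp add: uncountable_open_interval)
  ultimately have "\<not> {t<..<t + e} \<subseteq> Bad" by (metis countable_subset)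
  then obtain t' where t': "t' \<in> {t<..<t + e}" "t' \<notin> Bad" by blast
  have "cis (t' / r) ^ j \<noteq> 1" if "j \<ge> 1" for j
  proof
    assume "cis (t' / r) ^ j = 1"
    then have "cos (j * (t' / r)) = 1" unfolding Complex.DeMoivre
      by (metis cis.simps(1) one_complex.simps(1))
    then obtain l :: int where "j * (t' / r) = l * 2 * pi" using cos_one_2pi_int by auto
    then have "t' = 2 * pi * real_of_int l * r / real j" using that assms by (simp add: field_simps)
    then have "t' \<in> Bad" unfolding Bad_def by (intro image_eqI[of _ _ "(j, l)"]) simp_all
    then show False using t'(2) by blast
  qed
  moreover have "\<bar>t' - t\<bar> < e" using t'(1) by auto
  ultimately show ?thesis by blast
qed

lemma abs_quadratic_term_le:
  assumes "0 \<le> h" "h \<le> 1" "0 \<le> x" "x \<le> 1"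
  shows "\<bar>quadratic_term h x\<bar> \<le> 4"
proof -
  have "(1 + h) * (2 + h) \<le> 2 * 3" using assms by (intro mult_mono) auto
  moreover have "0 \<le> (1 + h) * (2 + h)" using assms by simp
  moreover have "x * (1 + h) \<le> 1 * 2" using assms by (intro mult_mono) auto
  moreover have "0 \<le> x * (1 + h)" using assms by simp
  moreover have "x\<^sup>2 \<le> 1" "0 \<le> x\<^sup>2" using assms by (auto simp: power_le_one)
  ultimately show ?thesis unfolding quadratic_term_def by linarith
qed

text \<open>For h = 0 the quadratic is 1/12 + (x - 1/2)^2, and at the mean x = (1 - a^2) / 2 this is
  1/12 + a^4 / 4.\<close>

lemma quadratic_term_diff:
  assumes "0 \<le> h" "h \<le> 1" "0 \<le> x" "x \<le> 1" "0 \<le> a" "a \<le> 1"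
  shows "\<bar>quadratic_term h x - (1 / 12 + a ^ 4 / 4)\<bar> \<le> 2 * h + 3 * \<bar>x - (1 - a\<^sup>2) / 2\<bar>"
proof -
  define y where "y = (1 - a\<^sup>2) / 2"
  have "0 \<le> a\<^sup>2" "a\<^sup>2 \<le> 1" using assms by (auto simp: power_le_one)
  then have y: "0 \<le> y" "y \<le> 1" unfolding y_def by (simp, argo)
  have "1 / 12 + a ^ 4 / 4 = 1 / 3 - y + y\<^sup>2"
    by (simp add: y_def power2_eq_square eval_nat_numeral field_simps)
  then have "quadratic_term h x - (1 / 12 + a ^ 4 / 4) = h * ((3 + h) / 6 - x) + (x - y) * (x + y - 1)"
    unfolding quadratic_term_def by (simp add: power2_eq_square field_simps)
  also have "\<bar>\<dots>\<bar> \<le> h * \<bar>(3 + h) / 6 - x\<bar> + \<bar>x - y\<bar> * \<bar>x + y - 1\<bar>"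
    using assms by (intro order_trans[OF abs_triangle_ineq]) (simp add: abs_mult)
  also have "\<dots> \<le> h * 2 + \<bar>x - y\<bar> * 3"
  proof (intro add_mono mult_left_mono)
    show "\<bar>(3 + h) / 6 - x\<bar> \<le> 2" using assms unfolding abs_le_iff by argo
    show "\<bar>x + y - 1\<bar> \<le> 3" using assms y unfolding abs_le_iff by argo
  qed (use assms in auto)
  finally show ?thesis by (simp add: y_def)
qed

section \<open>Limits along a family of conjugation invariant sets\<close>

locale conj_family =
  fixes A :: "nat \<Rightarrow> (nat \<Rightarrow> nat) set" and m :: "nat \<Rightarrow> nat" and a :: "nat \<Rightarrow> real" and \<alpha> :: real
  assumes A_ne: "\<And>n. n \<ge> 1 \<Longrightarrow> A n \<noteq> {}"
    and A_perm: "\<And>n. n \<ge> 1 \<Longrightarrow> A n \<subseteq> {\<pi>. \<pi> permutes {1..n}}"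
    and A_conj: "\<And>n. n \<ge> 1 \<Longrightarrow> conj_invariant n (A n)"
    and A_fixed: "\<And>n \<pi>. n \<ge> 1 \<Longrightarrow> \<pi> \<in> A n \<Longrightarrow> num_fixed_points n \<pi> = m n"
    and a_eq: "\<And>n. n \<ge> 1 \<Longrightarrow> a n = real (m n) / real n"
    and a_lim: "a \<longlonglongrightarrow> \<alpha>"
begin

lemma finite_A: "n \<ge> 1 \<Longrightarrow> finite (A n)"
  using A_perm finite_permutations[of "{1..n}"] finite_subset by blast

lemma a_bounds:
  assumes "n \<ge> 1"
  shows "0 \<le> a n" "a n \<le> 1"
proof -
  obtain \<pi> where "\<pi> \<in> A n" using A_ne[OF assms] by blast
  have "num_fixed_points n \<pi> \<le> card {1..n}" unfolding num_fixed_points_def by (rule card_mono) auto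
  then have "m n \<le> n" using A_fixed[OF assms \<open>\<pi> \<in> A n\<close>] by simp
  then show "0 \<le> a n" "a n \<le> 1" using a_eq[OF assms] assms by auto
qed

lemma desc_bounds: "n \<ge> 1 \<Longrightarrow> 1 \<le> desc n \<pi> \<and> desc n \<pi> \<le> n"
proof -
  assume "n \<ge> 1"
  have "card (descents n \<pi>) \<le> card {1..<n}" unfolding descents_def by (rule card_mono) auto
  then show ?thesis using \<open>n \<ge> 1\<close> by (auto simp: desc_def)
qed

lemma desc_ratio_bounds: "n \<ge> 1 \<Longrightarrow> 0 \<le> real (desc n \<pi>) / n \<and> real (desc n \<pi>) / n \<le> 1"
  using desc_bounds[of n \<pi>] by auto

text \<open>Crude but sufficient: moving \<open>t\<close> by at most 1 / (n + 1) changes the phase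
  by at most sqrt n / (n + 1).\<close>

lemma scaled_maj_le:
  assumes n: "n \<ge> 1"
  shows "\<bar>scaled_maj n (a n) \<pi>\<bar> \<le> sqrt n"
proof -
  have "maj n \<pi> \<le> (\<Sum>i\<in>descents n \<pi>. n)"
    unfolding maj_def by (intro sum_mono) (auto simp: descents_def)
  also have "\<dots> \<le> n * n"
    using desc_bounds[OF n, of \<pi>] by (simp add: desc_def)
  finally have "real (maj n \<pi>) \<le> real (n * n)" by (simp only: of_nat_le_iff)
  then have m: "real (maj n \<pi>) \<le> (real n)\<^sup>2" by (simp add: power2_eq_square)
  have "0 \<le> (a n)\<^sup>2" "(a n)\<^sup>2 \<le> 1" using a_bounds[OF n] by (auto simp: power_le_one)
  then have "0 \<le> (1 - (a n)\<^sup>2) / 4" "(1 - (a n)\<^sup>2) / 4 \<le> 1" by (simp, argo)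
  then have "0 \<le> (1 - (a n)\<^sup>2) / 4 * (real n)\<^sup>2" "(1 - (a n)\<^sup>2) / 4 * (real n)\<^sup>2 \<le> (real n)\<^sup>2"
    by (simp, intro mult_left_le_one_le) auto
  then have b: "\<bar>real (maj n \<pi>) - (1 - (a n)\<^sup>2) / 4 * (real n)\<^sup>2\<bar> \<le> (real n)\<^sup>2"
    using m of_nat_0_le_iff[of "maj n \<pi>", where 'a = real] unfolding abs_le_iff by linarith
  have "\<bar>scaled_maj n (a n) \<pi>\<bar> = \<bar>real (maj n \<pi>) - (1 - (a n)\<^sup>2) / 4 * (real n)\<^sup>2\<bar> / real n powr (3/2)"
    unfolding scaled_maj_def by (simp add: abs_divide)
  also have "\<dots> \<le> (real n)\<^sup>2 / real n powr (3/2)" using b by (intro divide_right_mono) auto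
  also have "\<dots> = real n powr 2 / real n powr (3/2)" using n by simp
  also have "\<dots> = real n powr (2 - 3/2)" by (simp only: powr_diff)
  also have "\<dots> = sqrt n" using n by (simp add: powr_half_sqrt)
  finally show ?thesis .
qed

lemma inverse_sqrt_tendsto: "(\<lambda>n. 1 / sqrt (real n)) \<longlonglongrightarrow> 0"
  by real_asymp

text \<open>The arguments vary with \<open>n\<close> for two reasons: \<open>t n\<close> has to
  avoid roots of unity, and the law of large numbers takes \<open>s n\<close> to 0.\<close>

lemma master_limit:
  assumes s: "s \<longlonglongrightarrow> s0" and t: "t \<longlonglongrightarrow> t0"
    and root: "\<And>n j. n \<ge> 1 \<Longrightarrow> j \<ge> 1 \<Longrightarrow> cis (t n / sqrt n ^ 3) ^ j \<noteq> 1"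
  shows "(\<lambda>n. average (A n) (\<lambda>\<pi>. cis (s n * scaled_desc n (a n) \<pi> + t n * scaled_maj n (a n) \<pi>) *
      exp (of_real (s n * (s n + t n) / 2 * quadratic_term (1 / n) (desc n \<pi> / n)))))
    \<longlonglongrightarrow> exp (of_real (s0 * (s0 + t0) * \<alpha> ^ 3 / 6 - t0\<^sup>2 * (1 - \<alpha> ^ 3) / 72))"
proof -
  obtain Bs where Bs: "\<And>n. norm (s n) \<le> Bs" using convergent_imp_Bseq[of s] s BseqE unfolding convergent_def by metis
  obtain Bt where Bt: "\<And>n. norm (t n) \<le> Bt" using convergent_imp_Bseq[of t] t BseqE unfolding convergent_def by metis
  define B where "B = max 2 (max Bs Bt)"
  have B: "B \<ge> 2" "\<bar>s n\<bar> \<le> B" "\<bar>t n\<bar> \<le> B" for n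
    using Bs[of n] Bt[of n] by (auto simp: B_def le_max_iff_disj)
  define L where "L n = exp (limit_exponent (s n) (t n) (1 / sqrt n) (a n))" for n
  define X where "X n = average (A n) (\<lambda>\<pi>. cis (s n * scaled_desc n (a n) \<pi> + t n * scaled_maj n (a n) \<pi>) *
      exp (of_real (s n * (s n + t n) / 2 * quadratic_term (1 / n) (desc n \<pi> / n))))" for n
  have "(\<lambda>n. 2 * B\<^sup>2 / sqrt (real n)) \<longlonglongrightarrow> 0" by real_asymp
  then have "eventually (\<lambda>n. 2 * B\<^sup>2 / sqrt (real n) < 1) sequentially"
    by (rule order_tendstoD) simp
  then have ev: "eventually (\<lambda>n. norm (X n - L n) \<le> approx_error B (1 / sqrt n)) sequentially"
    using eventually_ge_at_top[of 1]
  proof eventually_elim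
    case (elim n)
    show ?case
      unfolding X_def L_def a_eq[OF elim(2)]
      by (rule normalized_asymptotics[OF elim(2) A_perm[OF elim(2)] A_ne[OF elim(2)] A_conj[OF elim(2)] A_fixed[OF elim(2)] B])
        (use elim root in auto)
  qed
  have "(\<lambda>n. X n - L n) \<longlonglongrightarrow> 0"
    by (rule Lim_null_comparison[OF ev approx_error_tendsto_0[OF inverse_sqrt_tendsto]])
  moreover have "L \<longlonglongrightarrow> exp (limit_exponent s0 t0 0 \<alpha>)"
    unfolding L_def limit_exponent_def
    by (intro tendsto_intros s t a_lim inverse_sqrt_tendsto) auto
  ultimately have "X \<longlonglongrightarrow> exp (limit_exponent s0 t0 0 \<alpha>)"
    using tendsto_add[of "\<lambda>n. X n - L n" 0 sequentially L] by simp
  moreover have "limit_exponent s0 t0 0 \<alpha> = of_real (s0 * (s0 + t0) * \<alpha> ^ 3 / 6 - t0\<^sup>2 * (1 - \<alpha> ^ 3) / 72)"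
    unfolding limit_exponent_def by (simp add: power3_eq_cube complex_eq_iff) (simp add: field_simps)
  ultimately show ?thesis unfolding X_def by simp
qed


definition centered_desc :: "nat \<Rightarrow> (nat \<Rightarrow> nat) \<Rightarrow> real" where
  "centered_desc n \<pi> = real (desc n \<pi>) / n - (1 - (a n)\<^sup>2) / 2"

lemma abs_centered_desc_le: "n \<ge> 1 \<Longrightarrow> \<bar>centered_desc n \<pi>\<bar> \<le> 1"
proof -
  assume n: "n \<ge> 1"
  have "0 \<le> (a n)\<^sup>2" "(a n)\<^sup>2 \<le> 1" using a_bounds[OF n] by (auto simp: power_le_one)
  moreover have "0 \<le> real (desc n \<pi>) / n" "real (desc n \<pi>) / n \<le> 1" using desc_ratio_bounds[OF n] by auto
  ultimately show ?thesis unfolding centered_desc_def abs_le_iff by argo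
qed

lemma scaled_desc_eq: "n \<ge> 1 \<Longrightarrow> 1 / sqrt n * scaled_desc n (a n) \<pi> = centered_desc n \<pi>"
  unfolding scaled_desc_def centered_desc_def
  by (simp add: powr_half_sqrt field_simps)

lemma perturbation:
  obtains t where "\<And>n. \<bar>t n - t0\<bar> \<le> 1 / real (Suc n)"
    "\<And>n j. n \<ge> 1 \<Longrightarrow> j \<ge> 1 \<Longrightarrow> cis (t n / sqrt n ^ 3) ^ j \<noteq> 1" "t \<longlonglongrightarrow> t0"
proof -
  have "\<exists>t'. \<bar>t' - t0\<bar> < 1 / real (Suc n) \<and> (n \<ge> 1 \<longrightarrow> (\<forall>j\<ge>1. cis (t' / sqrt n ^ 3) ^ j \<noteq> 1))" for n
  proof (cases "n \<ge> 1")
    case True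
    then show ?thesis using exists_near_non_root_of_unity[of "1 / real (Suc n)" "sqrt n ^ 3" t0] by auto
  next
    case False
    then show ?thesis by (intro exI[of _ t0]) auto
  qed
  then obtain t where t: "\<And>n. \<bar>t n - t0\<bar> < 1 / real (Suc n)"
    "\<And>n. n \<ge> 1 \<longrightarrow> (\<forall>j\<ge>1. cis (t n / sqrt n ^ 3) ^ j \<noteq> 1)"
    using choice[of "\<lambda>n t'. \<bar>t' - t0\<bar> < 1 / real (Suc n) \<and> (n \<ge> 1 \<longrightarrow> (\<forall>j\<ge>1. cis (t' / sqrt n ^ 3) ^ j \<noteq> 1))"]
    by blast
  show thesis
  proof
    show 1: "\<bar>t n - t0\<bar> \<le> 1 / real (Suc n)" for n using t(1)[of n] by simp
    show "cis (t n / sqrt n ^ 3) ^ j \<noteq> 1" if "n \<ge> 1" "j \<ge> 1" for n j using t(2)[of n] that by blast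
    have "(\<lambda>n. 1 / real (Suc n)) \<longlonglongrightarrow> 0" by real_asymp
    then have "(\<lambda>n. t n - t0) \<longlonglongrightarrow> 0"
      by (rule Lim_null_comparison[rotated]) (use 1 in simp)
    then show "t \<longlonglongrightarrow> t0" by (simp add: LIM_zero_iff)
  qed
qed

text \<open>With s = n^(-1/2) the phase \<open>s * scaled_desc\<close> is
  \<open>centered_desc\<close> itself, the perturbed \<open>t\<close> is too small to matter, and
  the quadratic factor tends to 1 uniformly because its coefficient tends to 0. So the mean of
  \<open>cis (centered_desc n \<pi>)\<close> tends to 1, which forces the second moment of a
  quantity bounded by 1 to 0.\<close>

lemma average_centered_desc_square: "(\<lambda>n. average (A n) (\<lambda>\<pi>. (centered_desc n \<pi>)\<^sup>2)) \<longlonglongrightarrow> 0"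
proof -
  obtain t where t: "\<And>n. \<bar>t n - 0\<bar> \<le> 1 / real (Suc n)"
    "\<And>n j. n \<ge> 1 \<Longrightarrow> j \<ge> 1 \<Longrightarrow> cis (t n / sqrt n ^ 3) ^ j \<noteq> 1" "t \<longlonglongrightarrow> 0"
    using perturbation[of 0] by blast
  define s where "s n = 1 / sqrt (real n)" for n
  define u where "u n = s n * (s n + t n) / 2" for n
  define Y where "Y n \<pi> = cis (s n * scaled_desc n (a n) \<pi> + t n * scaled_maj n (a n) \<pi>) *
      exp (of_real (u n * quadratic_term (1 / n) (desc n \<pi> / n)))" for n \<pi>
  have s0: "s \<longlonglongrightarrow> 0" unfolding s_def by (rule inverse_sqrt_tendsto)
  have u0: "u \<longlonglongrightarrow> 0"
  proof -
    have "u \<longlonglongrightarrow> 0 * (0 + 0) / 2" unfolding u_def by (intro tendsto_intros s0 t(3)) simp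
    then show ?thesis by simp
  qed
  have "(\<lambda>n. average (A n) (Y n)) \<longlonglongrightarrow> 1"
    using master_limit[OF s0 t(3,2)] unfolding Y_def u_def by simp
  moreover have "(\<lambda>n. average (A n) (\<lambda>\<pi>. Y n \<pi> - cis (centered_desc n \<pi>))) \<longlonglongrightarrow> 0"
  proof (rule Lim_null_comparison)
    have "(\<lambda>n. sqrt n / real (Suc n)) \<longlonglongrightarrow> 0" by real_asymp
    moreover have "(\<lambda>n. exp (4 * \<bar>u n\<bar>) * (4 * \<bar>u n\<bar>)) \<longlonglongrightarrow> exp (4 * \<bar>0\<bar>) * (4 * \<bar>0\<bar>)"
      by (intro tendsto_intros u0)
    ultimately show "(\<lambda>n. exp (4 * \<bar>u n\<bar>) * (4 * \<bar>u n\<bar>) + sqrt n / real (Suc n)) \<longlonglongrightarrow> 0"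
      using tendsto_add[of "\<lambda>n. exp (4 * \<bar>u n\<bar>) * (4 * \<bar>u n\<bar>)" 0 sequentially "\<lambda>n. sqrt n / real (Suc n)" 0] by simp
    show "eventually (\<lambda>n. norm (average (A n) (\<lambda>\<pi>. Y n \<pi> - cis (centered_desc n \<pi>))) \<le>
        exp (4 * \<bar>u n\<bar>) * (4 * \<bar>u n\<bar>) + sqrt n / real (Suc n)) sequentially"
      using eventually_ge_at_top[of 1]
    proof eventually_elim
      case (elim n)
      show ?case
      proof (rule norm_average_le[OF finite_A[OF elim] A_ne[OF elim]])
        fix \<pi>
        define v where "v = u n * quadratic_term (1 / n) (desc n \<pi> / n)"
        define x where "x = s n * scaled_desc n (a n) \<pi> + t n * scaled_maj n (a n) \<pi>"
        have "\<bar>quadratic_term (1 / n) (desc n \<pi> / n)\<bar> \<le> 4"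
          using desc_ratio_bounds[OF elim, of \<pi>] elim by (intro abs_quadratic_term_le) auto
        then have v: "\<bar>v\<bar> \<le> 4 * \<bar>u n\<bar>" unfolding v_def abs_mult by (simp add: mult.commute mult_left_mono)
        have "Y n \<pi> - cis (centered_desc n \<pi>) = cis x * of_real (exp v - exp 0) + (cis x - cis (centered_desc n \<pi>))"
          unfolding Y_def v_def[symmetric] x_def[symmetric] exp_of_real by (simp add: algebra_simps)
        also have "norm \<dots> \<le> \<bar>exp v - exp 0\<bar> + \<bar>x - centered_desc n \<pi>\<bar>"
          by (rule order_trans[OF norm_triangle_ineq]) (intro add_mono norm_cis_diff_le, simp add: norm_mult flip: of_real_diff)
        also have "\<bar>exp v - exp 0\<bar> \<le> exp (4 * \<bar>u n\<bar>) * (4 * \<bar>u n\<bar>)"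
        proof -
          have "\<bar>exp v - exp 0\<bar> \<le> exp (4 * \<bar>u n\<bar>) * \<bar>v - 0\<bar>" using v by (intro exp_diff_le) auto
          also have "\<dots> \<le> exp (4 * \<bar>u n\<bar>) * (4 * \<bar>u n\<bar>)" using v by (intro mult_left_mono) auto
          finally show ?thesis .
        qed
        also have "x - centered_desc n \<pi> = t n * scaled_maj n (a n) \<pi>"
          unfolding x_def s_def scaled_desc_eq[OF elim] by simp
        also have "\<bar>t n * scaled_maj n (a n) \<pi>\<bar> \<le> 1 / real (Suc n) * sqrt n"
          unfolding abs_mult using t(1)[of n] scaled_maj_le[OF elim] by (intro mult_mono) auto
        finally show "norm (Y n \<pi> - cis (centered_desc n \<pi>)) \<le> exp (4 * \<bar>u n\<bar>) * (4 * \<bar>u n\<bar>) + sqrt n / real (Suc n)"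
          by simp
      qed
    qed
  qed
  ultimately have "(\<lambda>n. average (A n) (Y n) - average (A n) (\<lambda>\<pi>. Y n \<pi> - cis (centered_desc n \<pi>))) \<longlonglongrightarrow> 1 - 0"
    by (rule tendsto_diff)
  then have "(\<lambda>n. average (A n) (\<lambda>\<pi>. cis (centered_desc n \<pi>))) \<longlonglongrightarrow> 1"
    unfolding average_diff by simp
  then have "(\<lambda>n. Re (average (A n) (\<lambda>\<pi>. cis (centered_desc n \<pi>)))) \<longlonglongrightarrow> Re 1"
    by (rule tendsto_Re)
  then have "(\<lambda>n. 4 * (1 - average (A n) (\<lambda>\<pi>. cos (centered_desc n \<pi>)))) \<longlonglongrightarrow> 4 * (1 - 1)"
    unfolding Re_average by (intro tendsto_intros) simp
  then have "(\<lambda>n. 4 * (1 - average (A n) (\<lambda>\<pi>. cos (centered_desc n \<pi>)))) \<longlonglongrightarrow> 0" by simp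
  moreover have "eventually (\<lambda>n. norm (average (A n) (\<lambda>\<pi>. (centered_desc n \<pi>)\<^sup>2)) \<le>
      4 * (1 - average (A n) (\<lambda>\<pi>. cos (centered_desc n \<pi>)))) sequentially"
    using eventually_ge_at_top[of 1]
  proof eventually_elim
    case (elim n)
    have "average (A n) (\<lambda>\<pi>. (centered_desc n \<pi>)\<^sup>2) \<le> average (A n) (\<lambda>\<pi>. 4 * (1 - cos (centered_desc n \<pi>)))"
      by (intro average_mono square_le_one_minus_cos abs_centered_desc_le elim)
    also have "\<dots> = 4 * (1 - average (A n) (\<lambda>\<pi>. cos (centered_desc n \<pi>)))"
      unfolding average_mult_left average_diff average_const[OF finite_A[OF elim] A_ne[OF elim]] ..
    finally show ?case by (simp add: average_def sum_nonneg)
  qed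
  ultimately show ?thesis by (rule Lim_null_comparison[rotated])
qed

text \<open>In place of the Cauchy-Schwarz inequality, x \<le> e / 2 + x^2 / e is averaged.\<close>

lemma average_abs_centered_desc: "(\<lambda>n. average (A n) (\<lambda>\<pi>. \<bar>centered_desc n \<pi>\<bar>)) \<longlonglongrightarrow> 0"
proof (rule tendstoI)
  fix e :: real assume e: "e > 0"
  have "eventually (\<lambda>n. average (A n) (\<lambda>\<pi>. (centered_desc n \<pi>)\<^sup>2) < e * e / 4) sequentially"
    using e by (intro order_tendstoD(2)[OF average_centered_desc_square]) simp
  then show "eventually (\<lambda>n. dist (average (A n) (\<lambda>\<pi>. \<bar>centered_desc n \<pi>\<bar>)) 0 < e) sequentially"
    using eventually_ge_at_top[of 1]
  proof eventually_elim
    case (elim n)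
    have "average (A n) (\<lambda>\<pi>. \<bar>centered_desc n \<pi>\<bar>) \<le> average (A n) (\<lambda>\<pi>. e / 2 + (1 / e) * (centered_desc n \<pi>)\<^sup>2)"
    proof (rule average_mono)
      fix \<pi>
      define x where "x = \<bar>centered_desc n \<pi>\<bar>"
      have "0 \<le> (x - e)\<^sup>2" by simp
      then have "2 * (e * x) \<le> e\<^sup>2 + x\<^sup>2" by (simp add: power2_diff mult.commute)
      moreover have "0 \<le> x\<^sup>2" by simp
      moreover have "2 * (e * (e / 2)) = e\<^sup>2" by (simp add: power2_eq_square)
      ultimately have "e * x \<le> e * (e / 2) + x\<^sup>2" by linarith
      then have "x \<le> e / 2 + 1 / e * x\<^sup>2" using e by (simp add: field_simps)
      then show "\<bar>centered_desc n \<pi>\<bar> \<le> e / 2 + 1 / e * (centered_desc n \<pi>)\<^sup>2" by (simp add: x_def)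
    qed
    also have "\<dots> = e / 2 + 1 / e * average (A n) (\<lambda>\<pi>. (centered_desc n \<pi>)\<^sup>2)"
      unfolding average_add average_mult_left average_const[OF finite_A[OF elim(2)] A_ne[OF elim(2)]] ..
    also have "\<dots> < e / 2 + 1 / e * (e * e / 4)"
      using e elim(1) by (intro add_strict_left_mono mult_strict_left_mono) auto
    also have "\<dots> \<le> e" using e by simp
    finally have "average (A n) (\<lambda>\<pi>. \<bar>centered_desc n \<pi>\<bar>) < e" .
    moreover have "0 \<le> average (A n) (\<lambda>\<pi>. \<bar>centered_desc n \<pi>\<bar>)" by (simp add: average_def sum_nonneg)
    ultimately show ?case by simp
  qed
qed

text \<open>The quadratic factor is Lipschitz in d / n with bounded constant, so the first moment
  bound allows its replacement by \<open>G\<close>, the limit of its values at the mean, and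
  \<open>G\<close> is divided out. Subtracting s (s + t) (1/12 + \<alpha>^4 / 4) / 2 from s (s + t)
  \<alpha>^3 / 6 leaves - s (s + t) (1 - 4 \<alpha>^3 + 3 \<alpha>^4) / 24, the source of the
  covariance.\<close>

theorem characteristic_limit:
  "(\<lambda>n. average (A n) (\<lambda>\<pi>. cis (s * scaled_desc n (a n) \<pi> + t * scaled_maj n (a n) \<pi>))) \<longlonglongrightarrow>
    exp (of_real (- ((s\<^sup>2 + s * t) * (1 - 4 * \<alpha> ^ 3 + 3 * \<alpha> ^ 4) / 12 + t\<^sup>2 * (1 - \<alpha> ^ 3) / 36) / 2))"
proof -
  obtain \<tau> where \<tau>: "\<And>n. \<bar>\<tau> n - t\<bar> \<le> 1 / real (Suc n)"
    "\<And>n j. n \<ge> 1 \<Longrightarrow> j \<ge> 1 \<Longrightarrow> cis (\<tau> n / sqrt n ^ 3) ^ j \<noteq> 1" "\<tau> \<longlonglongrightarrow> t"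
    using perturbation[of t] by blast
  define g where "g b = 1 / 12 + b ^ 4 / (4 :: real)" for b
  define u where "u n = s * (s + \<tau> n) / 2" for n
  define u0 where "u0 = s * (s + t) / 2"
  define G where "G = exp (u0 * g \<alpha>)"
  \<comment> \<open>Eight times a bound for |u n|, as |\<tau> n - t| \<le> 1. The quadratic term and
    \<open>g\<close> stay below 8, so \<open>C\<close> bounds all exponents that are
    compared.\<close>
  define C where "C = \<bar>s\<bar> * (\<bar>s\<bar> + \<bar>t\<bar> + 1) * 4"
  define r where "r n = \<bar>u n * g (a n) - u0 * g \<alpha>\<bar>" for n
  define Z where "Z n \<pi> = s * scaled_desc n (a n) \<pi> + t * scaled_maj n (a n) \<pi>" for n \<pi>
  define Z' where "Z' n \<pi> = s * scaled_desc n (a n) \<pi> + \<tau> n * scaled_maj n (a n) \<pi>" for n \<pi>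
  define v where "v n \<pi> = u n * quadratic_term (1 / n) (desc n \<pi> / n)" for n \<pi>
  have u_lim: "u \<longlonglongrightarrow> u0" unfolding u_def u0_def by (intro tendsto_intros \<tau>(3)) simp
  have r_lim: "r \<longlonglongrightarrow> 0"
  proof -
    have "r \<longlonglongrightarrow> \<bar>u0 * g \<alpha> - u0 * g \<alpha>\<bar>" unfolding r_def g_def by (intro tendsto_intros u_lim a_lim) auto
    then show ?thesis by simp
  qed
  have uC: "\<bar>u n\<bar> * 8 \<le> C" for n
  proof -
    have "1 / real (Suc n) \<le> 1" by simp
    then have "\<bar>s + \<tau> n\<bar> \<le> \<bar>s\<bar> + \<bar>t\<bar> + 1" using \<tau>(1)[of n] by linarith
    then have "\<bar>s\<bar> * \<bar>s + \<tau> n\<bar> \<le> \<bar>s\<bar> * (\<bar>s\<bar> + \<bar>t\<bar> + 1)" by (intro mult_left_mono) auto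
    then show ?thesis by (simp add: u_def C_def abs_mult)
  qed
  have u0C: "\<bar>u0\<bar> * 8 \<le> C"
    using uC by (intro tendsto_upperbound[of "\<lambda>n. \<bar>u n\<bar> * 8" _ sequentially]) (auto intro!: tendsto_intros u_lim)
  have "\<alpha> \<ge> 0" "\<alpha> \<le> 1"
    using a_bounds by (auto intro!: tendsto_lowerbound[OF a_lim] tendsto_upperbound[OF a_lim]
        eventually_mono[OF eventually_ge_at_top[of 1]])
  then have "0 \<le> \<alpha> ^ 4" "\<alpha> ^ 4 \<le> 1" by (auto simp: power_le_one)
  then have "\<bar>g \<alpha>\<bar> \<le> 8" unfolding g_def by simp
  then have gC: "\<bar>u0 * g \<alpha>\<bar> \<le> C"
    using mult_left_mono[of "\<bar>g \<alpha>\<bar>" 8 "\<bar>u0\<bar>"] u0C unfolding abs_mult by linarith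
  have "(\<lambda>n. average (A n) (\<lambda>\<pi>. cis (Z' n \<pi>) * exp (of_real (v n \<pi>)))) \<longlonglongrightarrow>
      exp (of_real (s * (s + t) * \<alpha> ^ 3 / 6 - t\<^sup>2 * (1 - \<alpha> ^ 3) / 72))"
    using master_limit[OF tendsto_const[of s] \<tau>(3,2)] unfolding Z'_def v_def u_def .
  moreover have "(\<lambda>n. average (A n) (\<lambda>\<pi>. of_real G * cis (Z n \<pi>) - cis (Z' n \<pi>) * exp (of_real (v n \<pi>)))) \<longlonglongrightarrow> 0"
  proof (rule Lim_null_comparison)
    have "(\<lambda>n. sqrt n / real (Suc n)) \<longlonglongrightarrow> 0" by real_asymp
    moreover have "(\<lambda>n. 1 / real n) \<longlonglongrightarrow> 0" by real_asymp
    ultimately have "(\<lambda>n. G * (sqrt n / real (Suc n)) + exp C * (C * (2 * (1 / real n) + 3 * average (A n) (\<lambda>\<pi>. \<bar>centered_desc n \<pi>\<bar>)) + r n)) \<longlonglongrightarrow>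
        G * 0 + exp C * (C * (2 * 0 + 3 * 0) + 0)"
      by (intro tendsto_intros r_lim average_abs_centered_desc)
    then show "(\<lambda>n. G * (sqrt n / real (Suc n)) + exp C * (C * (2 * (1 / real n) + 3 * average (A n) (\<lambda>\<pi>. \<bar>centered_desc n \<pi>\<bar>)) + r n)) \<longlonglongrightarrow> 0"
      by simp
    show "eventually (\<lambda>n. norm (average (A n) (\<lambda>\<pi>. of_real G * cis (Z n \<pi>) - cis (Z' n \<pi>) * exp (of_real (v n \<pi>)))) \<le>
        G * (sqrt n / real (Suc n)) + exp C * (C * (2 * (1 / real n) + 3 * average (A n) (\<lambda>\<pi>. \<bar>centered_desc n \<pi>\<bar>)) + r n)) sequentially"
      using eventually_ge_at_top[of 1]
    proof eventually_elim
      case (elim n)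
      have "norm (average (A n) (\<lambda>\<pi>. of_real G * cis (Z n \<pi>) - cis (Z' n \<pi>) * exp (of_real (v n \<pi>)))) \<le>
          average (A n) (\<lambda>\<pi>. norm (of_real G * cis (Z n \<pi>) - cis (Z' n \<pi>) * exp (of_real (v n \<pi>))))"
        by (rule norm_average_le_average)
      also have "\<dots> \<le> average (A n) (\<lambda>\<pi>. (G * (sqrt n / real (Suc n)) + exp C * (C * (2 * (1 / real n)) + r n)) + (exp C * C * 3) * \<bar>centered_desc n \<pi>\<bar>)"
      proof (rule average_mono)
        fix \<pi>
        define Q where "Q = quadratic_term (1 / n) (desc n \<pi> / n)"
        have Q: "\<bar>Q\<bar> \<le> 4" unfolding Q_def
          using desc_ratio_bounds[OF elim, of \<pi>] elim by (intro abs_quadratic_term_le) auto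
        have Qg: "\<bar>Q - g (a n)\<bar> \<le> 2 * (1 / n) + 3 * \<bar>centered_desc n \<pi>\<bar>"
          unfolding Q_def g_def centered_desc_def
          using desc_ratio_bounds[OF elim, of \<pi>] elim a_bounds[OF elim] by (intro quadratic_term_diff) auto
        have vC: "\<bar>v n \<pi>\<bar> \<le> C"
          using mult_left_mono[of "\<bar>Q\<bar>" 8 "\<bar>u n\<bar>"] uC[of n] Q unfolding v_def Q_def[symmetric] abs_mult by linarith
        have "of_real G * cis (Z n \<pi>) - cis (Z' n \<pi>) * exp (of_real (v n \<pi>)) =
            of_real G * (cis (Z n \<pi>) - cis (Z' n \<pi>)) + cis (Z' n \<pi>) * of_real (exp (u0 * g \<alpha>) - exp (v n \<pi>))"
          by (simp add: G_def algebra_simps exp_of_real)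
        also have "norm \<dots> \<le> G * \<bar>Z n \<pi> - Z' n \<pi>\<bar> + \<bar>exp (u0 * g \<alpha>) - exp (v n \<pi>)\<bar>"
        proof (rule order_trans[OF norm_triangle_ineq], rule add_mono)
          show "norm (of_real G * (cis (Z n \<pi>) - cis (Z' n \<pi>))) \<le> G * \<bar>Z n \<pi> - Z' n \<pi>\<bar>"
            using norm_cis_diff_le[of "Z n \<pi>" "Z' n \<pi>"] by (simp add: norm_mult G_def mult_left_mono)
          show "norm (cis (Z' n \<pi>) * of_real (exp (u0 * g \<alpha>) - exp (v n \<pi>))) \<le> \<bar>exp (u0 * g \<alpha>) - exp (v n \<pi>)\<bar>"
            unfolding norm_mult norm_of_real by simp
        qed
        also have "\<bar>Z n \<pi> - Z' n \<pi>\<bar> \<le> 1 / real (Suc n) * sqrt n"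
        proof -
          have "Z n \<pi> - Z' n \<pi> = (t - \<tau> n) * scaled_maj n (a n) \<pi>" by (simp add: Z_def Z'_def algebra_simps)
          then show ?thesis using \<tau>(1)[of n] scaled_maj_le[OF elim, of \<pi>]
            by (simp only: abs_mult) (intro mult_mono, auto simp: abs_minus_commute)
        qed
        also have "\<bar>exp (u0 * g \<alpha>) - exp (v n \<pi>)\<bar> \<le> exp C * \<bar>u0 * g \<alpha> - v n \<pi>\<bar>"
          by (rule exp_diff_le[OF gC vC])
        also have "\<bar>u0 * g \<alpha> - v n \<pi>\<bar> \<le> C * (2 * (1 / real n) + 3 * \<bar>centered_desc n \<pi>\<bar>) + r n"
        proof -
          have "u0 * g \<alpha> - v n \<pi> = - (u n * (Q - g (a n))) - (u n * g (a n) - u0 * g \<alpha>)"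
            by (simp add: v_def Q_def algebra_simps)
          then have "\<bar>u0 * g \<alpha> - v n \<pi>\<bar> \<le> \<bar>u n\<bar> * \<bar>Q - g (a n)\<bar> + r n"
            unfolding r_def abs_mult[symmetric] by linarith
          also have "\<bar>u n\<bar> * \<bar>Q - g (a n)\<bar> \<le> C * (2 * (1 / real n) + 3 * \<bar>centered_desc n \<pi>\<bar>)"
            using Qg uC[of n] by (intro mult_mono) auto
          finally show ?thesis by simp
        qed
        finally show "norm (of_real G * cis (Z n \<pi>) - cis (Z' n \<pi>) * exp (of_real (v n \<pi>))) \<le>
            (G * (sqrt n / real (Suc n)) + exp C * (C * (2 * (1 / real n)) + r n)) + (exp C * C * 3) * \<bar>centered_desc n \<pi>\<bar>"
          by (simp add: G_def algebra_simps)
      qed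
      also have "\<dots> = G * (sqrt n / real (Suc n)) + exp C * (C * (2 * (1 / real n) + 3 * average (A n) (\<lambda>\<pi>. \<bar>centered_desc n \<pi>\<bar>)) + r n)"
        unfolding average_add average_mult_left average_const[OF finite_A[OF elim] A_ne[OF elim]]
        by (simp add: algebra_simps)
      finally show ?case .
    qed
  qed
  ultimately have "(\<lambda>n. average (A n) (\<lambda>\<pi>. cis (Z' n \<pi>) * exp (of_real (v n \<pi>))) +
      average (A n) (\<lambda>\<pi>. of_real G * cis (Z n \<pi>) - cis (Z' n \<pi>) * exp (of_real (v n \<pi>)))) \<longlonglongrightarrow>
      exp (of_real (s * (s + t) * \<alpha> ^ 3 / 6 - t\<^sup>2 * (1 - \<alpha> ^ 3) / 72)) + 0"
    by (rule tendsto_add)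
  then have "(\<lambda>n. of_real G * average (A n) (\<lambda>\<pi>. cis (Z n \<pi>))) \<longlonglongrightarrow>
      exp (of_real (s * (s + t) * \<alpha> ^ 3 / 6 - t\<^sup>2 * (1 - \<alpha> ^ 3) / 72))"
    unfolding average_diff average_mult_left by simp
  then have "(\<lambda>n. inverse (of_real G) * (of_real G * average (A n) (\<lambda>\<pi>. cis (Z n \<pi>)))) \<longlonglongrightarrow>
      inverse (of_real G) * exp (of_real (s * (s + t) * \<alpha> ^ 3 / 6 - t\<^sup>2 * (1 - \<alpha> ^ 3) / 72))"
    by (rule tendsto_mult_left)
  moreover have "inverse (of_real G) * exp (of_real (s * (s + t) * \<alpha> ^ 3 / 6 - t\<^sup>2 * (1 - \<alpha> ^ 3) / 72)) =
      exp (of_real (- ((s\<^sup>2 + s * t) * (1 - 4 * \<alpha> ^ 3 + 3 * \<alpha> ^ 4) / 12 + t\<^sup>2 * (1 - \<alpha> ^ 3) / 36) / 2) :: complex)"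
  proof -
    have e: "- (u0 * g \<alpha>) + (s * (s + t) * \<alpha> ^ 3 / 6 - t\<^sup>2 * (1 - \<alpha> ^ 3) / 72) =
        - ((s\<^sup>2 + s * t) * (1 - 4 * \<alpha> ^ 3 + 3 * \<alpha> ^ 4) / 12 + t\<^sup>2 * (1 - \<alpha> ^ 3) / 36) / 2"
      by (simp add: u0_def g_def power2_eq_square field_simps)
    have "inverse (of_real G) = (of_real (exp (- (u0 * g \<alpha>))) :: complex)"
      by (simp add: G_def exp_minus)
    then show ?thesis by (simp only: e[symmetric] exp_add of_real_mult exp_of_real)
  qed
  moreover have "inverse (of_real G) * (of_real G * x) = x" for x :: complex
    by (simp add: G_def field_simps)
  ultimately show ?thesis unfolding Z_def by simp
qed

end

section \<open>Convergence of characteristic functions on Euclidean space\<close>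

text \<open>The functions whose means are controlled directly by characteristic functions. Being
  closed under products, they include every polynomial in the real coordinates of
  \<open>torus_map\<close>.\<close>

inductive trig_polynomial :: "((real ^ 'n) \<Rightarrow> complex) \<Rightarrow> bool" where
  monomial: "trig_polynomial (\<lambda>x. c * cis (v \<bullet> x))"
| add: "trig_polynomial f \<Longrightarrow> trig_polynomial g \<Longrightarrow> trig_polynomial (\<lambda>x. f x + g x)"

lemma trig_polynomial_const: "trig_polynomial (\<lambda>x. c)"
  using trig_polynomial.monomial[of c 0] by simp

lemma trig_polynomial_mult_monomial:
  assumes "trig_polynomial f"
  shows "trig_polynomial (\<lambda>x. f x * (c * cis (v \<bullet> x)))"
  using assms
proof induction
  case (monomial d u)
  have "(\<lambda>x. d * cis (u \<bullet> x) * (c * cis (v \<bullet> x))) = (\<lambda>x. (d * c) * cis ((u + v) \<bullet> x))"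
    by (simp add: fun_eq_iff inner_add_left mult_ac flip: cis_mult)
  then show ?case by (simp only: trig_polynomial.monomial)
next
  case (add f g)
  then show ?case unfolding distrib_right by (intro trig_polynomial.add)
qed

lemma trig_polynomial_mult:
  assumes "trig_polynomial f" "trig_polynomial g"
  shows "trig_polynomial (\<lambda>x. f x * g x)"
  using assms(2)
proof induction
  case (monomial c v)
  show ?case by (rule trig_polynomial_mult_monomial[OF assms(1)])
next
  case (add g h)
  then show ?case unfolding distrib_left by (intro trig_polynomial.add)
qed

lemma trig_polynomial_sum: "finite I \<Longrightarrow> (\<And>i. i \<in> I \<Longrightarrow> trig_polynomial (f i)) \<Longrightarrow> trig_polynomial (\<lambda>x. \<Sum>i\<in>I. f i x)"
proof (induction I rule: finite_induct)
  case empty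
  show ?case unfolding sum.empty by (rule trig_polynomial_const)
next
  case (insert i I)
  have "trig_polynomial (f i)" by (rule insert.prems) simp
  moreover have "trig_polynomial (\<lambda>x. \<Sum>i\<in>I. f i x)" by (rule insert.IH, rule insert.prems) simp
  ultimately have "trig_polynomial (\<lambda>x. f i x + (\<Sum>i\<in>I. f i x))" by (rule trig_polynomial.add)
  then show ?case unfolding sum.insert[OF insert.hyps] .
qed

lemma trig_polynomial_cos: "trig_polynomial (\<lambda>x. of_real (cos (v \<bullet> x)))"
proof -
  have "(\<lambda>x. of_real (cos (v \<bullet> x))) = (\<lambda>x. (1 / 2) * cis (v \<bullet> x) + (1 / 2) * cis ((- v) \<bullet> x))"
    by (simp add: fun_eq_iff complex_eq_iff)
  then show ?thesis by (simp only: trig_polynomial.add[OF trig_polynomial.monomial trig_polynomial.monomial])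
qed

lemma trig_polynomial_sin: "trig_polynomial (\<lambda>x. of_real (sin (v \<bullet> x)))"
proof -
  have "(\<lambda>x. of_real (sin (v \<bullet> x))) = (\<lambda>x. (- \<i> / 2) * cis (v \<bullet> x) + (\<i> / 2) * cis ((- v) \<bullet> x))"
    by (simp add: fun_eq_iff complex_eq_iff)
  then show ?thesis by (simp only: trig_polynomial.add[OF trig_polynomial.monomial trig_polynomial.monomial])
qed

text \<open>Wraps Euclidean space around a compact torus. On the box |x_i| \<le> L the angles stay
  within one radian of 0, where the sine already separates points, so the map is injective
  there.\<close>

definition torus_map :: "real \<Rightarrow> real ^ 'n \<Rightarrow> complex ^ 'n" where
  "torus_map L x = (\<chi> i. cis (x $ i / L))"

lemma trig_polynomial_torus:
  fixes g :: "complex ^ 'n \<Rightarrow> real"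
  assumes "real_polynomial_function g"
  shows "trig_polynomial (\<lambda>x. of_real (g (torus_map L x)))"
  using assms
proof induction
  case (linear h)
  have h: "h z = (\<Sum>b\<in>Basis. (z \<bullet> b) * h b)" for z
  proof -
    interpret bounded_linear h by fact
    have "h z = h (\<Sum>b\<in>Basis. (z \<bullet> b) *\<^sub>R b)" by (simp add: euclidean_representation)
    also have "\<dots> = (\<Sum>b\<in>Basis. (z \<bullet> b) * h b)" by (simp add: sum scaleR)
    finally show ?thesis .
  qed
  have coord: "trig_polynomial (\<lambda>x. of_real (torus_map L x \<bullet> b))" if "b \<in> Basis" for b :: "complex ^ 'n"
  proof -
    have "\<exists>i c. b = axis i c \<and> (c = 1 \<or> c = \<i>)"
      using that by (auto simp: Basis_vec_def Basis_complex_def)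
    then obtain i c where b: "b = axis i c" "c = 1 \<or> c = \<i>" by blast
    have e: "x $ i / L = axis i (1 / L) \<bullet> x" for x :: "real ^ 'n"
      by (simp add: inner_axis')
    have "torus_map L x \<bullet> b = cis (axis i (1 / L) \<bullet> x) \<bullet> c" for x
      by (simp add: b(1) inner_axis torus_map_def e)
    then show ?thesis using b(2) trig_polynomial_cos[of "axis i (1 / L)"] trig_polynomial_sin[of "axis i (1 / L)"]
      by (auto simp: inner_complex_def)
  qed
  have "trig_polynomial (\<lambda>x. \<Sum>b\<in>Basis. of_real (torus_map L x \<bullet> b) * of_real (h b))"
    by (intro trig_polynomial_sum trig_polynomial_mult coord trig_polynomial_const) auto
  moreover have "of_real (h (torus_map L x)) = (\<Sum>b\<in>Basis. of_real (torus_map L x \<bullet> b) * complex_of_real (h b))" for x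
    by (subst h) simp
  ultimately show ?case by (simp only:)
next
  case (const c)
  then show ?case by (rule trig_polynomial_const)
next
  case (add f g)
  then show ?case unfolding of_real_add by (intro trig_polynomial.add)
next
  case (mult f g)
  then show ?case unfolding of_real_mult by (intro trig_polynomial_mult)
qed

text \<open>The setting of the continuity theorem in several variables with a given limit law. Tails
  are bounded by applying the one-dimensional Levy theorem to each coordinate; inside a large box,
  trigonometric polynomials approximate.\<close>

locale charfun_convergence =
  fixes M :: "nat \<Rightarrow> (real ^ 'n) measure" and N :: "(real ^ 'n) measure"
  assumes M: "\<And>k. prob_space (M k)" "\<And>k. sets (M k) = sets borel"
    and N: "prob_space N" "sets N = sets borel"
    and conv: "\<And>v. (\<lambda>k. \<integral>x. cis (v \<bullet> x) \<partial>M k) \<longlonglongrightarrow> (\<integral>x. cis (v \<bullet> x) \<partial>N)"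
begin

lemma measurable_M: "measurable (M k) = measurable borel" "measurable N = measurable borel"
  using M(2)[of k] N(2) by (auto intro!: measurable_cong_sets ext)

lemma integrable_bounded:
  fixes f :: "real ^ 'n \<Rightarrow> 'b::{banach, second_countable_topology}"
  assumes "f \<in> borel_measurable borel" "\<And>x. norm (f x) \<le> B"
  shows "integrable (M k) f" "integrable N f"
proof -
  interpret M: prob_space "M k" by (rule M)
  interpret N: prob_space N by (rule N)
  show "integrable (M k) f" using assms by (intro M.integrable_const_bound[of _ B]) (auto simp: measurable_M)
  show "integrable N f" using assms by (intro N.integrable_const_bound[of _ B]) (auto simp: measurable_M)
qed

lemma trig_polynomial_conv:
  assumes "trig_polynomial f"
  shows "f \<in> borel_measurable borel \<and> (\<exists>B. \<forall>x. norm (f x) \<le> B) \<and>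
    (\<lambda>k. \<integral>x. f x \<partial>M k) \<longlonglongrightarrow> (\<integral>x. f x \<partial>N)"
  using assms
proof induction
  case (monomial c v)
  have "(\<lambda>x. c * cis (v \<bullet> x)) \<in> borel_measurable borel"
    by (intro borel_measurable_continuous_onI continuous_intros)
  moreover have "norm (c * cis (v \<bullet> x)) \<le> norm c" for x by (simp add: norm_mult)
  ultimately show ?case using tendsto_mult_left[OF conv[of v], of c] by auto
next
  case (add f g)
  then obtain B C where B: "\<And>x. norm (f x) \<le> B" and C: "\<And>x. norm (g x) \<le> C" by blast
  have "norm (f x + g x) \<le> B + C" for x using norm_triangle_ineq[of "f x" "g x"] B[of x] C[of x] by linarith
  moreover have "(\<integral>x. f x + g x \<partial>M k) = (\<integral>x. f x \<partial>M k) + (\<integral>x. g x \<partial>M k)" for k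
    using add.IH B C by (intro Bochner_Integration.integral_add integrable_bounded) auto
  moreover have "(\<integral>x. f x + g x \<partial>N) = (\<integral>x. f x \<partial>N) + (\<integral>x. g x \<partial>N)"
    using add.IH B C by (intro Bochner_Integration.integral_add integrable_bounded) auto
  ultimately show ?case using add.IH by (auto intro!: tendsto_add)
qed

text \<open>The characteristic function of a coordinate is that of the vector along an axis.\<close>

lemma coordinate_conv:
  fixes h :: "real \<Rightarrow> real"
  assumes "continuous_on UNIV h" "\<And>x. \<bar>h x\<bar> \<le> B"
  shows "(\<lambda>k. \<integral>x. h (x $ i) \<partial>M k) \<longlonglongrightarrow> (\<integral>x. h (x $ i) \<partial>N)"
proof -
  have meas: "(\<lambda>x. x $ i) \<in> borel_measurable borel" for i :: 'n
    by (intro borel_measurable_continuous_onI continuous_intros)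
  then have mM: "(\<lambda>x. x $ i) \<in> borel_measurable (M k)" "(\<lambda>x. x $ i) \<in> borel_measurable N" for k
    by (simp_all add: measurable_M)
  have rd: "real_distribution (distr (M k) borel (\<lambda>x. x $ i))" "real_distribution (distr N borel (\<lambda>x. x $ i))" for k
    using prob_space.prob_space_distr[OF M(1) mM(1)] prob_space.prob_space_distr[OF N(1) mM(2)]
    by (auto simp: real_distribution_def real_distribution_axioms_def)
  have h: "h \<in> borel_measurable borel" using assms(1) by (rule borel_measurable_continuous_onI)
  have ax: "t * x $ i = axis i t \<bullet> x" for t and x :: "real ^ 'n" by (simp add: inner_axis')
  have "weak_conv_m (\<lambda>k. distr (M k) borel (\<lambda>x. x $ i)) (distr N borel (\<lambda>x. x $ i))"
  proof (rule levy_continuity[OF rd])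
    fix t
    have "char (distr (M k) borel (\<lambda>x. x $ i)) t = (\<integral>x. cis (axis i t \<bullet> x) \<partial>M k)"
      "char (distr N borel (\<lambda>x. x $ i)) t = (\<integral>x. cis (axis i t \<bullet> x) \<partial>N)" for k
      unfolding char_def cis_conv_exp ax[symmetric] by (subst integral_distr; simp add: mM)+
    then show "(\<lambda>k. char (distr (M k) borel (\<lambda>x. x $ i)) t) \<longlonglongrightarrow> char (distr N borel (\<lambda>x. x $ i)) t"
      using conv by simp
  qed
  from weak_conv_imp_integral_bdd_continuous_conv[OF rd this, of h B]
  have "(\<lambda>k. integral\<^sup>L (distr (M k) borel (\<lambda>x. x $ i)) h) \<longlonglongrightarrow> integral\<^sup>L (distr N borel (\<lambda>x. x $ i)) h"
    using assms by (auto simp: continuous_on_eq_continuous_at)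
  then show ?thesis using h by (simp add: integral_distr mM)
qed

text \<open>A continuous ramp, 0 up to |y| = K and 1 from |y| = K + 1 on, so that weak convergence
  of the coordinates applies to it.\<close>

definition tail :: "real \<Rightarrow> real \<Rightarrow> real" where
  "tail K y = min 1 (max 0 (\<bar>y\<bar> - K))"

lemma tail_props: "continuous_on UNIV (tail K)" "\<bar>tail K y\<bar> \<le> 1" "0 \<le> tail K y" "K + 1 \<le> \<bar>y\<bar> \<Longrightarrow> tail K y = 1"
  unfolding tail_def by (auto intro!: continuous_intros)

lemma tail_measurable: "(\<lambda>x. tail K (x $ i)) \<in> borel_measurable borel" for i :: 'n
  by (intro borel_measurable_continuous_onI continuous_on_compose2[OF tail_props(1)] continuous_intros) auto

lemma tail_N: "(\<lambda>j. \<integral>x. tail (real j) (x $ i) \<partial>N) \<longlonglongrightarrow> 0"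
proof -
  interpret N: prob_space N by (rule N)
  have "(\<lambda>j. \<integral>x. tail (real j) (x $ i) \<partial>N) \<longlonglongrightarrow> (\<integral>x. 0 \<partial>N)"
  proof (rule integral_dominated_convergence[where w = "\<lambda>_. 1"])
    show "AE x in N. (\<lambda>j. tail (real j) (x $ i)) \<longlonglongrightarrow> 0"
    proof (rule AE_I2)
      fix x
      have "eventually (\<lambda>j. tail (real j) (x $ i) = 0) sequentially"
        using eventually_ge_at_top[of "nat \<lceil>\<bar>x $ i\<bar>\<rceil>"]
      proof eventually_elim
        case (elim j)
        then have "\<bar>x $ i\<bar> \<le> real j" by linarith
        then show ?case by (simp add: tail_def)
      qed
      then show "(\<lambda>j. tail (real j) (x $ i)) \<longlonglongrightarrow> 0" by (rule tendsto_eventually)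
    qed
  qed (simp_all add: measurable_M tail_measurable tail_props(2))
  then show ?thesis by simp
qed

text \<open>What is needed is a trigonometric polynomial close to \<open>f\<close> on a box and
  bounded on the whole space by a constant that does not grow with the box. Transporting
  \<open>f\<close> to the torus, extending it by Tietze with the same bound and approximating it on
  a ball that contains the entire torus achieves both.\<close>

lemma converges: "converges_in_distribution M N"
  unfolding converges_in_distribution_def
proof (intro allI impI)
  fix f :: "real ^ 'n \<Rightarrow> real"
  assume f: "continuous_on UNIV f \<and> bounded (range f)"
  then have fc: "continuous_on UNIV f" by blast
  obtain B where B: "B \<ge> 0" "\<And>x. \<bar>f x\<bar> \<le> B"
    using f unfolding bounded_iff by (metis UNIV_I abs_ge_zero image_eqI order_trans real_norm_def)
  have fm: "f \<in> borel_measurable borel" using fc by (rule borel_measurable_continuous_onI)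
  show "(\<lambda>k. \<integral>x. f x \<partial>M k) \<longlonglongrightarrow> (\<integral>x. f x \<partial>N)"
  proof (rule tendstoI)
    fix e :: real assume "e > 0"
    \<comment> \<open>The final error is 3 \<epsilon> + 4 B \<epsilon>, with the constants rounded
      up.\<close>
    define \<epsilon> where "\<epsilon> = e / (4 + 6 * B)"
    have \<epsilon>: "\<epsilon> > 0" using \<open>e > 0\<close> B by (simp add: \<epsilon>_def)
    define H where "H K x = (\<Sum>i\<in>UNIV. tail K (x $ i))" for K and x :: "real ^ 'n"
    have Hb: "norm (H K x) \<le> CARD('n)" for K x
      unfolding H_def using tail_props(2) by (intro order_trans[OF norm_sum] order_trans[OF sum_bounded_above[of _ _ 1]]) auto
    have Hm: "H K \<in> borel_measurable borel" for K unfolding H_def[abs_def] using tail_measurable by measurable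
    have HN: "(\<integral>x. H K x \<partial>N) = (\<Sum>i\<in>UNIV. \<integral>x. tail K (x $ i) \<partial>N)"
      and HM: "(\<integral>x. H K x \<partial>M k) = (\<Sum>i\<in>UNIV. \<integral>x. tail K (x $ i) \<partial>M k)" for K k
      unfolding H_def using tail_props(2)
      by (intro Bochner_Integration.integral_sum integrable_bounded[of _ 1] tail_measurable; simp)+
    have "(\<lambda>j. \<integral>x. H (real j) x \<partial>N) \<longlonglongrightarrow> (\<Sum>i\<in>(UNIV :: 'n set). 0)"
      unfolding HN by (intro tendsto_sum tail_N)
    then have "eventually (\<lambda>j. (\<integral>x. H (real j) x \<partial>N) < \<epsilon>) sequentially"
      using \<epsilon> by (intro order_tendstoD) auto
    then obtain j where j: "(\<integral>x. H (real j) x \<partial>N) < \<epsilon>" by (auto dest: eventually_happens)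
    define K where "K = real j"
    have "(\<lambda>k. \<integral>x. H K x \<partial>M k) \<longlonglongrightarrow> (\<integral>x. H K x \<partial>N)"
      unfolding HN HM by (intro tendsto_sum coordinate_conv[of _ 1] tail_props)
    then have ev1: "eventually (\<lambda>k. (\<integral>x. H K x \<partial>M k) < \<epsilon>) sequentially"
      using j by (intro order_tendstoD) (auto simp: K_def)
    define L where "L = K + 1"
    have L: "L > 0" by (simp add: L_def K_def)
    define Bx where "Bx = {x :: real ^ 'n. \<forall>i. \<bar>x $ i\<bar> \<le> L}"
    have H1: "1 \<le> H K x" if "x \<notin> Bx" for x
    proof -
      have "\<exists>i. L < \<bar>x $ i\<bar>" using that by (auto simp: Bx_def not_le)
      then obtain i where "L < \<bar>x $ i\<bar>" by blast
      then have "tail K (x $ i) = 1" by (intro tail_props) (simp add: L_def)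
      then show ?thesis unfolding H_def
        using member_le_sum[of i UNIV "\<lambda>i. tail K (x $ i)"] tail_props(3) by simp
    qed
    have H0: "0 \<le> H K x" for x unfolding H_def by (intro sum_nonneg tail_props)
    define T :: "real ^ 'n \<Rightarrow> complex ^ 'n" where "T = torus_map L"
    have "Bx = cbox (\<chi> i. - L) (\<chi> i. L)" by (auto simp: Bx_def mem_box_cart abs_le_iff minus_le_iff)
    then have cB: "compact Bx" by simp
    have Tc: "continuous_on A T" for A
      unfolding T_def torus_map_def[abs_def] by (intro continuous_intros) (use L in auto)
    have inj: "inj_on T Bx"
    proof (rule inj_onI)
      fix x y assume xy: "x \<in> Bx" "y \<in> Bx" "T x = T y"
      have half: "- (pi / 2) \<le> z \<and> z \<le> pi / 2" if "\<bar>z\<bar> \<le> 1" for z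
        using that pi_gt3 by linarith
      have "x $ i = y $ i" for i
      proof -
        have "cis (x $ i / L) = cis (y $ i / L)" using xy(3) by (auto simp: T_def torus_map_def vec_eq_iff)
        from arg_cong[OF this, of Im] have "sin (x $ i / L) = sin (y $ i / L)" by simp
        moreover have "\<bar>x $ i / L\<bar> \<le> 1" "\<bar>y $ i / L\<bar> \<le> 1" using xy L by (auto simp: Bx_def)
        ultimately have "x $ i / L = y $ i / L"
          using half[of "x $ i / L"] half[of "y $ i / L"] by (intro sin_inj_pi[of "x $ i / L" "y $ i / L"]) blast+
        then show ?thesis using L by simp
      qed
      then show "x = y" by (simp add: vec_eq_iff)
    qed
    obtain g where g: "homeomorphism Bx (T ` Bx) T g"
      using homeomorphism_compact[OF cB Tc refl inj] by blast
    have gc: "continuous_on (T ` Bx) g" "\<And>x. x \<in> Bx \<Longrightarrow> g (T x) = x" using g by (auto simp: homeomorphism_def)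
    have fg: "continuous_on (T ` Bx) (\<lambda>z. f (g z))"
      by (rule continuous_on_compose2[OF fc gc(1)]) simp
    have "closed (T ` Bx)" using compact_continuous_image[OF Tc cB] by (rule compact_imp_closed)
    then have cl: "closedin (top_of_set UNIV) (T ` Bx)" by simp
    obtain F where F: "continuous_on UNIV F" "\<And>z. z \<in> T ` Bx \<Longrightarrow> F z = f (g z)" "\<And>z. norm (F z) \<le> B"
      using Tietze[OF fg cl B(1)] B(2) by (metis UNIV_I real_norm_def)
    have cT: "T x \<in> cball 0 CARD('n)" for x
    proof -
      have "norm (T x) \<le> (\<Sum>i\<in>UNIV. norm (T x $ i))" unfolding norm_vec_def by (rule L2_set_le_sum) simp
      also have "\<dots> = CARD('n)" by (simp add: T_def torus_map_def)
      finally show ?thesis by simp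
    qed
    obtain p where p: "real_polynomial_function p" "\<And>z. z \<in> cball 0 CARD('n) \<Longrightarrow> \<bar>F z - p z\<bar> < \<epsilon>"
      using Stone_Weierstrass_real_polynomial_function[OF compact_cball continuous_on_subset[OF F(1)] \<epsilon>, of 0 "CARD('n)"] by auto
    define P where "P x = p (T x)" for x
    have trig: "trig_polynomial (\<lambda>x. of_real (P x))" unfolding P_def T_def by (rule trig_polynomial_torus[OF p(1)])
    have "(\<lambda>x. complex_of_real (P x)) \<in> borel_measurable borel" using trig_polynomial_conv[OF trig] by blast
    then have "(\<lambda>x. Re (complex_of_real (P x))) \<in> borel_measurable borel" by measurable
    then have Pm: "P \<in> borel_measurable borel" by simp
    have PF: "\<bar>F (T x) - P x\<bar> < \<epsilon>" for x unfolding P_def using p(2)[OF cT] .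
    have Pb: "norm (P x) \<le> B + \<epsilon>" for x using PF[of x] F(3)[of "T x"] by simp
    \<comment> \<open>Off the box only the bounds on \<open>f\<close> and \<open>P\<close> remain,
      and they are charged to \<open>H\<close>, which is at least 1 there.\<close>
    have diff: "\<bar>f x - P x\<bar> \<le> \<epsilon> + 2 * B * H K x" for x
    proof (cases "x \<in> Bx")
      case True
      then have "F (T x) = f x" using F(2)[of "T x"] gc(2) by auto
      then have "\<bar>f x - P x\<bar> \<le> \<epsilon>" using PF[of x] by simp
      then show ?thesis using H0[of x] B(1) by (smt (verit) mult_nonneg_nonneg)
    next
      case False
      have "\<bar>f x - P x\<bar> \<le> \<epsilon> + 2 * B" using PF[of x] F(3)[of "T x"] B(2)[of x] by simp
      also have "\<dots> \<le> \<epsilon> + 2 * B * H K x" using H1[OF False] B(1) by (simp add: mult_left_le mult_le_cancel_left1)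
      finally show ?thesis .
    qed
    have est: "\<bar>(\<integral>x. f x \<partial>X) - (\<integral>x. P x \<partial>X)\<bar> \<le> \<epsilon> + 2 * B * (\<integral>x. H K x \<partial>X)" if "X = N \<or> (\<exists>k. X = M k)" for X
    proof -
      interpret X: prob_space X using that M N by auto
      have i: "integrable X f" "integrable X P" "integrable X (H K)"
        using that integrable_bounded[OF fm, of B] integrable_bounded[OF Pm Pb] integrable_bounded[OF Hm Hb] B by auto
      have "\<bar>(\<integral>x. f x \<partial>X) - (\<integral>x. P x \<partial>X)\<bar> = \<bar>\<integral>x. f x - P x \<partial>X\<bar>" using i by simp
      also have "\<dots> \<le> (\<integral>x. \<bar>f x - P x\<bar> \<partial>X)" by (rule integral_abs_bound)
      also have "\<dots> \<le> (\<integral>x. \<epsilon> + 2 * B * H K x \<partial>X)" using i diff by (intro integral_mono) auto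
      also have "\<dots> = \<epsilon> + 2 * B * (\<integral>x. H K x \<partial>X)" using i X.prob_space by simp
      finally show ?thesis .
    qed
    have "(\<lambda>k. \<integral>x. complex_of_real (P x) \<partial>M k) \<longlonglongrightarrow> (\<integral>x. complex_of_real (P x) \<partial>N)"
      using trig_polynomial_conv[OF trig] by blast
    then have "(\<lambda>k. Re (\<integral>x. complex_of_real (P x) \<partial>M k)) \<longlonglongrightarrow> Re (\<integral>x. complex_of_real (P x) \<partial>N)" by (rule tendsto_Re)
    then have "(\<lambda>k. \<integral>x. P x \<partial>M k) \<longlonglongrightarrow> (\<integral>x. P x \<partial>N)" by simp
    then have ev2: "eventually (\<lambda>k. dist (\<integral>x. P x \<partial>M k) (\<integral>x. P x \<partial>N) < \<epsilon>) sequentially" using \<epsilon> by (rule tendstoD)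
    show "eventually (\<lambda>k. dist (\<integral>x. f x \<partial>M k) (\<integral>x. f x \<partial>N) < e) sequentially"
      using ev1 ev2
    proof eventually_elim
      case (elim k)
      have 1: "2 * B * (\<integral>x. H K x \<partial>M k) \<le> 2 * B * \<epsilon>" using elim(1) B(1) by (intro mult_left_mono) auto
      have 2: "2 * B * (\<integral>x. H K x \<partial>N) \<le> 2 * B * \<epsilon>" using j B(1) by (intro mult_left_mono) (auto simp: K_def)
      have "dist (\<integral>x. f x \<partial>M k) (\<integral>x. f x \<partial>N) < 3 * \<epsilon> + 4 * (B * \<epsilon>)"
      proof -
        have "\<bar>(\<integral>x. f x \<partial>M k) - (\<integral>x. P x \<partial>M k)\<bar> \<le> \<epsilon> + 2 * B * (\<integral>x. H K x \<partial>M k)" by (rule est) blast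
        moreover have "\<bar>(\<integral>x. f x \<partial>N) - (\<integral>x. P x \<partial>N)\<bar> \<le> \<epsilon> + 2 * B * (\<integral>x. H K x \<partial>N)" by (rule est) blast
        moreover have "\<bar>(\<integral>x. P x \<partial>M k) - (\<integral>x. P x \<partial>N)\<bar> < \<epsilon>" using elim(2) by (simp add: dist_real_def)
        moreover have "2 * B * \<epsilon> + 2 * B * \<epsilon> = 4 * (B * \<epsilon>)" by simp
        ultimately show ?thesis using 1 2 unfolding dist_real_def by linarith
      qed
      also have "\<dots> \<le> (4 + 6 * B) * \<epsilon>" using \<epsilon> B(1) by (simp add: algebra_simps)
      also have "\<dots> = e" using B(1) by (simp add: \<epsilon>_def)
      finally show ?case .
    qed
  qed
qed

end

section \<open>Bivariate normal laws\<close>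

abbreviation std_normal :: "real measure" where
  "std_normal \<equiv> std_normal_distribution"

lemma prob_space_std_normal: "prob_space std_normal"
  using real_dist_normal_dist unfolding real_distribution_def by blast

text \<open>Scaling one standard normal variable treats the point mass at \<sigma> = 0 and the
  densities alike.\<close>

lemma normal_law_eq_distr:
  assumes "\<sigma> \<ge> 0"
  shows "normal_law 0 \<sigma> = distr std_normal borel (\<lambda>z. \<sigma> * z)"
proof (cases "\<sigma> = 0")
  case True
  interpret prob_space std_normal by (rule prob_space_std_normal)
  have "distr std_normal borel (\<lambda>z. \<sigma> * z) = distr std_normal borel (\<lambda>z. 0)" using True by simp
  also have "\<dots> = return borel 0" by (rule distr_const) simp
  finally show ?thesis using True by (simp add: normal_law_def)
next
  case False
  interpret prob_space std_normal by (rule prob_space_std_normal)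
  have "distributed std_normal lborel (\<lambda>z. z) (normal_density 0 1)"
    unfolding distributed_def by (auto intro!: distr_id2 measurable_ident_sets)
  then have "distributed std_normal lborel (\<lambda>z. 0 + \<sigma> * z) (normal_density (0 + \<sigma> * 0) (\<bar>\<sigma>\<bar> * 1))"
    using False by (intro normal_density_affine) auto
  then have "distr std_normal lborel (\<lambda>z. \<sigma> * z) = density lborel (normal_density 0 \<sigma>)"
    using assms by (simp add: distributed_def)
  moreover have "distr std_normal lborel (\<lambda>z. \<sigma> * z) = distr std_normal borel (\<lambda>z. \<sigma> * z)"
    by (rule distr_cong) auto
  ultimately show ?thesis using False by (simp add: normal_law_def)
qed

definition normal_pair :: "(real \<times> real) measure" where
  "normal_pair = std_normal \<Otimes>\<^sub>M std_normal"

lemma prob_space_normal_pair: "prob_space normal_pair"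
proof -
  interpret pair_prob_space std_normal std_normal
    by (simp add: pair_prob_space_def pair_sigma_finite_def prob_space_std_normal prob_space_imp_sigma_finite)
  show ?thesis unfolding normal_pair_def by unfold_locales
qed

lemma sets_normal_pair: "sets normal_pair = sets borel"
  unfolding normal_pair_def borel_prod[symmetric] by (intro sets_pair_measure_cong) simp_all

lemma measurable_normal_pair: "measurable normal_pair = measurable borel"
  by (intro ext measurable_cong_sets sets_normal_pair refl)

lemma integral_std_normal_cis: "(\<integral>z. cis (t * z) \<partial>std_normal) = of_real (exp (- t\<^sup>2 / 2))"
  using fun_cong[OF char_std_normal_distribution, of t] unfolding char_def cis_conv_exp by simp

lemma integral_normal_pair_cis:
  "(\<integral>z. cis (p * fst z + q * snd z) \<partial>normal_pair) = of_real (exp (- (p\<^sup>2 + q\<^sup>2) / 2))"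
proof -
  interpret P: pair_prob_space std_normal std_normal
    by (simp add: pair_prob_space_def pair_sigma_finite_def prob_space_std_normal prob_space_imp_sigma_finite)
  interpret N: prob_space normal_pair by (rule prob_space_normal_pair)
  have "(\<lambda>z. cis (p * fst z + q * snd z)) \<in> borel_measurable (borel :: (real \<times> real) measure)"
    by (intro borel_measurable_continuous_onI continuous_intros)
  then have "integrable normal_pair (\<lambda>z. cis (p * fst z + q * snd z))"
    by (intro N.integrable_const_bound[of _ 1]) (auto simp: measurable_normal_pair)
  then have "(\<integral>z. cis (p * fst z + q * snd z) \<partial>normal_pair) = (\<integral>x. \<integral>y. cis (p * x + q * y) \<partial>std_normal \<partial>std_normal)"
    unfolding normal_pair_def by (subst P.integral_fst'[symmetric]) simp_all
  also have "\<dots> = (\<integral>x. cis (p * x) * of_real (exp (- q\<^sup>2 / 2)) \<partial>std_normal)"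
    unfolding cis_mult[symmetric] by (simp add: integral_std_normal_cis)
  also have "\<dots> = of_real (exp (- p\<^sup>2 / 2)) * of_real (exp (- q\<^sup>2 / 2))"
    by (simp add: integral_std_normal_cis)
  also have "\<dots> = of_real (exp (- (p\<^sup>2 + q\<^sup>2) / 2))"
    unfolding of_real_mult[symmetric] exp_add[symmetric] by (simp add: add_divide_distrib diff_divide_distrib)
  finally show ?thesis .
qed

lemma real_distribution_distr:
  assumes "prob_space P" "f \<in> borel_measurable P"
  shows "real_distribution (distr P borel f)"
  using prob_space.prob_space_distr[OF assms] by (simp add: real_distribution_def real_distribution_axioms_def)

text \<open>The characteristic functions agree, and Levy uniqueness identifies the laws.\<close>

lemma distr_normal_pair_linear:
  "distr normal_pair borel (\<lambda>z. p * fst z + q * snd z) = normal_law 0 (sqrt (p\<^sup>2 + q\<^sup>2))"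
proof -
  define \<sigma> where "\<sigma> = sqrt (p\<^sup>2 + q\<^sup>2)"
  have m: "(\<lambda>z. p * fst z + q * snd z) \<in> borel_measurable normal_pair"
    unfolding measurable_normal_pair by (intro borel_measurable_continuous_onI continuous_intros)
  have "distr normal_pair borel (\<lambda>z. p * fst z + q * snd z) = distr std_normal borel (\<lambda>z. \<sigma> * z)"
  proof (rule Levy_uniqueness)
    show "real_distribution (distr normal_pair borel (\<lambda>z. p * fst z + q * snd z))"
      by (rule real_distribution_distr[OF prob_space_normal_pair m])
    show "real_distribution (distr std_normal borel (\<lambda>z. \<sigma> * z))"
      by (rule real_distribution_distr[OF prob_space_std_normal]) simp
    show "char (distr normal_pair borel (\<lambda>z. p * fst z + q * snd z)) = char (distr std_normal borel (\<lambda>z. \<sigma> * z))"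
    proof
      fix t
      have cm: "(\<lambda>x. iexp (t * x)) \<in> borel_measurable borel"
        by (intro borel_measurable_continuous_onI continuous_intros)
      have "char (distr normal_pair borel (\<lambda>z. p * fst z + q * snd z)) t =
          (\<integral>z. iexp (t * (p * fst z + q * snd z)) \<partial>normal_pair)"
        unfolding char_def by (rule integral_distr[OF m cm])
      also have "\<dots> = (\<integral>z. cis ((t * p) * fst z + (t * q) * snd z) \<partial>normal_pair)"
        unfolding cis_conv_exp by (simp add: algebra_simps)
      also have "\<dots> = of_real (exp (- (t * \<sigma>)\<^sup>2 / 2))"
        unfolding integral_normal_pair_cis by (simp add: \<sigma>_def power_mult_distrib distrib_left)
      also have "\<dots> = (\<integral>z. cis ((t * \<sigma>) * z) \<partial>std_normal)" by (rule integral_std_normal_cis[symmetric])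
      also have "\<dots> = (\<integral>z. iexp (t * (\<sigma> * z)) \<partial>std_normal)" unfolding cis_conv_exp by (simp add: mult.assoc)
      also have "\<dots> = char (distr std_normal borel (\<lambda>z. \<sigma> * z)) t"
        unfolding char_def by (rule integral_distr[OF _ cm, symmetric]) simp
      finally show "char (distr normal_pair borel (\<lambda>z. p * fst z + q * snd z)) t = char (distr std_normal borel (\<lambda>z. \<sigma> * z)) t" .
    qed
  qed
  then show ?thesis using normal_law_eq_distr[of \<sigma>] by (simp add: \<sigma>_def)
qed

lemma normal_law_moments:
  assumes "\<sigma> \<ge> 0"
  shows "(\<integral>x. x \<partial>normal_law 0 \<sigma>) = 0" "integrable (normal_law 0 \<sigma>) (\<lambda>x. x\<^sup>2)"
    "(\<integral>x. x\<^sup>2 \<partial>normal_law 0 \<sigma>) = \<sigma>\<^sup>2"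
proof -
  have m: "(\<lambda>z. \<sigma> * z) \<in> borel_measurable std_normal" by simp
  have "(\<integral>x. x \<partial>normal_law 0 \<sigma>) = (\<integral>z. \<sigma> * z \<partial>std_normal)"
    unfolding normal_law_eq_distr[OF assms] by (rule integral_distr[OF m]) simp
  also have "\<dots> = \<sigma> * (\<integral>z. z ^ 1 \<partial>std_normal)" by simp
  also have "\<dots> = 0" by (subst integral_std_normal_distribution_moment_odd) simp_all
  finally show "(\<integral>x. x \<partial>normal_law 0 \<sigma>) = 0" .
  have i: "integrable std_normal (\<lambda>z. z\<^sup>2)" by (rule integrable_std_normal_distribution_moment)
  show "integrable (normal_law 0 \<sigma>) (\<lambda>x. x\<^sup>2)"
    unfolding normal_law_eq_distr[OF assms] using i
    by (subst integrable_distr_eq[OF m]) (simp_all add: power_mult_distrib)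
  have "(\<integral>x. x\<^sup>2 \<partial>normal_law 0 \<sigma>) = (\<integral>z. (\<sigma> * z)\<^sup>2 \<partial>std_normal)"
    unfolding normal_law_eq_distr[OF assms] by (rule integral_distr[OF m]) simp
  also have "\<dots> = \<sigma>\<^sup>2 * (\<integral>z. z ^ (2 * 1) \<partial>std_normal)" by (simp add: power_mult_distrib)
  also have "\<dots> = \<sigma>\<^sup>2" unfolding std_normal_distribution_even_moments(1) by simp
  finally show "(\<integral>x. x\<^sup>2 \<partial>normal_law 0 \<sigma>) = \<sigma>\<^sup>2" .
qed

lemma inner_real2: "t \<bullet> x = t $ 1 * x $ 1 + t $ 2 * x $ 2" for t x :: "real ^ 2"
  by (simp add: inner_vec_def sum_2)

text \<open>The image of two independent standard normal variables under a lower triangular matrix,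
  a Cholesky factor of the covariance matrix. Entries may be zero, so degenerate laws are
  included.\<close>

definition gaussian2 :: "real \<Rightarrow> real \<Rightarrow> real \<Rightarrow> (real ^ 2) measure" where
  "gaussian2 u v r = distr normal_pair borel (\<lambda>z. vector [u * fst z, v * fst z + r * snd z])"

lemma gaussian2_map_measurable: "(\<lambda>z. vector [u * fst z, v * fst z + r * snd z] :: real ^ 2) \<in> borel_measurable normal_pair"
proof -
  have "continuous_on UNIV (\<lambda>z :: real \<times> real. \<chi> i. (vector [u * fst z, v * fst z + r * snd z] :: real ^ 2) $ i)"
  proof (intro continuous_on_vec_lambda)
    fix i :: 2
    consider "i = 1" | "i = 2" using exhaust_2 by blast
    then show "continuous_on UNIV (\<lambda>z :: real \<times> real. (vector [u * fst z, v * fst z + r * snd z] :: real ^ 2) $ i)"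
      by cases (simp_all add: vector_2, (intro continuous_intros)+)
  qed
  then show ?thesis unfolding measurable_normal_pair by (intro borel_measurable_continuous_onI) simp
qed

lemma gaussian2_basic: "prob_space (gaussian2 u v r)" "sets (gaussian2 u v r) = sets borel"
  unfolding gaussian2_def
  by (simp_all add: prob_space.prob_space_distr[OF prob_space_normal_pair gaussian2_map_measurable])

lemma gaussian2_inner:
  "distr (gaussian2 u v r) borel (\<lambda>x. t \<bullet> x) = normal_law 0 (sqrt ((t $ 1 * u + t $ 2 * v)\<^sup>2 + (t $ 2 * r)\<^sup>2))"
proof -
  have "distr (gaussian2 u v r) borel (\<lambda>x. t \<bullet> x) =
      distr normal_pair borel ((\<lambda>x. t \<bullet> x) \<circ> (\<lambda>z. vector [u * fst z, v * fst z + r * snd z]))"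
    unfolding gaussian2_def
    by (intro distr_distr gaussian2_map_measurable borel_measurable_continuous_onI continuous_intros)
  also have "(\<lambda>x. t \<bullet> x) \<circ> (\<lambda>z. vector [u * fst z, v * fst z + r * snd z]) =
      (\<lambda>z. (t $ 1 * u + t $ 2 * v) * fst z + (t $ 2 * r) * snd z)"
    by (simp add: fun_eq_iff inner_real2 vector_2 algebra_simps)
  finally show ?thesis unfolding distr_normal_pair_linear .
qed

lemma gaussian2_inner_moments:
  fixes t :: "real ^ 2"
  shows "(\<integral>x. t \<bullet> x \<partial>gaussian2 u v r) = 0" "integrable (gaussian2 u v r) (\<lambda>x. (t \<bullet> x)\<^sup>2)"
    "(\<integral>x. (t \<bullet> x)\<^sup>2 \<partial>gaussian2 u v r) = (t $ 1 * u + t $ 2 * v)\<^sup>2 + (t $ 2 * r)\<^sup>2"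
proof -
  have m: "(\<lambda>x. t \<bullet> x) \<in> borel_measurable (gaussian2 u v r)"
    using gaussian2_basic(2)[of u v r]
    by (subst measurable_cong_sets[OF gaussian2_basic(2) refl]) (intro borel_measurable_continuous_onI continuous_intros)
  define \<sigma> where "\<sigma> = sqrt ((t $ 1 * u + t $ 2 * v)\<^sup>2 + (t $ 2 * r)\<^sup>2)"
  have s: "\<sigma> \<ge> 0" by (simp add: \<sigma>_def)
  have d: "distr (gaussian2 u v r) borel (\<lambda>x. t \<bullet> x) = normal_law 0 \<sigma>" unfolding \<sigma>_def by (rule gaussian2_inner)
  have "(\<integral>x. t \<bullet> x \<partial>gaussian2 u v r) = (\<integral>y. y \<partial>normal_law 0 \<sigma>)"
    unfolding d[symmetric] by (rule integral_distr[OF m, symmetric]) simp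
  then show "(\<integral>x. t \<bullet> x \<partial>gaussian2 u v r) = 0" using normal_law_moments(1)[OF s] by simp
  show "integrable (gaussian2 u v r) (\<lambda>x. (t \<bullet> x)\<^sup>2)"
    using normal_law_moments(2)[OF s] unfolding d[symmetric] by (subst (asm) integrable_distr_eq[OF m]) simp_all
  have "(\<integral>x. (t \<bullet> x)\<^sup>2 \<partial>gaussian2 u v r) = (\<integral>y. y\<^sup>2 \<partial>normal_law 0 \<sigma>)"
    unfolding d[symmetric] by (rule integral_distr[OF m, symmetric]) simp
  then show "(\<integral>x. (t \<bullet> x)\<^sup>2 \<partial>gaussian2 u v r) = (t $ 1 * u + t $ 2 * v)\<^sup>2 + (t $ 2 * r)\<^sup>2"
    using normal_law_moments(3)[OF s] by (simp add: \<sigma>_def)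
qed

lemma gaussian2_cis:
  "(\<integral>x. cis (t \<bullet> x) \<partial>gaussian2 u v r) = of_real (exp (- ((t $ 1 * u + t $ 2 * v)\<^sup>2 + (t $ 2 * r)\<^sup>2) / 2))"
proof -
  have "(\<integral>x. cis (t \<bullet> x) \<partial>gaussian2 u v r) = (\<integral>z. cis (t \<bullet> vector [u * fst z, v * fst z + r * snd z]) \<partial>normal_pair)"
    unfolding gaussian2_def
    by (intro integral_distr gaussian2_map_measurable borel_measurable_continuous_onI continuous_intros)
  also have "\<dots> = (\<integral>z. cis ((t $ 1 * u + t $ 2 * v) * fst z + (t $ 2 * r) * snd z) \<partial>normal_pair)"
    by (simp add: inner_real2 vector_2 algebra_simps)
  finally show ?thesis unfolding integral_normal_pair_cis .
qed

lemma gaussian2_multivariate_normal: "multivariate_normal (gaussian2 u v r)"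
  unfolding multivariate_normal_def using gaussian2_basic gaussian2_inner real_sqrt_ge_zero
  by (metis add_nonneg_nonneg zero_le_power2)

lemma gaussian2_mean: "mean_vector (gaussian2 u v r) = 0"
proof -
  have "(\<integral>x. x $ i \<partial>gaussian2 u v r) = 0" for i
    using gaussian2_inner_moments(1)[where t = "axis i 1" and u = u and v = v and r = r] by (simp add: inner_axis')
  then show ?thesis by (simp add: mean_vector_def vec_eq_iff)
qed

text \<open>The mixed moment comes by polarization from the second moments along (1, 1) and (1,
  -1).\<close>

lemma gaussian2_covariance:
  "covariance_matrix (gaussian2 u v r) = vector [vector [u\<^sup>2, u * v], vector [u * v, v\<^sup>2 + r\<^sup>2]]"
proof -
  have 1: "(\<integral>x. x $ 1 * x $ 1 \<partial>gaussian2 u v r) = u\<^sup>2"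
    using gaussian2_inner_moments(3)[where t = "axis 1 1" and u = u and v = v and r = r] by (simp add: inner_real2 power2_eq_square axis_def)
  have 2: "(\<integral>x. x $ 2 * x $ 2 \<partial>gaussian2 u v r) = v\<^sup>2 + r\<^sup>2"
    using gaussian2_inner_moments(3)[where t = "axis 2 1" and u = u and v = v and r = r] by (simp add: inner_real2 power2_eq_square axis_def)
  define s d where "s = (vector [1, 1] :: real ^ 2)" and "d = (vector [1, -1] :: real ^ 2)"
  have "(\<integral>x. x $ 1 * x $ 2 \<partial>gaussian2 u v r) = (\<integral>x. ((s \<bullet> x)\<^sup>2 - (d \<bullet> x)\<^sup>2) / 4 \<partial>gaussian2 u v r)"
    by (simp add: s_def d_def inner_real2 vector_2 power2_eq_square algebra_simps)
  also have "\<dots> = ((\<integral>x. (s \<bullet> x)\<^sup>2 \<partial>gaussian2 u v r) - (\<integral>x. (d \<bullet> x)\<^sup>2 \<partial>gaussian2 u v r)) / 4"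
    using gaussian2_inner_moments(2) by simp
  also have "\<dots> = u * v"
    unfolding gaussian2_inner_moments(3) by (simp add: s_def d_def vector_2 power2_eq_square algebra_simps)
  finally have 3: "(\<integral>x. x $ 1 * x $ 2 \<partial>gaussian2 u v r) = u * v" .
  then have 4: "(\<integral>x. x $ 2 * x $ 1 \<partial>gaussian2 u v r) = u * v" by (simp add: mult.commute)
  show ?thesis
    unfolding covariance_matrix_def gaussian2_mean
    by (simp add: vec_eq_iff forall_2 vector_2 1 2 3 4)
qed

section \<open>The limit theorem\<close>

lemma integral_pmf_of_set_eq_average:
  fixes h :: "'a \<Rightarrow> complex"
  assumes "finite A" "A \<noteq> {}"
  shows "(\<integral>x. h x \<partial>measure_pmf (pmf_of_set A)) = average A h"
proof -
  have "(\<integral>x. h x \<partial>measure_pmf (pmf_of_set A)) = (\<Sum>x\<in>A. pmf (pmf_of_set A) x *\<^sub>R h x)"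
    using assms by (intro integral_measure_pmf) auto
  also have "\<dots> = (\<Sum>x\<in>A. h x / of_nat (card A))"
    using assms by (intro sum.cong refl) (simp add: pmf_of_set scaleR_conv_of_real)
  finally show ?thesis by (simp add: average_def sum_divide_distrib)
qed

lemma inner_W_stat: "v \<bullet> W_stat n a \<pi> = v $ 1 * scaled_desc n a \<pi> + v $ 2 * scaled_maj n a \<pi>"
  unfolding inner_real2 W_stat_def scaled_desc_def scaled_maj_def by (simp add: vector_2)

theorem theorem1p3:
  fixes A :: "nat \<Rightarrow> (nat \<Rightarrow> nat) set" and \<alpha>1 :: "nat \<Rightarrow> real" and \<alpha> :: real
  assumes "\<And>n. n \<ge> 1 \<Longrightarrow> A n \<noteq> {}"
    and "\<And>n. n \<ge> 1 \<Longrightarrow> A n \<subseteq> {\<pi>. \<pi> permutes {1..n}}"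
    and "\<And>n. n \<ge> 1 \<Longrightarrow> conj_invariant n (A n)"
    and "\<And>n \<pi> \<rho>. n \<ge> 1 \<Longrightarrow> \<pi> \<in> A n \<Longrightarrow> \<rho> \<in> A n \<Longrightarrow>
           num_fixed_points n \<pi> = num_fixed_points n \<rho>"
    and "\<And>n \<pi>. n \<ge> 1 \<Longrightarrow> \<pi> \<in> A n \<Longrightarrow> \<alpha>1 n = real (num_fixed_points n \<pi>) / real n"
    and "\<alpha> \<in> {0..1}"
    and "\<alpha>1 \<longlonglongrightarrow> \<alpha>"
  shows "\<exists>N :: (real ^ 2) measure.
           multivariate_normal N \<and> mean_vector N = 0 \<and> covariance_matrix N = Sigma_mat \<alpha> \<and>
           converges_in_distribution
             (\<lambda>n. distr (measure_pmf (pmf_of_set (A n))) borel (W_stat n (\<alpha>1 n))) N"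
proof -
  define m where "m n = num_fixed_points n (SOME \<pi>. \<pi> \<in> A n)" for n
  have some: "(SOME \<pi>. \<pi> \<in> A n) \<in> A n" if "n \<ge> 1" for n
    using assms(1)[OF that] by (simp add: some_in_eq)
  interpret conj_family A m \<alpha>1 \<alpha>
  proof
    show "num_fixed_points n \<pi> = m n" if "n \<ge> 1" "\<pi> \<in> A n" for n \<pi>
      unfolding m_def by (rule assms(4)[OF that some[OF that(1)]])
    show "\<alpha>1 n = real (m n) / real n" if "n \<ge> 1" for n
      unfolding m_def by (rule assms(5)[OF that some[OF that]])
  qed (fact assms)+
  \<comment> \<open>\<open>x\<close> and \<open>y\<close> are the diagonal entries of the covariance
    matrix; its off-diagonal entries are \<open>x / 2\<close>.\<close>
  define x where "x = (1 - 4 * \<alpha> ^ 3 + 3 * \<alpha> ^ 4) / 12"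
  define y where "y = (1 - \<alpha> ^ 3) / 36"
  have \<alpha>: "0 \<le> \<alpha>" "\<alpha> \<le> 1" using assms(6) by auto
  have "1 - 4 * \<alpha> ^ 3 + 3 * \<alpha> ^ 4 = (1 - \<alpha>)\<^sup>2 * (1 + 2 * \<alpha> + 3 * \<alpha>\<^sup>2)"
    by (simp add: power2_eq_square power3_eq_cube eval_nat_numeral algebra_simps)
  then have x: "x \<ge> 0" using \<alpha> by (simp add: x_def)
  have "y - x / 4 = ((1 - \<alpha> ^ 4) + 8 * \<alpha> ^ 3 * (1 - \<alpha>)) / 144"
    by (simp add: x_def y_def eval_nat_numeral field_simps)
  moreover have "0 \<le> (1 - \<alpha> ^ 4) + 8 * \<alpha> ^ 3 * (1 - \<alpha>)"
    using \<alpha> power_le_one[OF \<alpha>, of 4] by simp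
  ultimately have y: "y - x / 4 \<ge> 0" by simp
  \<comment> \<open>Since the off-diagonal entry is \<open>x / 2\<close>, the Cholesky factor
    involves no division by \<open>sqrt x\<close>, and the degenerate case \<alpha> = 1 needs no
    separate treatment.\<close>
  define N where "N = gaussian2 (sqrt x) (sqrt x / 2) (sqrt (y - x / 4))"
  have sq: "(sqrt x)\<^sup>2 = x" "(sqrt (y - x / 4))\<^sup>2 = y - x / 4"
    using x y by simp_all
  have cov: "covariance_matrix N = Sigma_mat \<alpha>"
  proof -
    have e: "sqrt x * (sqrt x / 2) = 1 / 24 * (1 - 4 * \<alpha> ^ 3 + 3 * \<alpha> ^ 4)"
      "(sqrt x / 2)\<^sup>2 + (sqrt (y - x / 4))\<^sup>2 = 1 / 36 * (1 - \<alpha> ^ 3)"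
      "(sqrt x)\<^sup>2 = 1 / 12 * (1 - 4 * \<alpha> ^ 3 + 3 * \<alpha> ^ 4)"
      unfolding times_divide_eq_right power2_eq_square[of "sqrt x", symmetric] power_divide sq
      by (simp_all add: x_def y_def)
    show ?thesis unfolding N_def gaussian2_covariance Sigma_mat_def e ..
  qed
  have "charfun_convergence (\<lambda>n. distr (measure_pmf (pmf_of_set (A n))) borel (W_stat n (\<alpha>1 n))) N"
  proof (rule charfun_convergence.intro)
    show "prob_space (distr (measure_pmf (pmf_of_set (A n))) borel (W_stat n (\<alpha>1 n)))" for n
      by (rule measure_pmf.prob_space_distr) simp
    show "prob_space N" "sets N = sets borel"
      unfolding N_def by (rule gaussian2_basic)+
    fix v :: "real ^ 2"
    have cm: "(\<lambda>w. cis (v \<bullet> w)) \<in> borel_measurable borel"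
      by (intro borel_measurable_continuous_onI continuous_intros)
    \<comment> \<open>Nothing is assumed about \<open>A 0\<close>, so the integrals are identified
      with averages only for n \<ge> 1.\<close>
    have "eventually (\<lambda>n. average (A n) (\<lambda>\<pi>. cis (v $ 1 * scaled_desc n (\<alpha>1 n) \<pi> + v $ 2 * scaled_maj n (\<alpha>1 n) \<pi>)) =
        (\<integral>w. cis (v \<bullet> w) \<partial>distr (measure_pmf (pmf_of_set (A n))) borel (W_stat n (\<alpha>1 n)))) sequentially"
      using eventually_ge_at_top[of 1]
    proof eventually_elim
      case (elim n)
      have "(\<integral>w. cis (v \<bullet> w) \<partial>distr (measure_pmf (pmf_of_set (A n))) borel (W_stat n (\<alpha>1 n))) =
          (\<integral>\<pi>. cis (v \<bullet> W_stat n (\<alpha>1 n) \<pi>) \<partial>measure_pmf (pmf_of_set (A n)))"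
        by (rule integral_distr[OF _ cm]) simp
      then show ?case
        unfolding inner_W_stat by (simp add: integral_pmf_of_set_eq_average[OF finite_A[OF elim] A_ne[OF elim]])
    qed
    moreover have "(\<integral>w. cis (v \<bullet> w) \<partial>N) = exp (of_real (- (((v $ 1)\<^sup>2 + v $ 1 * v $ 2) * (1 - 4 * \<alpha> ^ 3 + 3 * \<alpha> ^ 4) / 12 +
        (v $ 2)\<^sup>2 * (1 - \<alpha> ^ 3) / 36) / 2))"
    proof -
      have "(a * s + b * (s / 2))\<^sup>2 + (b * r)\<^sup>2 = (a\<^sup>2 + a * b + b\<^sup>2 / 4) * s\<^sup>2 + b\<^sup>2 * r\<^sup>2" for a b s r :: real
        by (simp add: power2_eq_square field_simps)
      then have "(v $ 1 * sqrt x + v $ 2 * (sqrt x / 2))\<^sup>2 + (v $ 2 * sqrt (y - x / 4))\<^sup>2 =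
          ((v $ 1)\<^sup>2 + v $ 1 * v $ 2 + (v $ 2)\<^sup>2 / 4) * (sqrt x)\<^sup>2 + (v $ 2)\<^sup>2 * (sqrt (y - x / 4))\<^sup>2" .
      also have "\<dots> = ((v $ 1)\<^sup>2 + v $ 1 * v $ 2) * x + (v $ 2)\<^sup>2 * y"
        unfolding sq by (simp add: power2_eq_square algebra_simps)
      also have "\<dots> = ((v $ 1)\<^sup>2 + v $ 1 * v $ 2) * (1 - 4 * \<alpha> ^ 3 + 3 * \<alpha> ^ 4) / 12 + (v $ 2)\<^sup>2 * (1 - \<alpha> ^ 3) / 36"
        by (simp add: x_def y_def)
      finally show ?thesis unfolding N_def gaussian2_cis by (simp only:  minus_divide_left exp_of_real)
    qed
    ultimately show "(\<lambda>n. \<integral>w. cis (v \<bullet> w) \<partial>distr (measure_pmf (pmf_of_set (A n))) borel (W_stat n (\<alpha>1 n))) \<longlonglongrightarrow>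
        (\<integral>w. cis (v \<bullet> w) \<partial>N)"
      using characteristic_limit[of "v $ 1" "v $ 2"] by (simp add: tendsto_cong)
  qed simp
  from charfun_convergence.converges[OF this] show ?thesis
    using gaussian2_multivariate_normal gaussian2_mean cov unfolding N_def by blast
qed

end
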